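(* Let $p,q,r\in[1,\infty)$, and let $I=(0,T)$ with $T\in(0,\infty)$ or $I=\mathbb R_+$. Let $A$ be the diagonal operator on $X_{q,r}=\ell^q(\ell^r)$ given by $(Ax)_{m,n}=2^n x_{m,n}$ with its natural maximal domain. Then $A$ has maximal $L^p$-regularity on $I$ if and only if one of the following conditions holds: (i) $p>1$ and either $q>1$ or $r=1$; (ii) $p=q=r=1$.
   Context: All Banach spaces are complex; $\mathbb R_+=(0,\infty)$. For $q,r\in[1,\infty)$, $X_{q,r}=\ell^q(\ell^r)$ is the space of scalar double sequences $x=(x_{m,n})_{m,n\ge1}$ with $\|x\|=\bigl(\sum_{m\ge1}(\sum_{n\ge1}|x_{m,n}|^r)^{q/r}\bigr)^{1/q}<\infty$. The operator $A$ is $(Ax)_{m,n}:=2^nx_{m,n}$ with domain $\{x\in X_{q,r}:(2^nx_{m,n})_{m,n}\in X_{q,r}\}$; $-A$ generates the analytic $C_0$-semigroup $(S(t)x)_{m,n}=e^{-2^nt}x_{m,n}$. Maximal $L^p$-regularity: let $A$ be a densely defined sectorial operator on a Banach space $X$ such that $-A$ generates an analytic $C_0$-semigroup $(S(t))_{t\ge0}$. For $f\in L^1_{\rm loc}(\overline I;X)$ put $u_f(t):=\int_0^tS(t-s)f(s)\,ds$, $t\in I$. For $p\in[1,\infty]$, $A$ has maximal $L^p$-regularity on $I$ if there is a constant $C$ such that for all $f\in L^p(I;X)$ one has $u_f(t)\in \mathsf D(A)$ for almost all $t\in I$ and $\|Au_f\|_{L^p(I;X)}\le C\|f\|_{L^p(I;X)}$.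 *)

theory Defs
  imports "HOL-Analysis.Analysis" "HOL-Library.Function_Algebras"
begin

instantiation "fun" :: (type, real_vector) real_vector
begin

definition scaleR_fun_def: "c *\<^sub>R f = (\<lambda>x. c *\<^sub>R f x)"

instance
  by standard (auto simp: scaleR_fun_def fun_eq_iff scaleR_add_right scaleR_add_left)

end

text \<open>
  The spaces below depend on real parameters, so a normed space is given by a carrier set
  \<open>X\<close> in an ambient real vector space together with a function \<open>nrm\<close> that is a complete norm
  on \<open>X\<close>. The Bochner notions mirror the library definitions, which require a type of class
  \<open>real_normed_vector\<close>. The values of a function need to lie in \<open>X\<close> only almost everywhere.
\<close>

definition strongly_measurable ::
    "'v::real_vector set \<Rightarrow> ('v \<Rightarrow> real) \<Rightarrow> 'a measure \<Rightarrow> ('a \<Rightarrow> 'v) \<Rightarrow> bool" where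
  "strongly_measurable X nrm M f \<longleftrightarrow>
     (AE t in M. f t \<in> X) \<and>
     (\<exists>s :: nat \<Rightarrow> 'a \<Rightarrow> 'v.
        (\<forall>i. simple_function M (s i) \<and> s i ` space M \<subseteq> X) \<and>
        (AE t in M. (\<lambda>i. nrm (f t - s i t)) \<longlonglongrightarrow> 0))"

definition has_bochner_integral_on ::
    "'v::real_vector set \<Rightarrow> ('v \<Rightarrow> real) \<Rightarrow> 'a measure \<Rightarrow> ('a \<Rightarrow> 'v) \<Rightarrow> 'v \<Rightarrow> bool" where
  "has_bochner_integral_on X nrm M f x \<longleftrightarrow>
     strongly_measurable X nrm M f \<and> x \<in> X \<and>
     (\<exists>s :: nat \<Rightarrow> 'a \<Rightarrow> 'v.
        (\<forall>i. Bochner_Integration.simple_bochner_integrable M (s i) \<and> s i ` space M \<subseteq> X) \<and>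
        (\<lambda>i. \<integral>\<^sup>+ t. ennreal (nrm (f t - s i t)) \<partial>M) \<longlonglongrightarrow> 0 \<and>
        (\<lambda>i. nrm (Bochner_Integration.simple_bochner_integral M (s i) - x)) \<longlonglongrightarrow> 0)"

definition bochner_integral_on ::
    "'v::real_vector set \<Rightarrow> ('v \<Rightarrow> real) \<Rightarrow> 'a measure \<Rightarrow> ('a \<Rightarrow> 'v) \<Rightarrow> 'v" where
  "bochner_integral_on X nrm M f = (THE x. has_bochner_integral_on X nrm M f x)"

definition Lp_fun ::
    "'v::real_vector set \<Rightarrow> ('v \<Rightarrow> real) \<Rightarrow> real \<Rightarrow> 'a measure \<Rightarrow> ('a \<Rightarrow> 'v) \<Rightarrow> bool" where
  "Lp_fun X nrm p M f \<longleftrightarrow>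
     strongly_measurable X nrm M f \<and> (\<integral>\<^sup>+ t. ennreal (nrm (f t) powr p) \<partial>M) < \<infinity>"

definition Lp_norm :: "('v \<Rightarrow> real) \<Rightarrow> real \<Rightarrow> 'a measure \<Rightarrow> ('a \<Rightarrow> 'v) \<Rightarrow> real" where
  "Lp_norm nrm p M f = enn2real (\<integral>\<^sup>+ t. ennreal (nrm (f t) powr p) \<partial>M) powr (1 / p)"

definition mild_solution ::
    "'v::real_vector set \<Rightarrow> ('v \<Rightarrow> real) \<Rightarrow> (real \<Rightarrow> 'v \<Rightarrow> 'v) \<Rightarrow> (real \<Rightarrow> 'v) \<Rightarrow> real \<Rightarrow> 'v" where
  "mild_solution X nrm S f t =
     bochner_integral_on X nrm (lebesgue_on {0<..<t}) (\<lambda>s. S (t - s) (f s))"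

text \<open>
  An unbounded operator is a pair of a domain \<open>D\<close> and a map \<open>A\<close> that is meaningful on \<open>D\<close>;
  \<open>S\<close> is the semigroup generated by \<open>-A\<close>. Only finite exponents \<open>p\<close> are covered. The
  mild solution lies in \<open>D\<close> only almost everywhere, hence its image under \<open>A\<close> lies in \<open>X\<close>
  only almost everywhere.
\<close>

definition maximal_Lp_regularity ::
    "'v::real_vector set \<Rightarrow> ('v \<Rightarrow> real) \<Rightarrow> 'v set \<Rightarrow> ('v \<Rightarrow> 'v) \<Rightarrow> (real \<Rightarrow> 'v \<Rightarrow> 'v) \<Rightarrow>
     real \<Rightarrow> real set \<Rightarrow> bool" where
  "maximal_Lp_regularity X nrm D A S p I \<longleftrightarrow>
     (\<exists>C. \<forall>f. Lp_fun X nrm p (lebesgue_on I) f \<longrightarrow>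
        (AE t in lebesgue_on I. mild_solution X nrm S f t \<in> D) \<and>
        Lp_fun X nrm p (lebesgue_on I) (\<lambda>t. A (mild_solution X nrm S f t)) \<and>
        Lp_norm nrm p (lebesgue_on I) (\<lambda>t. A (mild_solution X nrm S f t))
          \<le> C * Lp_norm nrm p (lebesgue_on I) f)"

text \<open>
  The mathematical index set starts at 1, the type \<open>nat\<close> at 0: \<open>x m n\<close> stands for the entry with
  indices \<open>m + 1\<close> and \<open>n + 1\<close>, so the eigenvalue belonging to \<open>n\<close> is \<open>2 ^ (n + 1)\<close>.
\<close>

type_synonym dseq = "nat \<Rightarrow> nat \<Rightarrow> complex"

definition lqr_space :: "real \<Rightarrow> real \<Rightarrow> dseq set" where
  "lqr_space q r = {x. (\<forall>m. summable (\<lambda>n. norm (x m n) powr r)) \<and>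
                       summable (\<lambda>m. (\<Sum>n. norm (x m n) powr r) powr (q / r))}"

definition lqr_norm :: "real \<Rightarrow> real \<Rightarrow> dseq \<Rightarrow> real" where
  "lqr_norm q r x = (\<Sum>m. (\<Sum>n. norm (x m n) powr r) powr (q / r)) powr (1 / q)"

definition diag_op :: "dseq \<Rightarrow> dseq" where
  "diag_op x = (\<lambda>m n. 2 ^ (n + 1) * x m n)"

definition diag_dom :: "real \<Rightarrow> real \<Rightarrow> dseq set" where
  "diag_dom q r = {x \<in> lqr_space q r. diag_op x \<in> lqr_space q r}"

definition diag_semigroup :: "real \<Rightarrow> dseq \<Rightarrow> dseq" where
  "diag_semigroup t x = (\<lambda>m n. of_real (exp (- (2 ^ (n + 1)) * t)) * x m n)"

text \<open>
  The following facts confirm that \<^const>\<open>diag_semigroup\<close> is a strongly continuous contraction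
  semigroup on \<^const>\<open>lqr_space\<close> and that its generator is exactly \<open>-\<close>\<^const>\<open>diag_op\<close> with
  domain \<^const>\<open>diag_dom\<close>.
\<close>

lemma lqr_dominated:
  assumes "q \<ge> 1" "r \<ge> 1" and x: "x \<in> lqr_space q r"
    and y: "\<And>m n. norm (y m n) \<le> norm (x m n)"
  shows "y \<in> lqr_space q r" "lqr_norm q r y \<le> lqr_norm q r x"
proof -
  have qr: "q / r \<ge> 0" "1 / q \<ge> 0" using assms by auto
  have le: "norm (y m n) powr r \<le> norm (x m n) powr r" for m n
    using y assms by (intro powr_mono2) auto
  have sx: "summable (\<lambda>n. norm (x m n) powr r)" for m using x by (auto simp: lqr_space_def)
  have sy: "summable (\<lambda>n. norm (y m n) powr r)" for m
    by (rule summable_comparison_test'[OF sx[of m], of 0]) (use le in auto)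
  have inner: "(\<Sum>n. norm (y m n) powr r) powr (q / r) \<le> (\<Sum>n. norm (x m n) powr r) powr (q / r)" for m
    by (intro powr_mono2 qr suminf_nonneg suminf_le sx sy le) auto
  have ox: "summable (\<lambda>m. (\<Sum>n. norm (x m n) powr r) powr (q / r))"
    using x by (auto simp: lqr_space_def)
  have oy: "summable (\<lambda>m. (\<Sum>n. norm (y m n) powr r) powr (q / r))"
    by (rule summable_comparison_test'[OF ox, of 0]) (use inner in auto)
  show "y \<in> lqr_space q r" using sy oy by (auto simp: lqr_space_def)
  show "lqr_norm q r y \<le> lqr_norm q r x"
    unfolding lqr_norm_def by (intro powr_mono2 qr suminf_nonneg suminf_le ox oy inner) auto
qed

lemma lqr_coord_le:
  assumes "q \<ge> 1" "r \<ge> 1" and x: "x \<in> lqr_space q r"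
  shows "norm (x m n) \<le> lqr_norm q r x"
proof -
  have sx: "summable (\<lambda>n. norm (x m n) powr r)" and
    ox: "summable (\<lambda>m. (\<Sum>n. norm (x m n) powr r) powr (q / r))"
    using x by (auto simp: lqr_space_def)
  have "norm (x m n) powr r \<le> (\<Sum>n. norm (x m n) powr r)"
    using sum_le_suminf[OF sx, of "{n}"] by auto
  then have "(norm (x m n) powr r) powr (q / r) \<le> (\<Sum>n. norm (x m n) powr r) powr (q / r)"
    using assms by (intro powr_mono2) auto
  also have "\<dots> \<le> (\<Sum>m. (\<Sum>n. norm (x m n) powr r) powr (q / r))"
    using sum_le_suminf[OF ox, of "{m}"] by auto
  finally have "((norm (x m n) powr r) powr (q / r)) powr (1 / q) \<le> lqr_norm q r x"
    unfolding lqr_norm_def using assms by (intro powr_mono2) auto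
  then show ?thesis using assms by (simp add: powr_powr)
qed

lemma lqr_tannery:
  fixes c :: "real \<Rightarrow> nat \<Rightarrow> real"
  assumes "q \<ge> 1" "r \<ge> 1" and x: "x \<in> lqr_space q r"
    and c: "\<And>h n. h > 0 \<Longrightarrow> \<bar>c h n\<bar> \<le> 1"
    and c0: "\<And>n. ((\<lambda>h. c h n) \<longlongrightarrow> 0) (at_right 0)"
  shows "((\<lambda>h. lqr_norm q r (\<lambda>m n. of_real (c h n) * x m n)) \<longlongrightarrow> 0) (at_right 0)"
proof -
  define y where "y h = (\<lambda>m n. of_real (c h n) * x m n)" for h
  have pos: "eventually (\<lambda>h::real. h > 0) (at_right 0)" by (simp add: eventually_at_right_less)
  have yx: "norm (y h m n) \<le> norm (x m n)" if "h > 0" for h m n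
    using c[OF that, of n] by (simp add: y_def norm_mult mult_left_le_one_le)
  have sx: "summable (\<lambda>n. norm (x m n) powr r)" for m using x by (auto simp: lqr_space_def)
  have ox: "summable (\<lambda>m. (\<Sum>n. norm (x m n) powr r) powr (q / r))"
    using x by (auto simp: lqr_space_def)
  have le: "norm (y h m n) powr r \<le> norm (x m n) powr r" if "h > 0" for h m n
    using yx[OF that] assms by (intro powr_mono2) auto
  have sy: "summable (\<lambda>n. norm (y h m n) powr r)" if "h > 0" for h m
    by (rule summable_comparison_test'[OF sx[of m], of 0]) (use le[OF that] in auto)
  have y0: "((\<lambda>h. norm (y h m n)) \<longlongrightarrow> 0) (at_right 0)" for m n
  proof -
    have "((\<lambda>h. \<bar>c h n\<bar> * norm (x m n)) \<longlongrightarrow> \<bar>0\<bar> * norm (x m n)) (at_right 0)"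
      by (intro tendsto_intros c0)
    then show ?thesis by (simp add: y_def norm_mult)
  qed
  have in0: "((\<lambda>h. \<Sum>n. norm (y h m n) powr r) \<longlongrightarrow> 0) (at_right 0)" for m
  proof -
    have "((\<lambda>h. \<Sum>n. norm (y h m n) powr r) \<longlongrightarrow> (\<Sum>n. 0)) (at_right 0)"
    proof (rule tannerys_theorem[where M = "\<lambda>n. norm (x m n) powr r", THEN conjunct2, THEN conjunct2])
      show "((\<lambda>h. norm (y h m n) powr r) \<longlongrightarrow> 0) (at_right 0)" for n
        using y0[of m n] assms by (intro tendsto_zero_powrI) auto
      show "\<forall>\<^sub>F (n, h) in at_top \<times>\<^sub>F at_right 0. norm (norm (y h m n) powr r) \<le> norm (x m n) powr r"
        unfolding eventually_prod_filter
        by (rule exI[of _ "\<lambda>_. True"], rule exI[of _ "\<lambda>h. h > 0"]) (use pos le in auto)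
    qed (use sx in auto)
    then show ?thesis by simp
  qed
  have "((\<lambda>h. \<Sum>m. (\<Sum>n. norm (y h m n) powr r) powr (q / r)) \<longlongrightarrow> (\<Sum>m. 0)) (at_right 0)"
  proof (rule tannerys_theorem[where M = "\<lambda>m. (\<Sum>n. norm (x m n) powr r) powr (q / r)", THEN conjunct2, THEN conjunct2])
    show "((\<lambda>h. (\<Sum>n. norm (y h m n) powr r) powr (q / r)) \<longlongrightarrow> 0) (at_right 0)" for m
      using assms
      by (intro tendsto_zero_powrI[OF in0 tendsto_const])
         (auto intro!: eventually_mono[OF pos] suminf_nonneg sy)
    have "norm ((\<Sum>n. norm (y h m n) powr r) powr (q / r)) \<le> (\<Sum>n. norm (x m n) powr r) powr (q / r)"
      if "h > 0" for h m
      unfolding real_norm_def abs_of_nonneg[OF powr_ge_zero]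
      using assms by (intro powr_mono2 suminf_nonneg suminf_le sx sy le that) auto
    then show "\<forall>\<^sub>F (m, h) in at_top \<times>\<^sub>F at_right 0.
        norm ((\<Sum>n. norm (y h m n) powr r) powr (q / r)) \<le> (\<Sum>n. norm (x m n) powr r) powr (q / r)"
      unfolding eventually_prod_filter
      by (intro exI[of _ "\<lambda>_. True"] exI[of _ "\<lambda>h. h > 0"]) (use pos in auto)
  qed (use ox in auto)
  then have lim: "((\<lambda>h. \<Sum>m. (\<Sum>n. norm (y h m n) powr r) powr (q / r)) \<longlongrightarrow> 0) (at_right 0)" by simp
  have oy: "summable (\<lambda>m. (\<Sum>n. norm (y h m n) powr r) powr (q / r))" if "h > 0" for h
    using lqr_dominated(1)[OF assms(1,2) x, of "y h"] yx[OF that] by (auto simp: lqr_space_def)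
  have "((\<lambda>h. lqr_norm q r (y h)) \<longlongrightarrow> 0) (at_right 0)"
    unfolding lqr_norm_def using assms
    by (intro tendsto_zero_powrI[OF lim tendsto_const])
       (auto intro!: eventually_mono[OF pos] suminf_nonneg oy)
  then show ?thesis by (simp add: y_def)
qed

lemma diag_semigroup_0: "diag_semigroup 0 x = x"
  by (simp add: diag_semigroup_def)

lemma diag_semigroup_add: "diag_semigroup (s + t) x = diag_semigroup s (diag_semigroup t x)"
  by (simp add: diag_semigroup_def fun_eq_iff algebra_simps exp_diff exp_minus
      divide_inverse del: of_real_exp)

lemma diag_semigroup_contraction:
  assumes "q \<ge> 1" "r \<ge> 1" "x \<in> lqr_space q r" "t \<ge> 0"
  shows "diag_semigroup t x \<in> lqr_space q r"
    and "lqr_norm q r (diag_semigroup t x) \<le> lqr_norm q r x"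
  using lqr_dominated[OF assms(1-3), of "diag_semigroup t x"] assms(4)
  by (auto simp: diag_semigroup_def norm_mult mult_left_le_one_le simp del: of_real_exp)

lemma diag_semigroup_continuous:
  assumes "q \<ge> 1" "r \<ge> 1" "x \<in> lqr_space q r"
  shows "((\<lambda>t. lqr_norm q r (diag_semigroup t x - x)) \<longlongrightarrow> 0) (at_right 0)"
proof -
  have "((\<lambda>h. lqr_norm q r (\<lambda>m n. of_real (exp (- (2 ^ (n + 1)) * h) - 1) * x m n)) \<longlongrightarrow> 0) (at_right 0)"
  proof (rule lqr_tannery[OF assms])
    show "\<bar>exp (- (2 ^ (n + 1)) * h) - 1\<bar> \<le> 1" if "h > 0" for h :: real and n :: nat
      using that by (auto simp: abs_if add_nonneg_nonneg)
    show "((\<lambda>h::real. exp (- (2 ^ (n + 1)) * h) - 1) \<longlongrightarrow> 0) (at_right 0)" for n :: nat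
      by (rule tendsto_eq_intros refl | simp)+
  qed
  moreover have "diag_semigroup t x - x = (\<lambda>m n. of_real (exp (- (2 ^ (n + 1)) * t) - 1) * x m n)" for t
    by (simp add: diag_semigroup_def fun_eq_iff algebra_simps)
  ultimately show ?thesis by simp
qed

lemma diag_generator_quotient:
  "((\<lambda>h::real. (exp (- a * h) - 1) / h) \<longlongrightarrow> - a) (at_right 0)"
proof -
  have "((\<lambda>h. exp (- a * h)) has_real_derivative (- a)) (at 0)"
    by (auto intro!: derivative_eq_intros)
  then have "((\<lambda>h. (exp (- a * h) - 1) / h) \<longlongrightarrow> - a) (at 0)"
    by (simp add: has_field_derivative_iff)
  then show ?thesis by (rule filterlim_at_split[THEN iffD1, THEN conjunct2])
qed

lemma lqr_diff:
  assumes "q \<ge> 1" "r \<ge> 1" and u: "u \<in> lqr_space q r" and v: "v \<in> lqr_space q r"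
  shows "u - v \<in> lqr_space q r"
proof -
  have quasi: "c powr s \<le> 2 powr s * (a powr s + b powr s)"
    if "0 \<le> a" "0 \<le> b" "0 \<le> c" "c \<le> a + b" "s \<ge> 0" for a b c s :: real
  proof -
    have "c powr s \<le> (2 * max a b) powr s" using that by (intro powr_mono2) auto
    also have "\<dots> = 2 powr s * max a b powr s" using that by (simp add: powr_mult)
    also have "\<dots> \<le> 2 powr s * (a powr s + b powr s)"
      by (intro mult_left_mono) (auto simp: max_def)
    finally show ?thesis .
  qed
  have su: "summable (\<lambda>n. norm (u m n) powr r)" and sv: "summable (\<lambda>n. norm (v m n) powr r)" for m
    using u v by (auto simp: lqr_space_def)
  have le: "norm ((u - v) m n) powr r \<le> 2 powr r * (norm (u m n) powr r + norm (v m n) powr r)"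
    for m n
    using assms by (intro quasi) (auto simp: norm_triangle_ineq4)
  have smaj: "summable (\<lambda>n. 2 powr r * (norm (u m n) powr r + norm (v m n) powr r))" for m
    by (intro summable_mult summable_add su sv)
  have sd: "summable (\<lambda>n. norm ((u - v) m n) powr r)" for m
    by (rule summable_comparison_test'[OF smaj[of m], of 0]) (use le in auto)
  define U where "U m = (\<Sum>n. norm (u m n) powr r)" for m
  define V where "V m = (\<Sum>n. norm (v m n) powr r)" for m
  define K where "K = (2 powr r) powr (q / r)"
  have U0: "U m \<ge> 0" and V0: "V m \<ge> 0" for m
    by (auto simp: U_def V_def intro!: suminf_nonneg su sv)
  have "(\<Sum>n. norm ((u - v) m n) powr r) \<le> (\<Sum>n. 2 powr r * (norm (u m n) powr r + norm (v m n) powr r))" for m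
    by (intro suminf_le le sd smaj)
  also have "(\<Sum>n. 2 powr r * (norm (u m n) powr r + norm (v m n) powr r)) = 2 powr r * (U m + V m)" for m
    using su[of m] sv[of m] by (simp add: U_def V_def suminf_mult suminf_add summable_add)
  finally have in_le: "(\<Sum>n. norm ((u - v) m n) powr r) \<le> 2 powr r * (U m + V m)" for m .
  have out_le: "(\<Sum>n. norm ((u - v) m n) powr r) powr (q / r)
      \<le> K * (2 powr (q / r) * (U m powr (q / r) + V m powr (q / r)))" for m
  proof -
    have "(\<Sum>n. norm ((u - v) m n) powr r) powr (q / r) \<le> (2 powr r * (U m + V m)) powr (q / r)"
      using assms by (intro powr_mono2 in_le suminf_nonneg sd) auto
    also have "\<dots> = K * (U m + V m) powr (q / r)"
      using U0 V0 by (simp add: K_def powr_mult)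
    also have "\<dots> \<le> K * (2 powr (q / r) * (U m powr (q / r) + V m powr (q / r)))"
      using assms U0[of m] V0[of m] by (intro mult_left_mono quasi) (auto simp: K_def)
    finally show ?thesis .
  qed
  have omaj: "summable (\<lambda>m. K * (2 powr (q / r) * (U m powr (q / r) + V m powr (q / r))))"
    using u v by (intro summable_mult summable_add) (auto simp: lqr_space_def U_def V_def)
  have "summable (\<lambda>m. (\<Sum>n. norm ((u - v) m n) powr r) powr (q / r))"
    by (rule summable_comparison_test'[OF omaj, of 0]) (use out_le in auto)
  then show ?thesis using sd by (auto simp: lqr_space_def)
qed

lemma lqr_scaleR:
  assumes "q \<ge> 1" "r \<ge> 1" and x: "x \<in> lqr_space q r"
  shows "c *\<^sub>R x \<in> lqr_space q r"
proof -
  have sx: "summable (\<lambda>n. norm (x m n) powr r)" for m using x by (auto simp: lqr_space_def)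
  have eq: "norm ((c *\<^sub>R x) m n) powr r = \<bar>c\<bar> powr r * norm (x m n) powr r" for m n
    by (simp add: scaleR_fun_def powr_mult)
  have "(\<Sum>n. norm ((c *\<^sub>R x) m n) powr r) powr (q / r)
      = (\<bar>c\<bar> powr r) powr (q / r) * (\<Sum>n. norm (x m n) powr r) powr (q / r)" for m
    unfolding eq suminf_mult[OF sx] by (intro powr_mult)
  then show ?thesis
    using x unfolding lqr_space_def by (auto simp: eq intro!: summable_mult)
qed

lemma diag_semigroup_generator:
  assumes q: "q \<ge> 1" and r: "r \<ge> 1" and x: "x \<in> lqr_space q r" and y: "y \<in> lqr_space q r"
  shows "((\<lambda>h. lqr_norm q r ((1 / h) *\<^sub>R (diag_semigroup h x - x) - y)) \<longlongrightarrow> 0) (at_right 0)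
           \<longleftrightarrow> x \<in> diag_dom q r \<and> y = - diag_op x" (is "?L \<longleftrightarrow> ?R")
proof
  define d where "d n h = (exp (- (2 ^ (n + 1)) * h) - 1) / h" for n :: nat and h :: real
  have d_lim: "((\<lambda>h. d n h) \<longlongrightarrow> - (2 ^ (n + 1))) (at_right 0)" for n
    unfolding d_def by (rule diag_generator_quotient)
  have quot: "((1 / h) *\<^sub>R (diag_semigroup h x - x) - w) m n = of_real (d n h) * x m n - w m n"
    for h w m n
    by (simp add: diag_semigroup_def scaleR_fun_def d_def scaleR_conv_of_real field_simps
        flip: exp_of_real)
  have pos: "eventually (\<lambda>h::real. h > 0) (at_right 0)" by (simp add: eventually_at_right_less)
  show ?R if ?L
  proof -
    have "y m n = - diag_op x m n" for m n
    proof -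
      have mem: "(1 / h) *\<^sub>R (diag_semigroup h x - x) - y \<in> lqr_space q r" if "h > 0" for h
      proof -
        have w: "diag_semigroup h x - x \<in> lqr_space q r"
          using that by (intro lqr_diff q r diag_semigroup_contraction(1) x) auto
        from lqr_scaleR[OF q r w, of "1 / h"] that
        have "(1 / h) *\<^sub>R (diag_semigroup h x - x) \<in> lqr_space q r" by simp
        then show ?thesis by (intro lqr_diff q r y)
      qed
      have "((\<lambda>h. ((1 / h) *\<^sub>R (diag_semigroup h x - x) - y) m n) \<longlongrightarrow> 0) (at_right 0)"
        by (rule Lim_null_comparison[OF eventually_mono[OF pos] that])
           (rule lqr_coord_le[OF q r mem])
      then have "((\<lambda>h. of_real (d n h) * x m n - y m n) \<longlongrightarrow> 0) (at_right 0)"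
        unfolding quot .
      moreover have "((\<lambda>h. of_real (d n h) * x m n - y m n) \<longlongrightarrow>
          of_real (- (2 ^ (n + 1))) * x m n - y m n) (at_right 0)"
        by (intro tendsto_intros d_lim)
      ultimately have "of_real (- (2 ^ (n + 1))) * x m n - y m n = 0"
        by (intro tendsto_unique[OF trivial_limit_at_right_real])
      then show ?thesis by (simp add: diag_op_def)
    qed
    then have eq: "y = - diag_op x" by (simp add: fun_eq_iff)
    moreover have "diag_op x \<in> lqr_space q r"
      by (rule lqr_dominated(1)[OF q r y]) (simp add: eq)
    ultimately show ?R using x by (simp add: diag_dom_def)
  qed
  show ?L if ?R
  proof -
    have ax: "diag_op x \<in> lqr_space q r" and y: "y = - diag_op x"
      using that by (auto simp: diag_dom_def)
    define c where "c h n = d n h / 2 ^ (n + 1) + 1" for h n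
    have "((\<lambda>h. lqr_norm q r (\<lambda>m n. of_real (c h n) * diag_op x m n)) \<longlongrightarrow> 0) (at_right 0)"
    proof (rule lqr_tannery[OF q r ax])
      show "\<bar>c h n\<bar> \<le> 1" if h: "h > 0" for h n
      proof -
        define l :: real where "l = 2 ^ (n + 1)"
        have l: "l > 0" by (simp add: l_def)
        have e1: "exp (- l * h) \<le> 1" using h l by simp
        have e2: "exp (- l * h) \<ge> 1 - l * h" using exp_ge_add_one_self[of "- l * h"] by simp
        have "c h n = (exp (- l * h) - 1) / (l * h) + 1"
          by (simp add: c_def d_def l_def)
        moreover have "(exp (- l * h) - 1) / (l * h) \<le> 0"
          using e1 h l by (intro divide_nonpos_pos) auto
        moreover have "(exp (- l * h) - 1) / (l * h) \<ge> -1"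
          using e2 h l by (simp add: pos_le_divide_eq)
        ultimately show ?thesis by linarith
      qed
      show "((\<lambda>h. c h n) \<longlongrightarrow> 0) (at_right 0)" for n
      proof -
        have "((\<lambda>h. c h n) \<longlongrightarrow> - (2 ^ (n + 1)) / 2 ^ (n + 1) + 1) (at_right 0)"
          unfolding c_def by (intro tendsto_intros d_lim) auto
        then show ?thesis by simp
      qed
    qed
    moreover have "(1 / h) *\<^sub>R (diag_semigroup h x - x) - y
        = (\<lambda>m n. of_real (c h n) * diag_op x m n)" for h
      by (intro ext, subst quot) (simp add: y c_def diag_op_def field_simps)
    ultimately show ?L by simp
  qed
qed

end

theory Submission
  imports Defs
begin

text \<open>
  The operator \<open>f \<mapsto> A u\<^sub>f\<close> acts on the coordinates separately: with \<open>l = 2 ^ (n + 1)\<close>, the entry with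
  index \<open>(m, n)\<close> of \<open>A u\<^sub>f\<close> at time \<open>t\<close> is the integral of \<open>l * exp (- l * (t - s)) * f s m n\<close> over
  \<open>0 < s < t\<close>. Maximal regularity thus asks whether these positive integral operators \<open>T\<^sub>n\<close>, one for
  each \<open>n\<close>, are jointly bounded on the mixed norm space \<open>L\<^sup>p(\<ell>\<^sup>q(\<ell>\<^sup>r))\<close>, and by positivity it suffices to
  look at functions with values in \<open>[0, \<infinity>]\<close>.

  Sufficiency. Each \<open>T\<^sub>n f\<close> and each adjoint \<open>T\<^sub>n\<^sup>* f\<close> is dominated by a multiple of the Hardy--Littlewood
  maximal function \<open>M f\<close>, uniformly in \<open>n\<close>. For \<open>p, q > 1\<close> the bound comes from three facts.

    \<^item> \<open>M\<close> is bounded on \<open>L\<^sup>p(\<ell>\<^sup>q)\<close>, the Fefferman--Stein inequality (\<open>maximal_fun_mixed\<close>). A covering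
      argument and the layer cake formula give the weighted inequality
      \<open>\<integral> (M f)\<^sup>q w \<le> C \<integral> f\<^sup>q M w\<close> (\<open>maximal_fun_weighted\<close>), which is the case \<open>p = q\<close> when \<open>w = 1\<close>. For
      \<open>q < p\<close>, test the \<open>q\<close>-th power of the \<open>\<ell>\<^sup>q\<close> norm against a weight from the dual space. For \<open>p < q\<close>,
      interpolate between \<open>L\<^sup>p(\<ell>\<^sup>p)\<close> and \<open>L\<^sup>p(\<ell>\<^sup>\<infinity>)\<close>.
    \<^item> Dualising, the case \<open>r = 1\<close> is the Fefferman--Stein inequality for the conjugate exponents
      (\<open>kernel_op_sum_bounded\<close>), because a single dual function \<open>g\<^sub>m\<close> is paired with all \<open>T\<^sub>n f\<^sub>m\<^sub>n\<close>.
    \<^item> The case \<open>r = \<infinity>\<close> is again the Fefferman--Stein inequality, as \<open>sup\<^sub>n T\<^sub>n f\<^sub>m\<^sub>n \<le> C M (sup\<^sub>n f\<^sub>m\<^sub>n)\<close>,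
      and \<open>1 \<le> r < \<infinity>\<close> lies in between (\<open>kernel_op_bounded\<close>).

  Interpolation is elementary here. A positive operator satisfies
  \<open>T (f\<^sup>1\<^sup>-\<^sup>\<theta> g\<^sup>\<theta>) \<le> (T f)\<^sup>1\<^sup>-\<^sup>\<theta> (T g)\<^sup>\<theta>\<close> by Hoelder's inequality, so it is enough to write a function as such a
  geometric mean (\<open>lattice_factor\<close>) and to apply Hoelder's inequality once more to the norms. For
  \<open>q = r = 1 < p\<close> the pairs \<open>(m, n)\<close> form one index set, and the duality argument with a single \<open>m\<close>
  applies. For \<open>p = q = r = 1\<close> Tonelli's theorem is enough.

  Necessity. For \<open>p = 1 < q\<close> take \<open>f\<close> to be constantly \<open>\<Sum>\<^sub>n e\<^sub>n\<^sub>n\<close>, with \<open>N\<close> consecutive indices \<open>n\<close>, on a very short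
  interval \<open>(0, \<epsilon>)\<close>. At a time of order \<open>1 / l\<close> the entry for the eigenvalue \<open>l\<close> alone contributes
  \<open>\<epsilon> * l\<close>, so the \<open>L\<^sup>1\<close> norm of \<open>A u\<^sub>f\<close> is of order \<open>N * \<epsilon>\<close> while that of \<open>f\<close> is \<open>N\<^sup>1\<^sup>/\<^sup>q * \<epsilon>\<close>
  (\<open>not_maximal_L1_regularity\<close>). For \<open>q = 1 < r\<close> cut a time interval into very short cells and let \<open>f\<close> on
  the \<open>m\<close>-th cell be the indicator of \<open>N\<close> consecutive indices in row \<open>m\<close>. Its norm is \<open>N\<^sup>1\<^sup>/\<^sup>r\<close> at all times. At
  a later time the cells at distance of order \<open>1 / l\<close> contribute through the entry of \<open>l\<close> a fixed amount
  in total, and summing over the \<open>N\<close> eigenvalues shows that the norm of \<open>A u\<^sub>f\<close> is of order \<open>N\<close>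
  (\<open>not_maximal_regularity_l1\<close>). Both times \<open>N \<rightarrow> \<infinity>\<close> contradicts boundedness.

  Both parts use that the Bochner integral that defines the mild solution is the coordinatewise Lebesgue
  integral (\<open>has_bochner_integral_on_lqr\<close>). This rests on Minkowski's integral
  inequality for \<open>\<ell>\<^sup>q(\<ell>\<^sup>r)\<close>.
\<close>

section \<open>Real powers of extended nonnegative reals\<close>

text \<open>
  Giving exponent \<open>0\<close> the value \<open>1\<close>, also at \<open>0\<close> and at \<open>\<infinity>\<close>, makes the laws of exponents hold
  without exceptions for all nonnegative exponents.
\<close>

definition powe :: "ennreal \<Rightarrow> real \<Rightarrow> ennreal" (infixr "powe" 80) where
  "x powe a = (if a = 0 then 1 else if x = top then top else ennreal (enn2real x powr a))"

lemma powe_zero [simp]: "x powe 0 = 1"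
  by (simp add: powe_def)

lemma powe_one [simp]: "x powe 1 = x"
  by (cases x) (auto simp: powe_def)

lemma zero_powe [simp]: "a \<noteq> 0 \<Longrightarrow> 0 powe a = 0"
  by (simp add: powe_def)

lemma one_powe [simp]: "1 powe a = 1"
  by (simp add: powe_def)

lemma top_powe [simp]: "a \<noteq> 0 \<Longrightarrow> top powe a = top"
  by (simp add: powe_def)

lemma ennreal_powe: "x \<ge> 0 \<Longrightarrow> a \<noteq> 0 \<Longrightarrow> ennreal x powe a = ennreal (x powr a)"
  by (simp add: powe_def)

lemma powe_eq_top_iff [simp]: "x powe a = top \<longleftrightarrow> a \<noteq> 0 \<and> x = top"
  by (simp add: powe_def)

lemma powe_eq_0_iff [simp]: "x powe a = 0 \<longleftrightarrow> a \<noteq> 0 \<and> x = 0"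
  by (cases x) (auto simp: powe_def)

lemma powe_less_top_iff [simp]: "x powe a < top \<longleftrightarrow> a = 0 \<or> x < top"
  by (auto simp: less_top[symmetric])

lemma powe_mono: "x \<le> y \<Longrightarrow> 0 \<le> a \<Longrightarrow> x powe a \<le> y powe a"
  by (cases x; cases y) (auto simp: powe_def top_unique intro!: powr_mono2 ennreal_leI)

lemma powe_mult: "0 \<le> a \<Longrightarrow> (x * y) powe a = x powe a * y powe a"
  by (cases x; cases y)
     (auto simp: powe_def ennreal_mult_top ennreal_top_mult powr_mult simp flip: ennreal_mult')

lemma powe_powe: "0 \<le> a \<Longrightarrow> 0 \<le> b \<Longrightarrow> (x powe a) powe b = x powe (a * b)"
  by (cases x) (auto simp: powe_def powr_powr)

lemma powe_add: "0 \<le> a \<Longrightarrow> 0 \<le> b \<Longrightarrow> x powe (a + b) = x powe a * x powe b"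
  by (cases x) (auto simp: powe_def powr_add ennreal_mult' ennreal_mult_top ennreal_top_mult)

lemma powe_inverse [simp]: "0 < a \<Longrightarrow> (x powe a) powe (1 / a) = x" "0 < a \<Longrightarrow> (x powe (1 / a)) powe a = x"
  by (simp_all add: powe_powe)

lemma powe_SUP:
  assumes "0 < a"
  shows "(SUP i\<in>A. f i) powe a = (SUP i\<in>A. f i powe a)"
proof (rule antisym)
  have "(SUP i\<in>A. f i) \<le> (SUP i\<in>A. f i powe a) powe (1 / a)"
  proof (rule SUP_least)
    fix i assume "i \<in> A"
    then have "(f i powe a) powe (1 / a) \<le> (SUP i\<in>A. f i powe a) powe (1 / a)"
      using assms by (intro powe_mono SUP_upper) auto
    then show "f i \<le> (SUP i\<in>A. f i powe a) powe (1 / a)" using assms by simp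
  qed
  then have "(SUP i\<in>A. f i) powe a \<le> ((SUP i\<in>A. f i powe a) powe (1 / a)) powe a"
    using assms by (intro powe_mono) auto
  then show "(SUP i\<in>A. f i) powe a \<le> (SUP i\<in>A. f i powe a)" using assms by simp
qed (use assms in \<open>auto intro!: SUP_least powe_mono SUP_upper\<close>)

lemma measurable_powe [measurable (raw)]:
  assumes [measurable]: "f \<in> borel_measurable M"
  shows "(\<lambda>x. f x powe a) \<in> borel_measurable M"
  unfolding powe_def by measurable

section \<open>Hoelder's inequality and geometric means\<close>

lemma young_powe:
  assumes "0 < \<theta>" "\<theta> < 1"
  shows "a powe (1 - \<theta>) * b powe \<theta> \<le> ennreal (1 - \<theta>) * a + ennreal \<theta> * b"
proof (cases "a = top \<or> b = top \<or> a = 0 \<or> b = 0")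
  case True
  then show ?thesis using assms by (auto simp: ennreal_mult_top)
next
  case False
  then obtain x y where xy: "a = ennreal x" "b = ennreal y" "x > 0" "y > 0"
    by (cases a; cases b) (auto simp: order_less_le)
  then show ?thesis
    using Youngs_inequality_0[of "1 - \<theta>" \<theta> x y] assms
    by (auto simp: ennreal_powe intro!: ennreal_leI simp flip: ennreal_mult' ennreal_plus)
qed

text \<open>
  This geometric mean form of Hoelder's inequality admits the end points \<open>\<theta> = 0\<close> and \<open>\<theta> = 1\<close> and is the
  one that interpolation uses. It follows by integrating Young's inequality after \<open>f\<close> and \<open>g\<close> have been
  normalised. With a counting measure it becomes an inequality for series.
\<close>

lemma nn_integral_Hoelder:
  assumes [measurable]: "f \<in> borel_measurable M" "g \<in> borel_measurable M"
    and "0 \<le> \<theta>" "\<theta> \<le> 1"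
  shows "(\<integral>\<^sup>+x. f x powe (1 - \<theta>) * g x powe \<theta> \<partial>M)
           \<le> (\<integral>\<^sup>+x. f x \<partial>M) powe (1 - \<theta>) * (\<integral>\<^sup>+x. g x \<partial>M) powe \<theta>"
proof (cases "\<theta> = 0 \<or> \<theta> = 1")
  case True
  then show ?thesis by auto
next
  case False
  then have \<theta>: "0 < \<theta>" "\<theta> < 1" using assms by auto
  define F where "F = (\<integral>\<^sup>+x. f x \<partial>M)"
  define G where "G = (\<integral>\<^sup>+x. g x \<partial>M)"
  consider "F = 0 \<or> G = 0" | "F \<noteq> 0" "G \<noteq> 0" "F = top \<or> G = top"
    | "F \<noteq> 0" "G \<noteq> 0" "F \<noteq> top" "G \<noteq> top" by blast
  then show ?thesis
  proof cases
    case 1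
    have "AE x in M. f x powe (1 - \<theta>) * g x powe \<theta> = 0"
    proof (cases "F = 0")
      case True
      then have "AE x in M. f x = 0" by (simp add: F_def nn_integral_0_iff_AE)
      then show ?thesis using \<theta> by auto
    next
      case False
      with 1 have "AE x in M. g x = 0" by (simp add: G_def nn_integral_0_iff_AE)
      then show ?thesis using \<theta> by auto
    qed
    then have "(\<integral>\<^sup>+x. f x powe (1 - \<theta>) * g x powe \<theta> \<partial>M) = 0"
      by (subst nn_integral_0_iff_AE) auto
    then show ?thesis by simp
  next
    case 2
    then have "F powe (1 - \<theta>) * G powe \<theta> = top"
      using \<theta> by (auto simp: ennreal_mult_top ennreal_top_mult)
    then show ?thesis by (simp add: F_def G_def)
  next
    case 3
    have eqF: "F * (f x / F) = f x" and eqG: "G * (g x / G) = g x" for x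
      using 3 by (metis ennreal_times_divide ennreal_mult_divide_eq mult.commute)+
    have "(\<integral>\<^sup>+x. f x powe (1 - \<theta>) * g x powe \<theta> \<partial>M)
        = (\<integral>\<^sup>+x. F powe (1 - \<theta>) * G powe \<theta> * ((f x / F) powe (1 - \<theta>) * (g x / G) powe \<theta>) \<partial>M)"
      using \<theta> by (subst (1) eqF[symmetric], subst (1) eqG[symmetric]) (simp add: powe_mult mult_ac)
    also have "\<dots> = F powe (1 - \<theta>) * G powe \<theta> * (\<integral>\<^sup>+x. (f x / F) powe (1 - \<theta>) * (g x / G) powe \<theta> \<partial>M)"
      by (simp add: nn_integral_cmult)
    also have "(\<integral>\<^sup>+x. (f x / F) powe (1 - \<theta>) * (g x / G) powe \<theta> \<partial>M)
        \<le> (\<integral>\<^sup>+x. ennreal (1 - \<theta>) * (f x / F) + ennreal \<theta> * (g x / G) \<partial>M)"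
      using \<theta> by (intro nn_integral_mono young_powe)
    also have "\<dots> = ennreal (1 - \<theta>) * (F / F) + ennreal \<theta> * (G / G)"
      by (simp add: nn_integral_add nn_integral_cmult nn_integral_divide F_def G_def)
    also have "\<dots> = 1"
      using 3 \<theta> by (simp add: ennreal_divide_self less_top flip: ennreal_plus)
    finally show ?thesis
      by (simp add: F_def G_def mult_left_mono)
  qed
qed

lemma suminf_Hoelder:
  fixes f g :: "nat \<Rightarrow> ennreal"
  assumes "0 \<le> \<theta>" "\<theta> \<le> 1"
  shows "(\<Sum>n. f n powe (1 - \<theta>) * g n powe \<theta>) \<le> (\<Sum>n. f n) powe (1 - \<theta>) * (\<Sum>n. g n) powe \<theta>"
  using nn_integral_Hoelder[of f "count_space UNIV" g \<theta>] assms
  by (simp add: nn_integral_count_space_nat)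

lemma powe_le_suminf_powe:
  "0 < r \<Longrightarrow> a n \<le> (\<Sum>n. a n powe r) powe (1 / r)"
  using powe_mono[of "a n powe r" "\<Sum>n. a n powe r" "1 / r"] sum_le_suminf[of "\<lambda>n. a n powe r" "{n}"]
  by auto

text \<open>
  A sequence \<open>a\<close> with finite \<open>\<ell>\<^sup>q\<close> norm \<open>N\<close> is the geometric mean, with weights \<open>p / q\<close> and \<open>1 - p / q\<close>, of a sequence
  with \<open>\<ell>\<^sup>p\<close> norm \<open>N\<close> and of the constant sequence \<open>N\<close>. The formula gives the entries of that sequence in
  \<open>\<ell>\<^sup>p\<close> and makes \<open>\<ell>\<^sup>q\<close> an interpolation space between \<open>\<ell>\<^sup>p\<close> and \<open>\<ell>\<^sup>\<infinity>\<close>.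
\<close>

definition lattice_factor :: "real \<Rightarrow> real \<Rightarrow> ennreal \<Rightarrow> ennreal \<Rightarrow> ennreal" where
  "lattice_factor p q N a = a powe (q / p) / N powe (q / p - 1)"

lemma lattice_factor:
  assumes "0 < p" "p \<le> q" "a \<le> N" "N < top"
  shows "a = lattice_factor p q N a powe (p / q) * N powe (1 - p / q)"
    and "lattice_factor p q N a powe p * N powe (q - p) = a powe q"
    and "lattice_factor p q N a powe p \<le> N powe p"
proof -
  have "a = lattice_factor p q N a powe (p / q) * N powe (1 - p / q) \<and>
     lattice_factor p q N a powe p * N powe (q - p) = a powe q \<and> lattice_factor p q N a powe p \<le> N powe p"
  proof (cases "a = 0")
    case True
    then show ?thesis using assms by (simp add: lattice_factor_def)
  next
    case False
    have "N \<noteq> 0" using assms False by auto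
    then obtain n where n: "N = ennreal n" "n > 0" using assms by (cases N) (auto simp: order_less_le)
    obtain x where x: "a = ennreal x" "x > 0" using assms False n by (cases a) (auto simp: order_less_le top_unique)
    have xn: "x \<le> n" using assms n x by simp
    show ?thesis
    proof (cases "p = q")
      case True
      moreover have "y / 1 = y" for y :: ennreal by (simp add: divide_ennreal_def)
      ultimately show ?thesis
        using assms n x by (auto simp: lattice_factor_def intro: powe_mono)
    next
      case False
      then have pq: "p < q" using assms by simp
      then have ne: "q / p - 1 \<noteq> 0" "1 - p / q \<noteq> 0" "q - p \<noteq> 0" "p / q \<noteq> 0" "q / p \<noteq> 0" "p \<noteq> 0" "q \<noteq> 0"
        using assms by (auto simp: field_simps)
      define h where "h = x powr (q / p) / n powr (q / p - 1)"
      have h: "h > 0" "lattice_factor p q N a = ennreal h"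
        using x n ne by (auto simp: h_def lattice_factor_def ennreal_powe divide_ennreal)
      have lnh: "ln h = q / p * ln x - (q / p - 1) * ln n"
        using x n by (simp add: h_def ln_div ln_powr)
      have e1: "x = h powr (p / q) * n powr (1 - p / q)"
      proof -
        have "ln (h powr (p / q) * n powr (1 - p / q)) = ln x"
          using h n ne lnh by (simp add: ln_mult ln_powr field_simps)
        then show ?thesis using h x n by (subst (asm) ln_inj_iff) auto
      qed
      have e2: "h powr p * n powr (q - p) = x powr q"
      proof -
        have "ln (h powr p * n powr (q - p)) = ln (x powr q)"
          using h n x ne lnh by (simp add: ln_mult ln_powr field_simps)
        then show ?thesis using h x n by (subst (asm) ln_inj_iff) auto
      qed
      have "ln h \<le> ln n"
      proof -
        have "q / p * ln x \<le> q / p * ln n" using xn x n assms by (intro mult_left_mono) auto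
        then show ?thesis unfolding lnh by (simp add: algebra_simps)
      qed
      then have e3: "h powr p \<le> n powr p" using h n assms by (intro powr_mono2) auto
      show ?thesis
        using e1 e2 e3 n x h ne by (auto simp: ennreal_powe simp flip: ennreal_mult')
    qed
  qed
  then show "a = lattice_factor p q N a powe (p / q) * N powe (1 - p / q)"
    and "lattice_factor p q N a powe p * N powe (q - p) = a powe q"
    and "lattice_factor p q N a powe p \<le> N powe p" by auto
qed

lemma suminf_lattice_factor:
  fixes a :: "nat \<Rightarrow> ennreal"
  assumes pq: "0 < p" "p \<le> q" and N: "N = (\<Sum>n. a n powe q) powe (1 / q)" "N < top"
  shows "(\<Sum>n. lattice_factor p q N (a n) powe p) = N powe p"
proof -
  have aN: "a n \<le> N" for n unfolding N by (rule powe_le_suminf_powe) (use pq in auto)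
  have "(\<Sum>n. lattice_factor p q N (a n) powe p) * N powe (q - p) = (\<Sum>n. a n powe q)"
    using lattice_factor(2)[OF pq aN N(2)] by (simp flip: ennreal_suminf_cmult ennreal_suminf_multc)
  also have "\<dots> = N powe q" using pq by (simp add: N)
  also have "\<dots> = N powe p * N powe (q - p)" using powe_add[of p "q - p" N] pq by simp
  finally have eq: "(\<Sum>n. lattice_factor p q N (a n) powe p) * N powe (q - p) = N powe p * N powe (q - p)" .
  show ?thesis
  proof (cases "N = 0")
    case True
    then have "a n = 0" for n using aN[of n] by simp
    then show ?thesis using pq True by (simp add: lattice_factor_def)
  next
    case False
    have "N powe (q - p) \<noteq> 0" "N powe (q - p) \<noteq> top" using False N(2) by (auto simp: less_top)
    then show ?thesis using eq by (metis ennreal_mult_divide_eq)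
  qed
qed

section \<open>The dyadic-radius Hardy--Littlewood maximal function\<close>

text \<open>
  The integral is divided by the radius and not by the length of the interval, so the mean of a constant
  \<open>c\<close> is \<open>2 * c\<close>. Restricting the radii to powers of \<open>2\<close> makes the maximal function a countable supremum
  and costs only a constant factor.
\<close>

definition dyadic_mean :: "int \<Rightarrow> (real \<Rightarrow> ennreal) \<Rightarrow> real \<Rightarrow> ennreal" where
  "dyadic_mean k f t = ennreal (2 powi (- k)) * (\<integral>\<^sup>+s. indicator {- (2 powi k)..2 powi k} (t - s) * f s \<partial>lborel)"

definition maximal_fun :: "(real \<Rightarrow> ennreal) \<Rightarrow> real \<Rightarrow> ennreal" where
  "maximal_fun f t = (SUP k. dyadic_mean k f t)"

lemma measurable_times_cball:
  fixes f :: "real \<Rightarrow> ennreal"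
  assumes "f \<in> borel_measurable borel"
  shows "(\<lambda>s. indicator (cball t R) s * f s) \<in> borel_measurable borel"
  using assms by (intro borel_measurable_times_ennreal borel_measurable_indicator) auto

lemma measurable_dyadic_mean [measurable]:
  assumes [measurable]: "f \<in> borel_measurable borel"
  shows "dyadic_mean k f \<in> borel_measurable borel"
  unfolding dyadic_mean_def[abs_def] by measurable

lemma measurable_maximal_fun [measurable]:
  assumes [measurable]: "f \<in> borel_measurable borel"
  shows "maximal_fun f \<in> borel_measurable borel"
  unfolding maximal_fun_def[abs_def] by measurable

lemma dyadic_mean_le_maximal_fun: "dyadic_mean k f t \<le> maximal_fun f t"
  unfolding maximal_fun_def by (rule SUP_upper) simp

lemma powi_mult_inverse: "ennreal (2 powi k) * (ennreal (2 powi (- k)) * x) = x"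
proof -
  have "ennreal (2 powi k) * ennreal (2 powi (- k)) = 1"
    by (simp add: power_int_minus flip: ennreal_mult')
  then show ?thesis by (simp flip: mult.assoc)
qed

lemma integral_le_maximal_fun:
  "(\<integral>\<^sup>+s. indicator {- (2 powi k)..2 powi k} (t - s) * f s \<partial>lborel) \<le> ennreal (2 powi k) * maximal_fun f t"
proof -
  have "(\<integral>\<^sup>+s. indicator {- (2 powi k)..2 powi k} (t - s) * f s \<partial>lborel) = ennreal (2 powi k) * dyadic_mean k f t"
    by (simp add: dyadic_mean_def powi_mult_inverse)
  also have "\<dots> \<le> ennreal (2 powi k) * maximal_fun f t"
    by (intro mult_left_mono dyadic_mean_le_maximal_fun) simp
  finally show ?thesis .
qed

lemma dyadic_mean_const: "dyadic_mean k (\<lambda>_. c) t = 2 * c"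
proof -
  have "(\<integral>\<^sup>+s. indicator {- (2 powi k)..2 powi k} (t - s) * c \<partial>lborel)
      = (\<integral>\<^sup>+s. c * indicator {t - 2 powi k..t + 2 powi k} s \<partial>lborel)"
    by (intro nn_integral_cong) (auto simp: indicator_def)
  also have "\<dots> = c * ennreal (2 * 2 powi k)"
    by (subst nn_integral_cmult_indicator) auto
  also have "\<dots> = ennreal (2 powi k) * (2 * c)"
    by (simp add: ennreal_mult' mult_ac)
  finally show ?thesis
    using powi_mult_inverse[of "- k" "2 * c"] by (simp add: dyadic_mean_def)
qed

lemma maximal_fun_const: "maximal_fun (\<lambda>_. c) t = 2 * c"
  by (simp add: maximal_fun_def dyadic_mean_const)

lemma maximal_fun_mono_AE:
  assumes "AE s in lborel. f s \<le> g s"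
  shows "maximal_fun f t \<le> maximal_fun g t"
  unfolding maximal_fun_def dyadic_mean_def using assms
  by (intro SUP_mono') (auto intro!: mult_left_mono nn_integral_mono_AE elim!: eventually_mono)

lemma dyadic_mean_Hoelder:
  assumes [measurable]: "f \<in> borel_measurable borel" "g \<in> borel_measurable borel" and \<theta>: "0 \<le> \<theta>" "\<theta> \<le> 1"
  shows "dyadic_mean k (\<lambda>s. f s powe (1 - \<theta>) * g s powe \<theta>) t
           \<le> dyadic_mean k f t powe (1 - \<theta>) * dyadic_mean k g t powe \<theta>"
proof -
  have split: "x * (a powe (1 - \<theta>) * b powe \<theta>) = (x * a) powe (1 - \<theta>) * (x * b) powe \<theta>" for x a b
    using powe_add[of "1 - \<theta>" \<theta> x] \<theta> by (simp add: powe_mult mult_ac)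
  show ?thesis
    unfolding dyadic_mean_def
    using nn_integral_Hoelder[of "\<lambda>s. indicator {- (2 powi k)..2 powi k} (t - s) * f s" lborel
        "\<lambda>s. indicator {- (2 powi k)..2 powi k} (t - s) * g s" \<theta>] \<theta>
    by (simp add: split[symmetric] mult_left_mono)
qed

text \<open>
  Although sublinear only, the maximal operator behaves under geometric means like a positive linear
  operator, since each mean does.
\<close>

lemma maximal_fun_Hoelder:
  assumes "f \<in> borel_measurable borel" "g \<in> borel_measurable borel" "0 \<le> \<theta>" "\<theta> \<le> 1"
  shows "maximal_fun (\<lambda>s. f s powe (1 - \<theta>) * g s powe \<theta>) t
           \<le> maximal_fun f t powe (1 - \<theta>) * maximal_fun g t powe \<theta>"
  unfolding maximal_fun_def[of "\<lambda>s. f s powe (1 - \<theta>) * g s powe \<theta>"]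
proof (rule SUP_least)
  fix k
  have "dyadic_mean k (\<lambda>s. f s powe (1 - \<theta>) * g s powe \<theta>) t
      \<le> dyadic_mean k f t powe (1 - \<theta>) * dyadic_mean k g t powe \<theta>"
    using assms by (rule dyadic_mean_Hoelder)
  also have "\<dots> \<le> maximal_fun f t powe (1 - \<theta>) * maximal_fun g t powe \<theta>"
    using assms by (intro mult_mono powe_mono dyadic_mean_le_maximal_fun) auto
  finally show "dyadic_mean k (\<lambda>s. f s powe (1 - \<theta>) * g s powe \<theta>) t
      \<le> maximal_fun f t powe (1 - \<theta>) * maximal_fun g t powe \<theta>" .
qed

text \<open>
  Every point \<open>s\<close> of a ball of radius \<open>R\<close> sees the whole five-fold ball inside its own ball of
  radius \<open>8 * R\<close>, which is the next dyadic radius above \<open>6 * R\<close>. Hence \<open>8 * R * maximal_fun w s\<close> bounds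
  the \<open>w\<close>-mass of the five-fold ball, for all these \<open>s\<close> at once.
\<close>

lemma maximal_fun_weak_ball:
  assumes [measurable]: "f \<in> borel_measurable borel" "w \<in> borel_measurable borel"
    and l: "l < dyadic_mean k f t"
  shows "l * (\<integral>\<^sup>+s. indicator (cball t (5 * 2 powi k)) s * w s \<partial>lborel)
           \<le> 8 * (\<integral>\<^sup>+s. indicator (cball t (2 powi k)) s * (f s * maximal_fun w s) \<partial>lborel)"
proof -
  define R :: real where "R = 2 powi k"
  have R: "R > 0" by (simp add: R_def)
  define W where "W = (\<integral>\<^sup>+s. indicator (cball t (5 * R)) s * w s \<partial>lborel)"
  have ind: "indicator {- R..R} (t - s) = (indicator (cball t R) s :: ennreal)" for s
    by (auto simp: indicator_def dist_real_def)
  have R8: "2 powi (k + 3) = 8 * R"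
    by (simp add: R_def power_int_add)
  have W: "W \<le> ennreal (8 * R) * maximal_fun w s" if "s \<in> cball t R" for s
  proof -
    have "cball t (5 * R) \<subseteq> {x. s - x \<in> {- (8 * R)..8 * R}}"
      using that R by (auto simp: dist_real_def abs_if split: if_splits)
    then have "W \<le> (\<integral>\<^sup>+x. indicator {- (8 * R)..8 * R} (s - x) * w x \<partial>lborel)"
      unfolding W_def by (intro nn_integral_mono mult_right_mono) (auto simp: indicator_def)
    also have "\<dots> \<le> ennreal (8 * R) * maximal_fun w s"
      using integral_le_maximal_fun[of "k + 3" s w] unfolding R8 .
    finally show ?thesis .
  qed
  have inv: "ennreal (2 powi (- k)) * ennreal (8 * R) = 8"
  proof -
    have "ennreal (2 powi (- k)) * ennreal (8 * R) = ennreal (2 powi (- k) * (8 * R))"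
      using R by (intro ennreal_mult'[symmetric]) simp
    also have "2 powi (- k) * (8 * R) = 8" by (simp add: R_def power_int_minus)
    finally show ?thesis by simp
  qed
  have "l * W \<le> ennreal (2 powi (- k)) * (\<integral>\<^sup>+s. indicator (cball t R) s * f s \<partial>lborel) * W"
    using l by (intro mult_right_mono) (auto simp: dyadic_mean_def ind simp flip: R_def)
  also have "\<dots> = ennreal (2 powi (- k)) * (\<integral>\<^sup>+s. indicator (cball t R) s * f s * W \<partial>lborel)"
    by (subst nn_integral_multc) (simp_all add: mult.assoc measurable_times_cball)
  also have "\<dots> \<le> ennreal (2 powi (- k)) * (\<integral>\<^sup>+s. indicator (cball t R) s * f s * (ennreal (8 * R) * maximal_fun w s) \<partial>lborel)"
  proof (rule mult_left_mono, rule nn_integral_mono)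
    fix s
    show "indicator (cball t R) s * f s * W \<le> indicator (cball t R) s * f s * (ennreal (8 * R) * maximal_fun w s)"
    proof (cases "s \<in> cball t R")
      case True
      then show ?thesis using W[OF True] by (simp add: mult_left_mono)
    qed simp
  qed simp
  also have "\<dots> = ennreal (2 powi (- k)) * (\<integral>\<^sup>+s. ennreal (8 * R) * (indicator (cball t R) s * (f s * maximal_fun w s)) \<partial>lborel)"
    by (simp add: mult_ac)
  also have "\<dots> = 8 * (\<integral>\<^sup>+s. indicator (cball t R) s * (f s * maximal_fun w s) \<partial>lborel)"
    by (subst nn_integral_cmult)
       (use measurable_times_cball[of "\<lambda>s. f s * maximal_fun w s" t R] in \<open>simp_all add: inv flip: mult.assoc\<close>)
  finally show ?thesis by (simp add: W_def R_def)
qed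

text \<open>
  Vitali's covering lemma selects disjoint balls on which the means of \<open>f\<close> exceed \<open>l\<close> and whose five-fold
  enlargements cover the level set; the estimate for one ball is then summed. The bound \<open>2 powi K\<close> on
  the radii is what the covering lemma asks for.
\<close>

lemma maximal_fun_weak_bounded:
  assumes [measurable]: "f \<in> borel_measurable borel" "w \<in> borel_measurable borel"
  shows "l * (\<integral>\<^sup>+t. w t * indicator {t. \<exists>k\<le>K. l < dyadic_mean k f t} t \<partial>lborel)
           \<le> 8 * (\<integral>\<^sup>+t. f t * maximal_fun w t \<partial>lborel)"
proof -
  define E where "E = {t. \<exists>k\<le>K. l < dyadic_mean k f t}"
  have "\<forall>t\<in>E. \<exists>k. k \<le> K \<and> l < dyadic_mean k f t" by (auto simp: E_def)
  then obtain k where k: "\<And>t. t \<in> E \<Longrightarrow> k t \<le> K \<and> l < dyadic_mean (k t) f t"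
    by (auto dest!: bchoice)
  define r :: "real \<Rightarrow> real" where "r t = 2 powi (k t)" for t
  have r: "0 < r t \<and> r t \<le> 2 powi K" if "t \<in> E" for t
    using k[OF that] by (auto simp: r_def intro: power_int_increasing)
  obtain C where C: "countable C" "C \<subseteq> E"
      and disj: "pairwise (\<lambda>i j. disjnt (cball i (r i)) (cball j (r j))) C"
      and cov: "E \<subseteq> (\<Union>i\<in>C. cball i (5 * r i))"
  proof (rule Vitali_covering_lemma_cballs)
    show "E \<subseteq> (\<Union>i\<in>E. cball i (r i))" using r by (force simp: less_eq_real_def)
  qed (use r in blast)+
  have "(\<integral>\<^sup>+t. w t * indicator E t \<partial>lborel)
      \<le> (\<integral>\<^sup>+t. (\<integral>\<^sup>+i. indicator (cball i (5 * r i)) t * w t \<partial>count_space C) \<partial>lborel)"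
  proof (intro nn_integral_mono)
    fix t
    show "w t * indicator E t \<le> (\<integral>\<^sup>+i. indicator (cball i (5 * r i)) t * w t \<partial>count_space C)"
    proof (cases "t \<in> E")
      case True
      then obtain i where i: "i \<in> C" "t \<in> cball i (5 * r i)" using cov by auto
      then have "w t * indicator E t = (\<integral>\<^sup>+j. w t * indicator {i} j \<partial>count_space C)"
        using True by (subst nn_integral_cmult_indicator) auto
      also have "\<dots> \<le> (\<integral>\<^sup>+j. indicator (cball j (5 * r j)) t * w t \<partial>count_space C)"
        using i by (intro nn_integral_mono) (auto simp: indicator_def)
      finally show ?thesis .
    qed simp
  qed
  also have "\<dots> = (\<integral>\<^sup>+i. (\<integral>\<^sup>+t. indicator (cball i (5 * r i)) t * w t \<partial>lborel) \<partial>count_space C)"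
    using assms by (intro nn_integral_count_space_nn_integral C(1)) (simp add: measurable_times_cball)
  finally have "l * (\<integral>\<^sup>+t. w t * indicator E t \<partial>lborel)
      \<le> l * (\<integral>\<^sup>+i. (\<integral>\<^sup>+t. indicator (cball i (5 * r i)) t * w t \<partial>lborel) \<partial>count_space C)"
    by (rule mult_left_mono) simp
  also have "\<dots> = (\<integral>\<^sup>+i. l * (\<integral>\<^sup>+t. indicator (cball i (5 * r i)) t * w t \<partial>lborel) \<partial>count_space C)"
    by (simp add: nn_integral_cmult)
  also have "\<dots> \<le> (\<integral>\<^sup>+i. 8 * (\<integral>\<^sup>+t. indicator (cball i (r i)) t * (f t * maximal_fun w t) \<partial>lborel) \<partial>count_space C)"
    unfolding r_def using C(2) k by (intro nn_integral_mono maximal_fun_weak_ball) auto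
  also have "\<dots> = 8 * (\<integral>\<^sup>+t. (\<integral>\<^sup>+i. indicator (cball i (r i)) t * (f t * maximal_fun w t) \<partial>count_space C) \<partial>lborel)"
    using assms by (subst nn_integral_count_space_nn_integral[OF C(1)])
       (simp_all add: measurable_times_cball nn_integral_cmult del: measurable_maximal_fun)
  also have "\<dots> \<le> 8 * (\<integral>\<^sup>+t. f t * maximal_fun w t \<partial>lborel)"
  proof (rule mult_left_mono, rule nn_integral_mono)
    fix t
    show "(\<integral>\<^sup>+i. indicator (cball i (r i)) t * (f t * maximal_fun w t) \<partial>count_space C) \<le> f t * maximal_fun w t"
    proof (cases "\<exists>i\<in>C. t \<in> cball i (r i)")
      case True
      then obtain i where i: "i \<in> C" "t \<in> cball i (r i)" by auto
      have uniq: "t \<notin> cball j (r j)" if "j \<in> C" "j \<noteq> i" for j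
        using disj i that unfolding pairwise_def disjnt_def by blast
      have "(\<integral>\<^sup>+j. indicator (cball j (r j)) t * (f t * maximal_fun w t) \<partial>count_space C)
          \<le> (\<integral>\<^sup>+j. (f t * maximal_fun w t) * indicator {i} j \<partial>count_space C)"
      proof (rule nn_integral_mono)
        fix j assume "j \<in> space (count_space C)"
        then show "indicator (cball j (r j)) t * (f t * maximal_fun w t) \<le> f t * maximal_fun w t * indicator {i} j"
          using uniq[of j] by (cases "j = i") (simp_all add: indicator_def del: mem_cball)
      qed
      also have "\<dots> = f t * maximal_fun w t"
        using i by (subst nn_integral_cmult_indicator) auto
      finally show ?thesis .
    next
      case False
      then have "(\<integral>\<^sup>+j. indicator (cball j (r j)) t * (f t * maximal_fun w t) \<partial>count_space C)
          = (\<integral>\<^sup>+j. 0 \<partial>count_space C)"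
        by (intro nn_integral_cong) (auto simp: indicator_def)
      then show ?thesis by simp
    qed
  qed simp
  finally show ?thesis by (simp add: E_def)
qed

lemma maximal_fun_weak:
  assumes [measurable]: "f \<in> borel_measurable borel" "w \<in> borel_measurable borel"
  shows "l * (\<integral>\<^sup>+t. w t * indicator {t. l < maximal_fun f t} t \<partial>lborel)
           \<le> 8 * (\<integral>\<^sup>+t. f t * maximal_fun w t \<partial>lborel)"
proof -
  define E where "E N = {t. \<exists>k\<le>int N. l < dyadic_mean k f t}" for N
  have [measurable]: "E N \<in> sets borel" for N unfolding E_def by measurable
  have inc: "incseq (\<lambda>N t. w t * indicator (E N) t)"
    by (auto simp: incseq_def le_fun_def E_def indicator_def)
  have E: "{t. l < maximal_fun f t} = (\<Union>N. E N)"
  proof (intro equalityI subsetI)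
    fix t assume "t \<in> {t. l < maximal_fun f t}"
    then obtain k where "l < dyadic_mean k f t" by (auto simp: maximal_fun_def less_SUP_iff)
    moreover have "k \<le> int (nat k)" by simp
    ultimately show "t \<in> (\<Union>N. E N)" unfolding E_def by blast
  qed (auto simp: E_def intro: less_le_trans dyadic_mean_le_maximal_fun)
  have "w t * indicator {t. l < maximal_fun f t} t = (SUP N. w t * indicator (E N) t)" for t
  proof (intro antisym SUP_least)
    show "w t * indicator {t. l < maximal_fun f t} t \<le> (SUP N. w t * indicator (E N) t)"
    proof (cases "\<exists>N. t \<in> E N")
      case True
      then obtain N where "t \<in> E N" by blast
      then show ?thesis by (intro SUP_upper2[of N]) (auto simp: indicator_def)
    next
      case False
      then show ?thesis using E by auto
    qed
  qed (use E in \<open>auto simp: indicator_def\<close>)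
  then have "l * (\<integral>\<^sup>+t. w t * indicator {t. l < maximal_fun f t} t \<partial>lborel)
      = (SUP N. l * (\<integral>\<^sup>+t. w t * indicator (E N) t \<partial>lborel))"
    using inc by (simp add: nn_integral_monotone_convergence_SUP SUP_mult_left_ennreal)
  also have "\<dots> \<le> 8 * (\<integral>\<^sup>+t. f t * maximal_fun w t \<partial>lborel)"
    unfolding E_def by (intro SUP_least maximal_fun_weak_bounded assms)
  finally show ?thesis .
qed

lemma layer_cake_finite:
  assumes "0 < a" "0 \<le> x"
  shows "(\<integral>\<^sup>+l. ennreal (a * l powr (a - 1)) * indicator {0..x} l \<partial>lborel) = ennreal (x powr a)"
proof -
  have "((\<lambda>l. l powr (a - 1)) has_integral (x powr (a - 1 + 1) / (a - 1 + 1))) {0..x}"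
    by (rule has_integral_powr_from_0) (use assms in linarith)+
  from has_integral_mult_right[OF this, of a]
  have 1: "((\<lambda>l. a * l powr (a - 1)) has_integral x powr a) {0..x}" using assms by simp
  show ?thesis
    by (rule nn_integral_has_integral_lebesgue'[OF _ 1]) (use assms in simp)
qed

lemma layer_cake:
  assumes "0 < a"
  shows "(\<integral>\<^sup>+l. ennreal (a * l powr (a - 1)) * indicator {0<..} l * indicator {l. ennreal l < y} l \<partial>lborel) = y powe a" (is "?L = _")
proof (cases y)
  case (real x)
  have "?L
      = (\<integral>\<^sup>+l. ennreal (a * l powr (a - 1)) * indicator {0..x} l \<partial>lborel)"
  proof (rule nn_integral_cong_AE)
    have "AE l in lborel. l \<noteq> 0 \<and> l \<noteq> x" using AE_lborel_singleton[of 0] AE_lborel_singleton[of x] by auto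
    then show "AE l in lborel. ennreal (a * l powr (a - 1)) * indicator {0<..} l * indicator {l. ennreal l < y} l
        = ennreal (a * l powr (a - 1)) * indicator {0..x} l"
      by eventually_elim (use real in \<open>auto simp: indicator_def ennreal_less_iff\<close>)
  qed
  then show ?thesis using real assms by (simp add: layer_cake_finite ennreal_powe)
next
  case top
  have "ennreal (x powr a) \<le> ?L"
    if "x \<ge> 0" for x
  proof -
    have "(\<integral>\<^sup>+l. ennreal (a * l powr (a - 1)) * indicator {0..x} l \<partial>lborel) \<le> ?L"
    proof (rule nn_integral_mono_AE)
      show "AE l in lborel. ennreal (a * l powr (a - 1)) * indicator {0..x} l
          \<le> ennreal (a * l powr (a - 1)) * indicator {0<..} l * indicator {l. ennreal l < y} l"
        using AE_lborel_singleton[of 0] by eventually_elim (use top in \<open>auto simp: indicator_def\<close>)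
    qed
    then show ?thesis using layer_cake_finite[OF assms that] by simp
  qed
  note * = this
  have "ennreal (real n) \<le> ?L" for n
    using *[of "real n powr (1 / a)"] assms by (simp add: powr_powr)
  then have "?L = top"
    by (metis ennreal_Ex_less_of_nat ennreal_of_nat_eq_real_of_nat leD less_top)
  then show ?thesis using top assms by simp
qed

text \<open>
  Tonelli's theorem turns the layer cake formula for the values of \<open>g\<close> into one for its level sets.
\<close>

lemma layer_cake_weighted:
  assumes g [measurable]: "g \<in> borel_measurable borel" and w [measurable]: "w \<in> borel_measurable borel"
    and a: "0 < a"
  shows "(\<integral>\<^sup>+t. g t powe a * w t \<partial>lborel)
    = (\<integral>\<^sup>+l. ennreal (a * l powr (a - 1)) * indicator {0<..} l *
         (\<integral>\<^sup>+t. w t * indicator {t. ennreal l < g t} t \<partial>lborel) \<partial>lborel)"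
proof -
  define k where "k l = ennreal (a * l powr (a - 1)) * indicator {0<..} l" for l :: real
  have [measurable]: "k \<in> borel_measurable borel" unfolding k_def by measurable
  have "(\<integral>\<^sup>+t. g t powe a * w t \<partial>lborel)
      = (\<integral>\<^sup>+t. (\<integral>\<^sup>+l. k l * indicator {l. ennreal l < g t} l \<partial>lborel) * w t \<partial>lborel)"
    unfolding k_def by (simp only: layer_cake[OF a])
  also have "\<dots> = (\<integral>\<^sup>+t. (\<integral>\<^sup>+l. k l * indicator {l. ennreal l < g t} l * w t \<partial>lborel) \<partial>lborel)"
    by (intro nn_integral_cong nn_integral_multc[symmetric]) measurable
  also have "\<dots> = (\<integral>\<^sup>+t. (\<integral>\<^sup>+l. (if ennreal l < g t then k l * w t else 0) \<partial>lborel) \<partial>lborel)"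
    by (intro nn_integral_cong) (auto simp: indicator_def)
  also have "\<dots> = (\<integral>\<^sup>+l. (\<integral>\<^sup>+t. (if ennreal l < g t then k l * w t else 0) \<partial>lborel) \<partial>lborel)"
    by (rule lborel_pair.Fubini') measurable
  also have "\<dots> = (\<integral>\<^sup>+l. (\<integral>\<^sup>+t. k l * (w t * indicator {t. ennreal l < g t} t) \<partial>lborel) \<partial>lborel)"
    by (intro nn_integral_cong) (auto simp: indicator_def)
  also have "\<dots> = (\<integral>\<^sup>+l. k l * (\<integral>\<^sup>+t. w t * indicator {t. ennreal l < g t} t \<partial>lborel) \<partial>lborel)"
    by (intro nn_integral_cong nn_integral_cmult) measurable
  finally show ?thesis by (simp only: k_def)
qed

text \<open>
  Dropping the values of \<open>f\<close> below \<open>l / 4\<close> lowers its means by at most \<open>l / 2\<close>, since the mean of a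
  constant is twice that constant. So only the part of \<open>f\<close> above \<open>l / 4\<close> matters for the level \<open>l\<close>. This is the step that
  upgrades the weak inequality to the strong one.
\<close>

lemma maximal_fun_level:
  assumes [measurable]: "f \<in> borel_measurable borel" "w \<in> borel_measurable borel" and l: "l > 0"
  shows "(\<integral>\<^sup>+t. w t * indicator {t. ennreal l < maximal_fun f t} t \<partial>lborel)
      \<le> ennreal (16 / l) * (\<integral>\<^sup>+t. f t * indicator {t. ennreal l < 4 * f t} t * maximal_fun w t \<partial>lborel)"
proof -
  define h where "h t = f t * indicator {t. ennreal l < 4 * f t} t" for t
  have [measurable]: "h \<in> borel_measurable borel" unfolding h_def by measurable
  have fh: "f t \<le> h t + ennreal (l / 4)" for t
  proof (cases "ennreal l < 4 * f t")
    case False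
    moreover have "4 * ennreal (l / 4) = ennreal l"
      using l by (simp flip: ennreal_numeral ennreal_mult')
    ultimately have "4 * f t \<le> 4 * ennreal (l / 4)" by simp
    then have "f t \<le> ennreal (l / 4)" by (subst (asm) ennreal_mult_le_mult_iff) auto
    then show ?thesis by (simp add: add_increasing)
  qed (simp add: h_def)
  have "maximal_fun f t \<le> maximal_fun h t + ennreal (l / 2)" for t
    unfolding maximal_fun_def[of f]
  proof (rule SUP_least)
    fix k
    have "dyadic_mean k f t \<le> dyadic_mean k (\<lambda>s. h s + ennreal (l / 4)) t"
      unfolding dyadic_mean_def by (intro mult_left_mono nn_integral_mono fh) auto
    also have "\<dots> = dyadic_mean k h t + dyadic_mean k (\<lambda>_. ennreal (l / 4)) t"
      unfolding dyadic_mean_def by (simp add: distrib_left nn_integral_add)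
    also have "dyadic_mean k (\<lambda>_. ennreal (l / 4)) t = ennreal (l / 2)"
      using l by (simp add: dyadic_mean_const flip: ennreal_numeral ennreal_mult')
    finally show "dyadic_mean k f t \<le> maximal_fun h t + ennreal (l / 2)"
      using dyadic_mean_le_maximal_fun[of k h t] by (meson add_right_mono order_trans)
  qed
  note le = this
  have "ennreal (l / 2) < maximal_fun h t" if "ennreal l < maximal_fun f t" for t
  proof (rule ccontr)
    assume "\<not> ?thesis"
    then have "maximal_fun f t \<le> ennreal (l / 2) + ennreal (l / 2)"
      using le[of t] by (meson add_right_mono not_less order_trans)
    also have "\<dots> = ennreal l" using l by (simp flip: ennreal_plus)
    finally show False using that by simp
  qed
  then have "(\<integral>\<^sup>+t. w t * indicator {t. ennreal l < maximal_fun f t} t \<partial>lborel)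
      \<le> (\<integral>\<^sup>+t. w t * indicator {t. ennreal (l / 2) < maximal_fun h t} t \<partial>lborel)" (is "?A \<le> ?B")
    by (intro nn_integral_mono) (auto simp: indicator_def)
  also have "\<dots> = ennreal (2 / l) * (ennreal (l / 2) * ?B)"
    using l by (simp flip: mult.assoc ennreal_mult')
  also have "\<dots> \<le> ennreal (2 / l) * (8 * (\<integral>\<^sup>+t. h t * maximal_fun w t \<partial>lborel))"
    by (intro mult_left_mono maximal_fun_weak) auto
  also have "\<dots> = ennreal (16 / l) * (\<integral>\<^sup>+t. h t * maximal_fun w t \<partial>lborel)"
    using l by (simp flip: mult.assoc ennreal_mult' ennreal_numeral)
  finally show ?thesis by (simp add: h_def)
qed

text \<open>
  The weight on the right is the maximal function of the weight on the left. This asymmetric form makes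
  the inequality usable for all weights, in particular for the weights that duality produces.
\<close>

theorem maximal_fun_weighted:
  assumes "1 < q"
  obtains C where "C < top" "\<And>f w. f \<in> borel_measurable borel \<Longrightarrow> w \<in> borel_measurable borel \<Longrightarrow>
    (\<integral>\<^sup>+t. maximal_fun f t powe q * w t \<partial>lborel) \<le> C * (\<integral>\<^sup>+t. f t powe q * maximal_fun w t \<partial>lborel)"
proof -
  define c where "c = ennreal (16 * q / (q - 1)) * ennreal (4 powr (q - 1))"
  have main: "(\<integral>\<^sup>+t. maximal_fun f t powe q * w t \<partial>lborel) \<le> c * (\<integral>\<^sup>+t. f t powe q * maximal_fun w t \<partial>lborel)"
    if [measurable]: "f \<in> borel_measurable borel" "w \<in> borel_measurable borel" for f w :: "real \<Rightarrow> ennreal"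
  proof -
    let ?k = "\<lambda>a l. ennreal (a * l powr (a - 1)) * indicator {0<..} l"
    let ?v = "\<lambda>t. f t * maximal_fun w t"
    have k: "?k q l * ennreal (16 / l) = ennreal (16 * q / (q - 1)) * ?k (q - 1) l" for l :: real
    proof (cases "l > 0")
      case True
      have "l powr (q - 1) = l powr (q - 2) * l"
        using True powr_add[of l "q - 2" 1] by simp
      then have "q * l powr (q - 1) * (16 / l) = 16 * q / (q - 1) * ((q - 1) * l powr (q - 2))"
        using True assms by simp
      then show ?thesis
        using True assms by (simp flip: ennreal_mult')
    qed simp
    have "(\<integral>\<^sup>+t. maximal_fun f t powe q * w t \<partial>lborel)
        = (\<integral>\<^sup>+l. ?k q l * (\<integral>\<^sup>+t. w t * indicator {t. ennreal l < maximal_fun f t} t \<partial>lborel) \<partial>lborel)"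
      using assms by (intro layer_cake_weighted) auto
    also have "\<dots> \<le> (\<integral>\<^sup>+l. ?k q l * (ennreal (16 / l) * (\<integral>\<^sup>+t. ?v t * indicator {t. ennreal l < 4 * f t} t \<partial>lborel)) \<partial>lborel)"
    proof (intro nn_integral_mono)
      fix l :: real
      show "?k q l * (\<integral>\<^sup>+t. w t * indicator {t. ennreal l < maximal_fun f t} t \<partial>lborel)
          \<le> ?k q l * (ennreal (16 / l) * (\<integral>\<^sup>+t. ?v t * indicator {t. ennreal l < 4 * f t} t \<partial>lborel))"
        using maximal_fun_level[OF that, of l]
        by (cases "l > 0") (auto simp: mult_ac intro!: mult_left_mono)
    qed
    also have "\<dots> = (\<integral>\<^sup>+l. ennreal (16 * q / (q - 1)) * (?k (q - 1) l * (\<integral>\<^sup>+t. ?v t * indicator {t. ennreal l < 4 * f t} t \<partial>lborel)) \<partial>lborel)"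
      by (simp only: mult.assoc[symmetric] k)
    also have "\<dots> = ennreal (16 * q / (q - 1)) * (\<integral>\<^sup>+l. ?k (q - 1) l * (\<integral>\<^sup>+t. ?v t * indicator {t. ennreal l < 4 * f t} t \<partial>lborel) \<partial>lborel)"
      by (intro nn_integral_cmult) measurable
    also have "\<dots> = ennreal (16 * q / (q - 1)) * (\<integral>\<^sup>+t. (4 * f t) powe (q - 1) * ?v t \<partial>lborel)"
      using assms by (subst layer_cake_weighted) auto
    also have "(\<integral>\<^sup>+t. (4 * f t) powe (q - 1) * ?v t \<partial>lborel)
        = (\<integral>\<^sup>+t. ennreal (4 powr (q - 1)) * (f t powe q * maximal_fun w t) \<partial>lborel)"
    proof (intro nn_integral_cong)
      fix t
      have "f t powe q = f t powe (q - 1) * f t" using powe_add[of "q - 1" 1 "f t"] assms by simp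
      moreover have "4 powe (q - 1) = ennreal (4 powr (q - 1))" using ennreal_powe[of 4 "q - 1"] assms by simp
      ultimately show "(4 * f t) powe (q - 1) * ?v t = ennreal (4 powr (q - 1)) * (f t powe q * maximal_fun w t)"
        using assms by (simp add: powe_mult mult_ac)
    qed
    finally show ?thesis by (simp add: nn_integral_cmult c_def mult.assoc)
  qed
  have "c < top" by (simp add: c_def ennreal_mult_less_top)
  then show ?thesis using main by (rule that)
qed

section \<open>Duality in \<open>L\<^sup>p(\<ell>\<^sup>q)\<close>\<close>

text \<open>
  The \<open>p\<close>-th power of the norm of \<open>L\<^sup>p(\<ell>\<^sup>q)\<close>.
\<close>

definition mixed_integral :: "real \<Rightarrow> real \<Rightarrow> (nat \<Rightarrow> real \<Rightarrow> ennreal) \<Rightarrow> ennreal" where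
  "mixed_integral p q F = (\<integral>\<^sup>+t. (\<Sum>m. F m t powe q) powe (p / q) \<partial>lborel)"

lemma Hoelder_conjugate:
  assumes [measurable]: "f \<in> borel_measurable M" "g \<in> borel_measurable M" and p: "1 < p"
  shows "(\<integral>\<^sup>+x. f x * g x \<partial>M) \<le> (\<integral>\<^sup>+x. f x powe p \<partial>M) powe (1 / p) * (\<integral>\<^sup>+x. g x powe (p / (p - 1)) \<partial>M) powe (1 - 1 / p)"
proof -
  have eq: "p * (1 - 1 / p) / (p - 1) = 1" "1 - (1 - 1 / p) = 1 / p" using p by (auto simp: field_simps)
  show ?thesis
    using nn_integral_Hoelder[of "\<lambda>x. f x powe p" M "\<lambda>x. g x powe (p / (p - 1))" "1 - 1 / p"] p
    by (simp add: powe_powe eq)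
qed

lemma suminf_Hoelder_conjugate:
  fixes f g :: "nat \<Rightarrow> ennreal"
  assumes "1 < p"
  shows "(\<Sum>n. f n * g n) \<le> (\<Sum>n. f n powe p) powe (1 / p) * (\<Sum>n. g n powe (p / (p - 1))) powe (1 - 1 / p)"
  using Hoelder_conjugate[of f "count_space UNIV" g p] assms
  by (simp add: nn_integral_count_space_nat)

lemma conjugate_exponent:
  fixes p :: real
  assumes "1 < p"
  shows "1 < p / (p - 1)" "p / (p - 1) * (1 - 1 / p) = 1" "1 / (p / (p - 1)) = 1 - 1 / p"
  using assms by (auto simp: field_simps)

lemma mixed_Hoelder:
  assumes [measurable]: "\<And>m. F m \<in> borel_measurable borel" "\<And>m. G m \<in> borel_measurable borel"
    and pq: "1 < p" "1 < q"
  shows "(\<integral>\<^sup>+t. (\<Sum>m. F m t * G m t) \<partial>lborel)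
     \<le> mixed_integral p q F powe (1 / p) * mixed_integral (p / (p - 1)) (q / (q - 1)) G powe (1 - 1 / p)"
proof -
  have "(\<integral>\<^sup>+t. (\<Sum>m. F m t * G m t) \<partial>lborel)
    \<le> (\<integral>\<^sup>+t. (\<Sum>m. F m t powe q) powe (1 / q) * (\<Sum>m. G m t powe (q / (q - 1))) powe (1 - 1 / q) \<partial>lborel)"
    using pq by (intro nn_integral_mono suminf_Hoelder_conjugate)
  also have "\<dots> \<le> (\<integral>\<^sup>+t. ((\<Sum>m. F m t powe q) powe (1 / q)) powe p \<partial>lborel) powe (1 / p)
      * (\<integral>\<^sup>+t. ((\<Sum>m. G m t powe (q / (q - 1))) powe (1 - 1 / q)) powe (p / (p - 1)) \<partial>lborel) powe (1 - 1 / p)"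
    using pq by (intro Hoelder_conjugate) measurable
  also have "\<dots> = mixed_integral p q F powe (1 / p) * mixed_integral (p / (p - 1)) (q / (q - 1)) G powe (1 - 1 / p)"
  proof -
    have "(1 - 1 / q) * (p / (p - 1)) = p / (p - 1) / (q / (q - 1))" using pq by (simp add: field_simps)
    then show ?thesis using pq by (simp add: mixed_integral_def powe_powe)
  qed
  finally show ?thesis .
qed

text \<open>
  Finiteness of \<open>J\<close> is essential: it allows the cancellation of a power of \<open>J\<close>.
\<close>

lemma powe_absorb:
  assumes "J \<le> A * J powe (1 - 1 / p)" "J < top" "1 < p"
  shows "J \<le> A powe p"
proof (cases "J = 0")
  case False
  have nz: "J powe (1 - 1 / p) \<noteq> 0" "J powe (1 - 1 / p) \<noteq> top"
    using False assms by auto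
  have "J powe (1 / p) * J powe (1 - 1 / p) = J"
    using powe_add[of "1 / p" "1 - 1 / p" J] assms by simp
  then have "J powe (1 - 1 / p) * J powe (1 / p) \<le> J powe (1 - 1 / p) * A"
    using assms(1) by (simp add: mult.commute)
  then have "J powe (1 / p) \<le> A"
    using nz by (simp add: ennreal_mult_le_mult_iff)
  then have "(J powe (1 / p)) powe p \<le> A powe p" using assms by (intro powe_mono) auto
  then show ?thesis using assms by simp
qed simp

text \<open>
  The extremal dual function is \<open>g\<^sub>m = v\<^sub>m\<^sup>q\<^sup>-\<^sup>1 S\<^sup>p\<^sup>-\<^sup>q\<close>, where \<open>S\<close> is the \<open>\<ell>\<^sup>q\<close> norm of \<open>v\<close>. Both \<open>\<Sum>\<^sub>m v\<^sub>m g\<^sub>m\<close> and the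
  \<open>p'\<close>-th power of the \<open>\<ell>\<^sup>q\<^sup>'\<close> norm of \<open>g\<close> are then equal to \<open>S\<^sup>p\<close>, where \<open>p'\<close> and \<open>q'\<close> are the conjugate
  exponents. For \<open>p < q\<close> the exponent \<open>p - q\<close> is negative; where \<open>S\<close> vanishes so does \<open>v\<close>, and the
  convention that real powers of \<open>0\<close> are \<open>0\<close> is the right one.
\<close>

lemma mixed_duality_bounded:
  assumes v [measurable]: "\<And>m. v m \<in> borel_measurable borel"
    and bound: "\<And>m t. 0 \<le> v m t" "\<And>m t. v m t \<le> B"
    and supp: "\<And>m t. m \<ge> N \<Longrightarrow> v m t = 0" "\<And>m t. t \<notin> {- R..R} \<Longrightarrow> v m t = 0"
    and pq: "1 < p" "1 < q"
    and dual: "\<And>g. (\<And>m. g m \<in> borel_measurable borel) \<Longrightarrow>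
       (\<integral>\<^sup>+t. (\<Sum>m. ennreal (v m t) * g m t) \<partial>lborel) \<le> A * mixed_integral (p / (p - 1)) (q / (q - 1)) g powe (1 - 1 / p)"
  shows "mixed_integral p q (\<lambda>m t. ennreal (v m t)) \<le> A powe p"
proof -
  define S where "S t = (\<Sum>m<N. v m t powr q) powr (1 / q)" for t
  define g where "g m t = ennreal (v m t powr (q - 1) * S t powr (p - q))" for m t
  have S0: "S t \<ge> 0" for t by (simp add: S_def)
  have [measurable]: "S \<in> borel_measurable borel" unfolding S_def[abs_def] by measurable
  have [measurable]: "g m \<in> borel_measurable borel" for m unfolding g_def[abs_def] by measurable
  have Sq: "(\<Sum>m<N. v m t powr q) = S t powr q" for t
    using pq by (simp add: S_def powr_powr sum_nonneg)
  have fin: "(\<Sum>m. ennreal (f m)) = ennreal (\<Sum>m<N. f m)"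
    if "\<And>m. f m \<ge> 0" "\<And>m. m \<ge> N \<Longrightarrow> f m = 0" for f :: "nat \<Rightarrow> real"
    by (subst suminf_finite[of "{..<N}"]) (use that in \<open>auto simp: sum_nonneg\<close>)
  have V: "(\<Sum>m. ennreal (v m t) powe q) powe (p / q) = ennreal (S t powr p)" for t
  proof -
    have "(\<Sum>m. ennreal (v m t) powe q) = (\<Sum>m. ennreal (v m t powr q))"
      using bound pq by (intro suminf_cong) (simp add: ennreal_powe)
    also have "\<dots> = ennreal (S t powr q)"
      using supp pq by (subst fin) (auto simp: Sq)
    finally show ?thesis using pq by (simp add: ennreal_powe powr_powr)
  qed
  have pair: "(\<Sum>m. ennreal (v m t) * g m t) = ennreal (S t powr p)" for t
  proof -
    have "ennreal (v m t) * g m t = ennreal (v m t powr q * S t powr (p - q))" for m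
    proof -
      have "v m t * v m t powr (q - 1) = v m t powr q"
        using bound(1)[of m t] powr_add[of "v m t" 1 "q - 1"] by (cases "v m t = 0") auto
      then show ?thesis using bound(1)[of m t]
        by (simp add: g_def mult.assoc flip: ennreal_mult')
    qed
    then have "(\<Sum>m. ennreal (v m t) * g m t) = (\<Sum>m. ennreal (v m t powr q * S t powr (p - q)))"
      by (simp only:)
    also have "\<dots> = ennreal (\<Sum>m<N. v m t powr q * S t powr (p - q))"
      by (rule fin) (use supp pq in auto)
    also have "(\<Sum>m<N. v m t powr q * S t powr (p - q)) = S t powr p"
      by (simp add: Sq powr_add[symmetric] flip: sum_distrib_right)
    finally show ?thesis .
  qed
  have G: "(\<Sum>m. g m t powe (q / (q - 1))) powe (p / (p - 1) / (q / (q - 1))) = ennreal (S t powr p)" for t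
  proof -
    have "g m t powe (q / (q - 1)) = ennreal (v m t powr q * S t powr ((p - q) * (q / (q - 1))))" for m
      using pq by (simp add: g_def ennreal_powe powr_mult powr_powr)
    then have "(\<Sum>m. g m t powe (q / (q - 1))) = (\<Sum>m. ennreal (v m t powr q * S t powr ((p - q) * (q / (q - 1)))))"
      by (simp only:)
    also have "\<dots> = ennreal (\<Sum>m<N. v m t powr q * S t powr ((p - q) * (q / (q - 1))))"
      by (rule fin) (use supp pq in auto)
    also have "(\<Sum>m<N. v m t powr q * S t powr ((p - q) * (q / (q - 1)))) = S t powr (q + (p - q) * (q / (q - 1)))"
      by (simp add: Sq powr_add flip: sum_distrib_right)
    finally have "(\<Sum>m. g m t powe (q / (q - 1))) powe (p / (p - 1) / (q / (q - 1)))
        = ennreal (S t powr ((q + (p - q) * (q / (q - 1))) * (p / (p - 1) / (q / (q - 1)))))"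
      using pq by (simp add: ennreal_powe powr_powr)
    also have "(q + (p - q) * (q / (q - 1))) * (p / (p - 1) / (q / (q - 1))) = p"
    proof -
      have "q + (p - q) * (q / (q - 1)) = (p - 1) * (q / (q - 1))" using pq by (simp add: field_simps)
      then show ?thesis using pq by simp
    qed
    finally show ?thesis .
  qed
  define J where "J = (\<integral>\<^sup>+t. ennreal (S t powr p) \<partial>lborel)"
  have J1: "mixed_integral p q (\<lambda>m t. ennreal (v m t)) = J"
    by (simp add: mixed_integral_def V J_def)
  have J2: "mixed_integral (p / (p - 1)) (q / (q - 1)) g = J"
    by (simp only: mixed_integral_def G J_def)
  have "J \<le> A * J powe (1 - 1 / p)"
    using dual[of g] by (simp add: pair J2 flip: J_def)
  moreover have "J < top"
  proof -
    have Sb: "S t \<le> (real N * B powr q) powr (1 / q)" for t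
    proof -
      have "(\<Sum>m<N. v m t powr q) \<le> (\<Sum>m<N. B powr q)"
        using bound pq by (intro sum_mono powr_mono2) auto
      then show ?thesis unfolding S_def using pq by (intro powr_mono2) (auto simp: sum_nonneg)
    qed
    define b where "b = ((real N * B powr q) powr (1 / q)) powr p"
    have "ennreal (S t powr p) \<le> ennreal b * indicator {- R..R} t" for t
    proof (cases "t \<in> {- R..R}")
      case True
      then show ?thesis unfolding b_def using Sb[of t] S0[of t] pq by (simp add: ennreal_leI powr_mono2)
    next
      case False
      then have "S t = 0" unfolding S_def using supp(2) pq by simp
      then show ?thesis by simp
    qed
    then have "J \<le> (\<integral>\<^sup>+t. ennreal b * indicator {- R..R} t \<partial>lborel)"
      unfolding J_def by (intro nn_integral_mono)
    also have "\<dots> = ennreal b * emeasure lborel {- R..R}" by (subst nn_integral_cmult_indicator) auto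
    also have "\<dots> < top" by (cases "- R \<le> R") (auto simp: ennreal_mult_less_top)
    finally show ?thesis .
  qed
  ultimately show ?thesis using J1 pq by (simp add: powe_absorb)
qed

text \<open>
  Approximating \<open>U\<close> from below by bounded functions with compact support spares the users of this lemma any
  a priori knowledge that the norm of \<open>U\<close> is finite.
\<close>

lemma mixed_duality:
  assumes U [measurable]: "\<And>m. U m \<in> borel_measurable borel"
    and pq: "1 < p" "1 < q"
    and dual: "\<And>g. (\<And>m. g m \<in> borel_measurable borel) \<Longrightarrow>
       (\<integral>\<^sup>+t. (\<Sum>m. U m t * g m t) \<partial>lborel) \<le> A * mixed_integral (p / (p - 1)) (q / (q - 1)) g powe (1 - 1 / p)"
  shows "mixed_integral p q U \<le> A powe p"
proof -
  define V where "V N m t = (if m < N \<and> t \<in> {- real N..real N} then min (U m t) (of_nat N) else 0)" for N :: nat and m t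
  have [measurable]: "V N m \<in> borel_measurable borel" for N m unfolding V_def[abs_def] by measurable
  have V_inc: "incseq (\<lambda>N. V N m t)" for m t
    unfolding incseq_def V_def by (auto intro: min.coboundedI2)
  have V_le: "V N m t \<le> U m t" for N m t by (simp add: V_def)
  have V_fin: "V N m t \<le> of_nat N" for N m t by (simp add: V_def)
  have V_SUP: "U m t = (SUP N. V N m t)" for m t
  proof (rule antisym)
    show "U m t \<le> (SUP N. V N m t)"
    proof (rule dense_le)
      fix y assume y: "y < U m t"
      then have "y < top" by (meson less_le_trans top_greatest)
      then obtain n where n: "y < of_nat n" using ennreal_Ex_less_of_nat[of y] by blast
      define N where "N = max n (max (Suc m) (nat \<lceil>\<bar>t\<bar>\<rceil>))"
      have "n \<le> N" "m < N" "t \<in> {- real N..real N}" unfolding N_def by (auto; linarith)+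
      then have "V N m t = min (U m t) (of_nat N)" by (simp add: V_def)
      moreover have "y < of_nat N" using n \<open>n \<le> N\<close> by (meson of_nat_mono order_less_le_trans)
      ultimately have "y \<le> V N m t" using y by (simp add: less_imp_le)
      then show "y \<le> (SUP N. V N m t)" by (rule SUP_upper2[OF UNIV_I])
    qed
  qed (simp add: SUP_least V_le)
  have "mixed_integral p q (V N) \<le> A powe p" for N
  proof -
    have V_real: "V N m t = ennreal (enn2real (V N m t))" for m t
      using V_fin[of N m t] by (metis ennreal_enn2real ennreal_of_nat_eq_real_of_nat ennreal_less_top le_less_trans)
    have "mixed_integral p q (\<lambda>m t. ennreal (enn2real (V N m t))) \<le> A powe p"
    proof (rule mixed_duality_bounded[where B = "real N" and N = N and R = "real N"])
      show "enn2real (V N m t) \<le> real N" for m t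
        using V_fin[of N m t] by (intro enn2real_leI) (auto simp: ennreal_of_nat_eq_real_of_nat)
      fix g :: "nat \<Rightarrow> real \<Rightarrow> ennreal" assume g: "\<And>m. g m \<in> borel_measurable borel"
      have "(\<integral>\<^sup>+t. (\<Sum>m. V N m t * g m t) \<partial>lborel) \<le> (\<integral>\<^sup>+t. (\<Sum>m. U m t * g m t) \<partial>lborel)"
        by (intro nn_integral_mono suminf_le mult_right_mono V_le) auto
      also have "\<dots> \<le> A * mixed_integral (p / (p - 1)) (q / (q - 1)) g powe (1 - 1 / p)"
        using g by (rule dual)
      finally show "(\<integral>\<^sup>+t. (\<Sum>m. ennreal (enn2real (V N m t)) * g m t) \<partial>lborel) \<le> A * mixed_integral (p / (p - 1)) (q / (q - 1)) g powe (1 - 1 / p)"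
        unfolding V_real[symmetric] .
    qed (use pq in \<open>auto simp: V_def\<close>)
    then show ?thesis unfolding V_real[symmetric] .
  qed
  moreover have "mixed_integral p q U = (SUP N. mixed_integral p q (V N))"
  proof -
    have powe_inc: "incseq (\<lambda>N. V N m t powe q)" for m t
      using V_inc[of m t] pq unfolding incseq_def by (auto intro: powe_mono)
    have "(\<Sum>m. U m t powe q) powe (p / q) = (SUP N. (\<Sum>m. V N m t powe q) powe (p / q))" for t
    proof -
      have "(\<Sum>m. U m t powe q) = (\<Sum>m. SUP N. V N m t powe q)"
        unfolding V_SUP using pq by (simp add: powe_SUP)
      also have "\<dots> = (SUP N. \<Sum>m. V N m t powe q)"
        using powe_inc by (rule ennreal_suminf_SUP_eq)
      finally show ?thesis using pq by (simp add: powe_SUP)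
    qed
    then have "mixed_integral p q U = (\<integral>\<^sup>+t. (SUP N. (\<Sum>m. V N m t powe q) powe (p / q)) \<partial>lborel)"
      by (simp add: mixed_integral_def)
    also have "\<dots> = (SUP N. mixed_integral p q (V N))"
      unfolding mixed_integral_def
    proof (rule nn_integral_monotone_convergence_SUP)
      show "incseq (\<lambda>N t. (\<Sum>m. V N m t powe q) powe (p / q))"
        using pq V_inc unfolding incseq_def le_fun_def
        by (intro allI impI powe_mono suminf_le) auto
    qed measurable
    finally show ?thesis .
  qed
  ultimately show ?thesis by (simp add: SUP_least)
qed

lemma mixed_integral_single:
  assumes "0 < p" "0 < q"
  shows "mixed_integral p q (\<lambda>m t. if m = 0 then f t else 0) = (\<integral>\<^sup>+t. f t powe p \<partial>lborel)"
proof -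
  have "(\<Sum>m. (if m = 0 then f t else 0) powe q) = f t powe q" for t
    using assms by (subst suminf_finite[of "{0 :: nat}"]) auto
  then show ?thesis using assms by (simp add: mixed_integral_def powe_powe)
qed

lemma duality:
  fixes U :: "real \<Rightarrow> ennreal"
  assumes U [measurable]: "U \<in> borel_measurable borel"
    and p: "1 < p"
    and dual: "\<And>g. g \<in> borel_measurable borel \<Longrightarrow>
       (\<integral>\<^sup>+t. U t * g t \<partial>lborel) \<le> A * (\<integral>\<^sup>+t. g t powe (p / (p - 1)) \<partial>lborel) powe (1 - 1 / p)"
  shows "(\<integral>\<^sup>+t. U t powe p \<partial>lborel) \<le> A powe p"
proof -
  have "mixed_integral p 2 (\<lambda>m t. if m = 0 then U t else 0) \<le> A powe p"
  proof (rule mixed_duality)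
    fix g :: "nat \<Rightarrow> real \<Rightarrow> ennreal" assume g [measurable]: "\<And>m. g m \<in> borel_measurable borel"
    have "(\<Sum>m. (if m = 0 then U t else 0) * g m t) = U t * g 0 t" for t
      by (subst suminf_finite[of "{0 :: nat}"]) auto
    then have "(\<integral>\<^sup>+t. (\<Sum>m. (if m = 0 then U t else 0) * g m t) \<partial>lborel) = (\<integral>\<^sup>+t. U t * g 0 t \<partial>lborel)"
      by simp
    also have "\<dots> \<le> A * (\<integral>\<^sup>+t. g 0 t powe (p / (p - 1)) \<partial>lborel) powe (1 - 1 / p)"
      using g by (rule dual)
    also have "(\<integral>\<^sup>+t. g 0 t powe (p / (p - 1)) \<partial>lborel) \<le> mixed_integral (p / (p - 1)) 2 g"
      unfolding mixed_integral_def
    proof (intro nn_integral_mono)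
      fix t
      have "g 0 t powe (p / (p - 1)) \<le> ((\<Sum>m. g m t powe 2) powe (1 / 2)) powe (p / (p - 1))"
        using p powe_le_suminf_powe[of 2 "\<lambda>m. g m t" 0] by (intro powe_mono) auto
      then show "g 0 t powe (p / (p - 1)) \<le> (\<Sum>m. g m t powe 2) powe (p / (p - 1) / 2)"
        using p by (simp add: powe_powe mult.commute)
    qed
    finally show "(\<integral>\<^sup>+t. (\<Sum>m. (if m = 0 then U t else 0) * g m t) \<partial>lborel)
        \<le> A * mixed_integral (p / (p - 1)) (2 / (2 - 1)) g powe (1 - 1 / p)"
      using p by (simp add: mult_left_mono powe_mono)
  qed (use p in auto)
  then show ?thesis using p by (simp add: mixed_integral_single)
qed

section \<open>The vector-valued maximal theorem\<close>

lemma maximal_fun_Lp: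
  assumes "1 < p"
  obtains C where "C < top" "\<And>f. f \<in> borel_measurable borel \<Longrightarrow>
    (\<integral>\<^sup>+t. maximal_fun f t powe p \<partial>lborel) \<le> C * (\<integral>\<^sup>+t. f t powe p \<partial>lborel)"
proof -
  obtain C where C: "C < top" "\<And>f w. f \<in> borel_measurable borel \<Longrightarrow> w \<in> borel_measurable borel \<Longrightarrow>
    (\<integral>\<^sup>+t. maximal_fun f t powe p * w t \<partial>lborel) \<le> C * (\<integral>\<^sup>+t. f t powe p * maximal_fun w t \<partial>lborel)"
    using maximal_fun_weighted[OF assms] by blast
  show ?thesis
  proof (rule that)
    show "C * 2 < top" using C(1) by (simp add: ennreal_mult_less_top)
    fix f :: "real \<Rightarrow> ennreal" assume [measurable]: "f \<in> borel_measurable borel"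
    show "(\<integral>\<^sup>+t. maximal_fun f t powe p \<partial>lborel) \<le> C * 2 * (\<integral>\<^sup>+t. f t powe p \<partial>lborel)"
      using C(2)[of f "\<lambda>_. 1"] by (simp add: maximal_fun_const nn_integral_multc mult.assoc mult.commute[of 2])
  qed
qed

lemma maximal_fun_mixed_eq:
  assumes "1 < p"
  obtains C where "C < top" "\<And>F. (\<And>m. F m \<in> borel_measurable borel) \<Longrightarrow>
    mixed_integral p p (\<lambda>m. maximal_fun (F m)) \<le> C * mixed_integral p p F"
proof -
  obtain C where C: "C < top" "\<And>f. f \<in> borel_measurable borel \<Longrightarrow>
    (\<integral>\<^sup>+t. maximal_fun f t powe p \<partial>lborel) \<le> C * (\<integral>\<^sup>+t. f t powe p \<partial>lborel)"
    using maximal_fun_Lp[OF assms] by blast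
  show ?thesis
  proof (rule that[OF C(1)])
    fix F :: "nat \<Rightarrow> real \<Rightarrow> ennreal" assume [measurable]: "\<And>m. F m \<in> borel_measurable borel"
    have eq: "mixed_integral p p G = (\<Sum>m. \<integral>\<^sup>+t. G m t powe p \<partial>lborel)"
      if [measurable]: "\<And>m. G m \<in> borel_measurable borel" for G :: "nat \<Rightarrow> real \<Rightarrow> ennreal"
      using assms by (simp add: mixed_integral_def nn_integral_suminf)
    have "mixed_integral p p (\<lambda>m. maximal_fun (F m)) = (\<Sum>m. \<integral>\<^sup>+t. maximal_fun (F m) t powe p \<partial>lborel)"
      by (rule eq) measurable
    also have "\<dots> \<le> (\<Sum>m. C * (\<integral>\<^sup>+t. F m t powe p \<partial>lborel))"
      by (intro suminf_le C(2)) auto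
    also have "\<dots> = C * mixed_integral p p F"
      by (simp add: eq)
    finally show "mixed_integral p p (\<lambda>m. maximal_fun (F m)) \<le> C * mixed_integral p p F" .
  qed
qed

text \<open>
  Interpolation between \<open>L\<^sup>p(\<ell>\<^sup>p)\<close> and \<open>L\<^sup>p(\<ell>\<^sup>\<infinity>)\<close>: with \<open>N\<close> the \<open>\<ell>\<^sup>q\<close> norm of \<open>F\<close>, one has
  \<open>F\<^sub>m = N\<^sup>1\<^sup>-\<^sup>\<theta> h\<^sub>m\<^sup>\<theta>\<close> with \<open>\<theta> = p / q\<close>, where the \<open>\<ell>\<^sup>p\<close> norm of \<open>h\<close> equals \<open>N\<close>, wherever \<open>N\<close> is finite, and only the scalar maximal
  inequality is applied, to \<open>N\<close> and to each \<open>h\<^sub>m\<close>.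
\<close>

lemma maximal_fun_mixed_less:
  assumes p: "1 < p" and pq: "p < q"
  obtains C where "C < top" "\<And>F. (\<And>m. F m \<in> borel_measurable borel) \<Longrightarrow>
    mixed_integral p q (\<lambda>m. maximal_fun (F m)) \<le> C * mixed_integral p q F"
proof -
  obtain C where C: "C < top" "\<And>f. f \<in> borel_measurable borel \<Longrightarrow>
    (\<integral>\<^sup>+t. maximal_fun f t powe p \<partial>lborel) \<le> C * (\<integral>\<^sup>+t. f t powe p \<partial>lborel)"
    using maximal_fun_Lp[OF p] by blast
  show ?thesis
  proof (rule that)
    show "C + 1 < top" using C(1) by simp
    fix F :: "nat \<Rightarrow> real \<Rightarrow> ennreal" assume F [measurable]: "\<And>m. F m \<in> borel_measurable borel"
    define N where "N t = (\<Sum>m. F m t powe q) powe (1 / q)" for t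
    have [measurable]: "N \<in> borel_measurable borel" unfolding N_def[abs_def] by measurable
    define I where "I = (\<integral>\<^sup>+t. N t powe p \<partial>lborel)"
    have I: "mixed_integral p q F = I"
      using assms by (simp add: mixed_integral_def I_def N_def powe_powe)
    show "mixed_integral p q (\<lambda>m. maximal_fun (F m)) \<le> (C + 1) * mixed_integral p q F"
    proof (cases "I = top")
      case True
      then show ?thesis by (simp add: I ennreal_mult_top)
    next
      case False
      then have "AE t in lborel. N t powe p \<noteq> top"
        using nn_integral_PInf_AE[of "\<lambda>t. N t powe p" lborel] by (simp add: I_def)
      then have N_fin: "AE t in lborel. N t < top"
        using p by (auto simp: less_top)
      define \<theta> where "\<theta> = p / q"
      have \<theta>: "0 < \<theta>" "\<theta> < 1" "\<theta> * q = p" "(1 - \<theta>) * q = q - p" using assms by (auto simp: \<theta>_def field_simps)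
      define h where "h m t = lattice_factor p q (N t) (F m t)" for m t
      have [measurable]: "h m \<in> borel_measurable borel" for m
        unfolding h_def[abs_def] lattice_factor_def by measurable
      have aN: "F m t \<le> N t" for m t
        unfolding N_def using assms by (intro powe_le_suminf_powe) auto
      have fac: "AE t in lborel. F m t \<le> N t powe (1 - \<theta>) * h m t powe \<theta>" for m
        using N_fin
      proof eventually_elim
        fix t assume "N t < top"
        then show "F m t \<le> N t powe (1 - \<theta>) * h m t powe \<theta>"
          using lattice_factor(1)[of p q "F m t" "N t"] aN assms
          by (simp add: h_def \<theta>_def mult.commute)
      qed
      have "AE t in lborel. (\<Sum>m. h m t powe p) = N t powe p"
        using N_fin
      proof eventually_elim
        fix t assume "N t < top"
        then show "(\<Sum>m. h m t powe p) = N t powe p"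
          unfolding h_def using assms by (intro suminf_lattice_factor) (auto simp: N_def)
      qed
      then have H: "(\<integral>\<^sup>+t. (\<Sum>m. h m t powe p) \<partial>lborel) = I"
        unfolding I_def by (rule nn_integral_cong_AE)
      have pt: "(\<Sum>m. maximal_fun (F m) t powe q) powe (p / q)
          \<le> (maximal_fun N t powe p) powe (1 - \<theta>) * (\<Sum>m. maximal_fun (h m) t powe p) powe \<theta>" for t
      proof -
        have "maximal_fun (F m) t \<le> maximal_fun N t powe (1 - \<theta>) * maximal_fun (h m) t powe \<theta>" for m
          using maximal_fun_mono_AE[OF fac[of m]] maximal_fun_Hoelder[of N "h m" \<theta> t] \<theta>
          by (auto intro: order_trans)
        then have "maximal_fun (F m) t powe q \<le> (maximal_fun N t powe (1 - \<theta>) * maximal_fun (h m) t powe \<theta>) powe q" for m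
          using assms by (intro powe_mono) auto
        also have "(maximal_fun N t powe (1 - \<theta>) * maximal_fun (h m) t powe \<theta>) powe q
           = maximal_fun N t powe (q - p) * maximal_fun (h m) t powe p" for m
          using assms \<theta>(1,2) by (simp add: powe_mult powe_powe \<theta>(3,4))
        finally have "(\<Sum>m. maximal_fun (F m) t powe q) \<le> (\<Sum>m. maximal_fun N t powe (q - p) * maximal_fun (h m) t powe p)"
          by (intro suminf_le) auto
        then have "(\<Sum>m. maximal_fun (F m) t powe q) powe \<theta> \<le> (maximal_fun N t powe (q - p) * (\<Sum>m. maximal_fun (h m) t powe p)) powe \<theta>"
          using \<theta> by (intro powe_mono) auto
        also have "\<dots> = (maximal_fun N t powe p) powe (1 - \<theta>) * (\<Sum>m. maximal_fun (h m) t powe p) powe \<theta>"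
        proof -
          have "(q - p) * \<theta> = p * (1 - \<theta>)" using assms by (simp add: \<theta>_def field_simps)
          then show ?thesis using assms \<theta>(1,2) by (simp add: powe_mult powe_powe)
        qed
        finally show ?thesis by (simp add: \<theta>_def)
      qed
      have "mixed_integral p q (\<lambda>m. maximal_fun (F m))
          \<le> (\<integral>\<^sup>+t. (maximal_fun N t powe p) powe (1 - \<theta>) * (\<Sum>m. maximal_fun (h m) t powe p) powe \<theta> \<partial>lborel)"
        unfolding mixed_integral_def by (intro nn_integral_mono pt)
      also have "\<dots> \<le> (\<integral>\<^sup>+t. maximal_fun N t powe p \<partial>lborel) powe (1 - \<theta>)
          * (\<integral>\<^sup>+t. (\<Sum>m. maximal_fun (h m) t powe p) \<partial>lborel) powe \<theta>"
        using \<theta> by (intro nn_integral_Hoelder) auto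
      also have "(\<integral>\<^sup>+t. (\<Sum>m. maximal_fun (h m) t powe p) \<partial>lborel) = (\<Sum>m. \<integral>\<^sup>+t. maximal_fun (h m) t powe p \<partial>lborel)"
        by (intro nn_integral_suminf) measurable
      also have "\<dots> \<le> (\<Sum>m. C * (\<integral>\<^sup>+t. h m t powe p \<partial>lborel))"
        by (intro suminf_le C(2)) auto
      also have "\<dots> = C * (\<integral>\<^sup>+t. (\<Sum>m. h m t powe p) \<partial>lborel)"
        by (simp add: nn_integral_suminf)
      also have "\<dots> = C * I" by (simp add: H)
      also have "(\<integral>\<^sup>+t. maximal_fun N t powe p \<partial>lborel) \<le> C * I"
        unfolding I_def by (intro C(2)) measurable
      finally have "mixed_integral p q (\<lambda>m. maximal_fun (F m)) \<le> (C * I) powe (1 - \<theta>) * (C * I) powe \<theta>"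
        using \<theta> by (simp add: mult_mono powe_mono)
      also have "\<dots> = C * I" using powe_add[of "1 - \<theta>" \<theta> "C * I"] \<theta> by simp
      also have "\<dots> \<le> (C + 1) * mixed_integral p q F" by (simp add: I mult_right_mono)
      finally show ?thesis .
    qed
  qed
qed

text \<open>
  The function \<open>U = \<Sum>\<^sub>m (M F\<^sub>m)\<^sup>q\<close> has to be bounded in \<open>L\<^sup>s\<close> with \<open>s = p / q > 1\<close>. Paired with \<open>g\<close> it is controlled by
  the weighted inequality, which moves the maximal operator from all the \<open>F\<^sub>m\<close> to the one function \<open>g\<close>.
\<close>

lemma maximal_fun_mixed_greater:
  assumes q: "1 < q" and pq: "q < p"
  obtains C where "C < top" "\<And>F. (\<And>m. F m \<in> borel_measurable borel) \<Longrightarrow>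
    mixed_integral p q (\<lambda>m. maximal_fun (F m)) \<le> C * mixed_integral p q F"
proof -
  obtain C where C: "C < top" "\<And>f w. f \<in> borel_measurable borel \<Longrightarrow> w \<in> borel_measurable borel \<Longrightarrow>
    (\<integral>\<^sup>+t. maximal_fun f t powe q * w t \<partial>lborel) \<le> C * (\<integral>\<^sup>+t. f t powe q * maximal_fun w t \<partial>lborel)"
    using maximal_fun_weighted[OF q] by blast
  define s where "s = p / q"
  have s: "1 < s" using assms by (simp add: s_def)
  obtain D where D: "D < top" "\<And>f. f \<in> borel_measurable borel \<Longrightarrow>
    (\<integral>\<^sup>+t. maximal_fun f t powe (s / (s - 1)) \<partial>lborel) \<le> D * (\<integral>\<^sup>+t. f t powe (s / (s - 1)) \<partial>lborel)"
    using maximal_fun_Lp[of "s / (s - 1)"] conjugate_exponent(1)[OF s] by blast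
  define B where "B = C * D powe (1 - 1 / s)"
  show ?thesis
  proof (rule that)
    show "B powe s < top" using C(1) D(1) s by (auto simp: B_def ennreal_mult_less_top)
    fix F :: "nat \<Rightarrow> real \<Rightarrow> ennreal" assume F [measurable]: "\<And>m. F m \<in> borel_measurable borel"
    define N where "N t = (\<Sum>m. F m t powe q)" for t
    have [measurable]: "N \<in> borel_measurable borel" unfolding N_def[abs_def] by measurable
    define U where "U t = (\<Sum>m. maximal_fun (F m) t powe q)" for t
    have [measurable]: "U \<in> borel_measurable borel" unfolding U_def[abs_def] by measurable
    have "(\<integral>\<^sup>+t. U t powe s \<partial>lborel) \<le> (B * (\<integral>\<^sup>+t. N t powe s \<partial>lborel) powe (1 / s)) powe s"
    proof (rule duality)
      fix g :: "real \<Rightarrow> ennreal" assume g [measurable]: "g \<in> borel_measurable borel"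
      have "(\<integral>\<^sup>+t. U t * g t \<partial>lborel) = (\<Sum>m. \<integral>\<^sup>+t. maximal_fun (F m) t powe q * g t \<partial>lborel)"
        by (simp add: U_def nn_integral_suminf flip: ennreal_suminf_multc)
      also have "\<dots> \<le> (\<Sum>m. C * (\<integral>\<^sup>+t. F m t powe q * maximal_fun g t \<partial>lborel))"
        by (intro suminf_le C(2)) auto
      also have "\<dots> = C * (\<integral>\<^sup>+t. N t * maximal_fun g t \<partial>lborel)"
        by (simp add: N_def nn_integral_suminf flip: ennreal_suminf_multc)
      also have "\<dots> \<le> C * ((\<integral>\<^sup>+t. N t powe s \<partial>lborel) powe (1 / s) * (\<integral>\<^sup>+t. maximal_fun g t powe (s / (s - 1)) \<partial>lborel) powe (1 - 1 / s))"
        using s by (intro mult_left_mono Hoelder_conjugate) auto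
      also have "\<dots> \<le> C * ((\<integral>\<^sup>+t. N t powe s \<partial>lborel) powe (1 / s) * (D * (\<integral>\<^sup>+t. g t powe (s / (s - 1)) \<partial>lborel)) powe (1 - 1 / s))"
        using s g by (intro mult_left_mono powe_mono D(2)) auto
      finally show "(\<integral>\<^sup>+t. U t * g t \<partial>lborel)
        \<le> B * (\<integral>\<^sup>+t. N t powe s \<partial>lborel) powe (1 / s) * (\<integral>\<^sup>+t. g t powe (s / (s - 1)) \<partial>lborel) powe (1 - 1 / s)"
        using s by (simp add: B_def powe_mult mult_ac)
    qed (use s in auto)
    then have "(\<integral>\<^sup>+t. U t powe s \<partial>lborel) \<le> B powe s * (\<integral>\<^sup>+t. N t powe s \<partial>lborel)"
      using s by (simp add: powe_mult)
    then show "mixed_integral p q (\<lambda>m. maximal_fun (F m)) \<le> B powe s * mixed_integral p q F"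
      by (simp only: mixed_integral_def U_def N_def s_def)
  qed
qed

theorem maximal_fun_mixed:
  assumes "1 < p" "1 < q"
  obtains C where "C < top" "\<And>F. (\<And>m. F m \<in> borel_measurable borel) \<Longrightarrow>
    mixed_integral p q (\<lambda>m. maximal_fun (F m)) \<le> C * mixed_integral p q F"
proof (cases p q rule: linorder_cases)
  case less
  then show ?thesis using maximal_fun_mixed_less[of p q] assms that by blast
next
  case equal
  then show ?thesis using maximal_fun_mixed_eq[of p] assms that by blast
next
  case greater
  then show ?thesis using maximal_fun_mixed_greater[of q p] assms that by blast
qed

section \<open>Positive kernels dominated by the maximal function\<close>

text \<open>
  These two bounds are all that the mixed norm estimates need from the kernels: the bound for the operators
  gives the case \<open>r = \<infinity>\<close>, the bound for their adjoints the case \<open>r = 1\<close>.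
\<close>

locale dominated_kernels =
  fixes K :: "nat \<Rightarrow> real \<Rightarrow> real \<Rightarrow> ennreal" and c :: ennreal
  assumes K_measurable [measurable]: "\<And>n. (\<lambda>(t, s). K n t s) \<in> borel_measurable (borel \<Otimes>\<^sub>M borel)"
    and c_finite: "c < top"
    and K_le: "\<And>n f t. f \<in> borel_measurable borel \<Longrightarrow> (\<integral>\<^sup>+s. f s * K n t s \<partial>lborel) \<le> c * maximal_fun f t"
    and K_adjoint_le: "\<And>n g s. g \<in> borel_measurable borel \<Longrightarrow> (\<integral>\<^sup>+t. g t * K n t s \<partial>lborel) \<le> c * maximal_fun g s"
begin

definition kernel_op :: "nat \<Rightarrow> (real \<Rightarrow> ennreal) \<Rightarrow> real \<Rightarrow> ennreal" where
  "kernel_op n f t = (\<integral>\<^sup>+s. f s * K n t s \<partial>lborel)"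

lemma measurable_kernel_op [measurable]:
  assumes [measurable]: "f \<in> borel_measurable borel"
  shows "kernel_op n f \<in> borel_measurable borel"
  unfolding kernel_op_def[abs_def] by measurable

lemma kernel_op_pairing:
  assumes [measurable]: "f \<in> borel_measurable borel" "g \<in> borel_measurable borel"
  shows "(\<integral>\<^sup>+t. kernel_op n f t * g t \<partial>lborel) \<le> c * (\<integral>\<^sup>+s. f s * maximal_fun g s \<partial>lborel)"
proof -
  have "(\<integral>\<^sup>+t. kernel_op n f t * g t \<partial>lborel) = (\<integral>\<^sup>+t. (\<integral>\<^sup>+s. f s * (g t * K n t s) \<partial>lborel) \<partial>lborel)"
    unfolding kernel_op_def by (intro nn_integral_cong, subst nn_integral_multc[symmetric]) (auto simp: mult_ac)
  also have "\<dots> = (\<integral>\<^sup>+s. (\<integral>\<^sup>+t. f s * (g t * K n t s) \<partial>lborel) \<partial>lborel)"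
    by (rule lborel_pair.Fubini') measurable
  also have "\<dots> = (\<integral>\<^sup>+s. f s * (\<integral>\<^sup>+t. g t * K n t s \<partial>lborel) \<partial>lborel)"
    by (intro nn_integral_cong nn_integral_cmult) measurable
  also have "\<dots> \<le> (\<integral>\<^sup>+s. f s * (c * maximal_fun g s) \<partial>lborel)"
    by (intro nn_integral_mono mult_left_mono K_adjoint_le) auto
  also have "\<dots> = c * (\<integral>\<^sup>+s. f s * maximal_fun g s \<partial>lborel)"
    by (simp add: nn_integral_cmult mult.left_commute)
  finally show ?thesis .
qed

text \<open>
  In the pairing with a dual function \<open>g\<^sub>m\<close> all the adjoint operators act on the same \<open>g\<^sub>m\<close> and are dominated by
  its maximal function. The sum over \<open>n\<close> then falls on \<open>h\<close> alone, and the maximal inequality in the dual space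
  finishes the proof.
\<close>

theorem kernel_op_sum_bounded:
  assumes p: "1 < p" and q: "1 < q"
  obtains C where "C < top" "\<And>h. (\<And>m n. h m n \<in> borel_measurable borel) \<Longrightarrow>
    mixed_integral p q (\<lambda>m t. \<Sum>n. kernel_op n (h m n) t) \<le> C * mixed_integral p q (\<lambda>m t. \<Sum>n. h m n t)"
proof -
  obtain D where D: "D < top" "\<And>F. (\<And>m. F m \<in> borel_measurable borel) \<Longrightarrow>
    mixed_integral (p / (p - 1)) (q / (q - 1)) (\<lambda>m. maximal_fun (F m)) \<le> D * mixed_integral (p / (p - 1)) (q / (q - 1)) F"
    using maximal_fun_mixed[of "p / (p - 1)" "q / (q - 1)"] conjugate_exponent(1) p q by blast
  define B where "B = c * D powe (1 - 1 / p)"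
  show ?thesis
  proof (rule that)
    show "B powe p < top" using c_finite D(1) p by (auto simp: B_def ennreal_mult_less_top)
    fix h :: "nat \<Rightarrow> nat \<Rightarrow> real \<Rightarrow> ennreal" assume [measurable]: "\<And>m n. h m n \<in> borel_measurable borel"
    define H where "H m t = (\<Sum>n. h m n t)" for m t
    define U where "U m t = (\<Sum>n. kernel_op n (h m n) t)" for m t
    have [measurable]: "H m \<in> borel_measurable borel" "U m \<in> borel_measurable borel" for m
      unfolding H_def[abs_def] U_def[abs_def] by measurable
    have "mixed_integral p q U \<le> (B * mixed_integral p q H powe (1 / p)) powe p"
    proof (rule mixed_duality)
      fix g :: "nat \<Rightarrow> real \<Rightarrow> ennreal" assume g [measurable]: "\<And>m. g m \<in> borel_measurable borel"
      have "(\<integral>\<^sup>+t. (\<Sum>m. U m t * g m t) \<partial>lborel) = (\<Sum>m. \<Sum>n. \<integral>\<^sup>+t. kernel_op n (h m n) t * g m t \<partial>lborel)"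
        by (simp add: U_def nn_integral_suminf flip: ennreal_suminf_multc)
      also have "\<dots> \<le> (\<Sum>m. \<Sum>n. c * (\<integral>\<^sup>+s. h m n s * maximal_fun (g m) s \<partial>lborel))"
        by (intro suminf_le kernel_op_pairing) auto
      also have "\<dots> = c * (\<integral>\<^sup>+t. (\<Sum>m. H m t * maximal_fun (g m) t) \<partial>lborel)"
        by (simp add: H_def nn_integral_suminf flip: ennreal_suminf_multc)
      also have "\<dots> \<le> c * (mixed_integral p q H powe (1 / p) * mixed_integral (p / (p - 1)) (q / (q - 1)) (\<lambda>m. maximal_fun (g m)) powe (1 - 1 / p))"
        using p q by (intro mult_left_mono mixed_Hoelder) auto
      also have "\<dots> \<le> c * (mixed_integral p q H powe (1 / p) * (D * mixed_integral (p / (p - 1)) (q / (q - 1)) g) powe (1 - 1 / p))"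
        using p g by (intro mult_left_mono powe_mono D(2)) auto
      finally show "(\<integral>\<^sup>+t. (\<Sum>m. U m t * g m t) \<partial>lborel)
        \<le> B * mixed_integral p q H powe (1 / p) * mixed_integral (p / (p - 1)) (q / (q - 1)) g powe (1 - 1 / p)"
        using p by (simp add: B_def powe_mult mult_ac)
    qed (use p q in auto)
    then have "mixed_integral p q U \<le> B powe p * mixed_integral p q H"
      using p by (simp add: powe_mult)
    then show "mixed_integral p q (\<lambda>m t. \<Sum>n. kernel_op n (h m n) t) \<le> B powe p * mixed_integral p q (\<lambda>m t. \<Sum>n. h m n t)"
      by (simp only: U_def[abs_def] H_def[abs_def])
  qed
qed

lemma kernel_op_mono_AE:
  assumes "AE s in lborel. f s \<le> g s"
  shows "kernel_op n f t \<le> kernel_op n g t"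
  unfolding kernel_op_def
  by (rule nn_integral_mono_AE) (use assms in \<open>auto elim!: eventually_mono intro: mult_right_mono\<close>)

lemma kernel_op_Hoelder:
  assumes [measurable]: "f \<in> borel_measurable borel" "g \<in> borel_measurable borel" and \<theta>: "0 \<le> \<theta>" "\<theta> \<le> 1"
  shows "kernel_op n (\<lambda>s. f s powe (1 - \<theta>) * g s powe \<theta>) t
           \<le> kernel_op n f t powe (1 - \<theta>) * kernel_op n g t powe \<theta>"
proof -
  have split: "(a powe (1 - \<theta>) * b powe \<theta>) * x = (a * x) powe (1 - \<theta>) * (b * x) powe \<theta>" for x a b
    using powe_add[of "1 - \<theta>" \<theta> x] \<theta> by (simp add: powe_mult mult_ac)
  show ?thesis
    unfolding kernel_op_def split using \<theta> by (intro nn_integral_Hoelder) measurable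
qed

lemma kernel_op_le: "f \<in> borel_measurable borel \<Longrightarrow> kernel_op n f t \<le> c * maximal_fun f t"
  unfolding kernel_op_def by (rule K_le)

text \<open>
  The two factors of \<open>f\<^sub>m\<^sub>n = N\<^sub>m\<^sup>1\<^sup>-\<^sup>\<theta> h\<^sub>m\<^sub>n\<^sup>\<theta>\<close>, where \<open>\<theta> = 1 / r\<close> and \<open>N\<^sub>m\<close> is the \<open>\<ell>\<^sup>r\<close> norm of row \<open>m\<close>, are
  treated differently: \<open>N\<^sub>m\<close> does not depend on \<open>n\<close> and is handled by the maximal function, whereas
  \<open>\<Sum>\<^sub>n h\<^sub>m\<^sub>n = N\<^sub>m\<close> puts \<open>h\<close> within the reach of the case \<open>r = 1\<close>.
\<close>

theorem kernel_op_bounded: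
  assumes p: "1 < p" and q: "1 < q" and r: "1 \<le> r"
  obtains C where "C < top" "\<And>f. (\<And>m n. f m n \<in> borel_measurable borel) \<Longrightarrow>
    (\<integral>\<^sup>+t. (\<Sum>m. (\<Sum>n. kernel_op n (f m n) t powe r) powe (q / r)) powe (p / q) \<partial>lborel)
      \<le> C * (\<integral>\<^sup>+t. (\<Sum>m. (\<Sum>n. f m n t powe r) powe (q / r)) powe (p / q) \<partial>lborel)"
proof -
  obtain C1 where C1: "C1 < top" "\<And>F. (\<And>m. F m \<in> borel_measurable borel) \<Longrightarrow>
    mixed_integral p q (\<lambda>m. maximal_fun (F m)) \<le> C1 * mixed_integral p q F"
    using maximal_fun_mixed[OF p q] by blast
  obtain C2 where C2: "C2 < top" "\<And>h. (\<And>m n. h m n \<in> borel_measurable borel) \<Longrightarrow>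
    mixed_integral p q (\<lambda>m t. \<Sum>n. kernel_op n (h m n) t) \<le> C2 * mixed_integral p q (\<lambda>m t. \<Sum>n. h m n t)"
    using kernel_op_sum_bounded[OF p q] by blast
  define D where "D = c powe p * C1 + C2"
  define \<theta> where "\<theta> = 1 / r"
  have \<theta>: "0 < \<theta>" "\<theta> \<le> 1" using r by (auto simp: \<theta>_def)
  let ?\<Phi> = "\<lambda>x. (\<Sum>m. (\<Sum>n. x m n powe r) powe (q / r)) powe (p / q)"
  show ?thesis
  proof (rule that)
    show "D + 1 < top" using C1(1) C2(1) c_finite p by (simp add: D_def ennreal_mult_less_top)
    fix f :: "nat \<Rightarrow> nat \<Rightarrow> real \<Rightarrow> ennreal" assume f [measurable]: "\<And>m n. f m n \<in> borel_measurable borel"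
    define N where "N m t = (\<Sum>n. f m n t powe r) powe (1 / r)" for m t
    have [measurable]: "N m \<in> borel_measurable borel" for m unfolding N_def[abs_def] by measurable
    define I where "I = mixed_integral p q N"
    have I: "(\<integral>\<^sup>+t. ?\<Phi> (\<lambda>m n. f m n t) \<partial>lborel) = I"
      using p q r by (simp add: mixed_integral_def I_def N_def powe_powe)
    show "(\<integral>\<^sup>+t. ?\<Phi> (\<lambda>m n. kernel_op n (f m n) t) \<partial>lborel)
      \<le> (D + 1) * (\<integral>\<^sup>+t. ?\<Phi> (\<lambda>m n. f m n t) \<partial>lborel)"
    proof (cases "I = top")
      case True
      then show ?thesis unfolding I by (simp add: ennreal_mult_top)
    next
      case False
      then have "AE t in lborel. (\<Sum>m. N m t powe q) powe (p / q) \<noteq> top"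
        using nn_integral_PInf_AE[of "\<lambda>t. (\<Sum>m. N m t powe q) powe (p / q)" lborel]
        by (simp add: I_def mixed_integral_def)
      then have "AE t in lborel. \<forall>m. N m t < top"
      proof eventually_elim
        fix t assume "(\<Sum>m. N m t powe q) powe (p / q) \<noteq> top"
        then have fin: "(\<Sum>m. N m t powe q) < top" using p q by (simp add: less_top)
        show "\<forall>m. N m t < top"
        proof
          fix m
          have "N m t \<le> (\<Sum>m. N m t powe q) powe (1 / q)"
            using q by (intro powe_le_suminf_powe[of q "\<lambda>m. N m t"]) auto
          also have "\<dots> < top" using fin by simp
          finally show "N m t < top" .
        qed
      qed
      then have N_fin: "AE t in lborel. N m t < top" for m by auto
      define h where "h m n t = lattice_factor 1 r (N m t) (f m n t)" for m n t
      have [measurable]: "h m n \<in> borel_measurable borel" for m n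
        unfolding h_def[abs_def] lattice_factor_def by measurable
      define U where "U m t = (\<Sum>n. kernel_op n (h m n) t)" for m t
      have [measurable]: "U m \<in> borel_measurable borel" for m unfolding U_def[abs_def] by measurable
      define M where "M m t = c * maximal_fun (N m) t" for m t
      have [measurable]: "M m \<in> borel_measurable borel" for m unfolding M_def[abs_def] by measurable
      have aN: "f m n t \<le> N m t" for m n t
        unfolding N_def using r by (intro powe_le_suminf_powe) auto
      have fac: "AE t in lborel. f m n t \<le> N m t powe (1 - \<theta>) * h m n t powe \<theta>" for m n
        using N_fin[of m]
      proof eventually_elim
        fix t assume "N m t < top"
        then show "f m n t \<le> N m t powe (1 - \<theta>) * h m n t powe \<theta>"
          using lattice_factor(1)[of 1 r "f m n t" "N m t"] aN r
          by (simp add: h_def \<theta>_def mult.commute)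
      qed
      have sum_h: "AE t in lborel. (\<Sum>n. h m n t) = N m t" for m
        using N_fin[of m]
      proof eventually_elim
        fix t assume "N m t < top"
        then show "(\<Sum>n. h m n t) = N m t"
          using suminf_lattice_factor[of 1 r "N m t" "\<lambda>n. f m n t"] r by (simp add: h_def N_def)
      qed
      have U_le: "mixed_integral p q U \<le> C2 * I"
      proof -
        have "AE t in lborel. \<forall>m. (\<Sum>n. h m n t) = N m t"
          using sum_h by (simp add: AE_all_countable)
        then have "mixed_integral p q (\<lambda>m t. \<Sum>n. h m n t) = I"
          unfolding mixed_integral_def I_def by (intro nn_integral_cong_AE) (auto elim!: eventually_mono)
        then show ?thesis using C2(2)[of h] by (simp add: U_def[abs_def])
      qed
      have M_le: "mixed_integral p q M \<le> c powe p * C1 * I"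
      proof -
        have "mixed_integral p q M = (\<integral>\<^sup>+t. c powe p * (\<Sum>m. maximal_fun (N m) t powe q) powe (p / q) \<partial>lborel)"
          unfolding mixed_integral_def M_def using p q by (simp add: powe_mult powe_powe)
        also have "\<dots> = c powe p * mixed_integral p q (\<lambda>m. maximal_fun (N m))"
          unfolding mixed_integral_def by (intro nn_integral_cmult) measurable
        also have "\<dots> \<le> c powe p * (C1 * I)"
          unfolding I_def by (intro mult_left_mono C1(2)) auto
        finally show ?thesis by (simp add: mult.assoc)
      qed
      have pt1: "(\<Sum>n. kernel_op n (f m n) t powe r) powe (q / r) \<le> (M m t powe q) powe (1 - \<theta>) * (U m t powe q) powe \<theta>" for m t
      proof -
        have "kernel_op n (f m n) t \<le> M m t powe (1 - \<theta>) * kernel_op n (h m n) t powe \<theta>" for n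
        proof -
          have "kernel_op n (f m n) t \<le> kernel_op n (\<lambda>s. N m s powe (1 - \<theta>) * h m n s powe \<theta>) t"
            by (rule kernel_op_mono_AE[OF fac])
          also have "\<dots> \<le> kernel_op n (N m) t powe (1 - \<theta>) * kernel_op n (h m n) t powe \<theta>"
            using \<theta> by (intro kernel_op_Hoelder) auto
          also have "\<dots> \<le> M m t powe (1 - \<theta>) * kernel_op n (h m n) t powe \<theta>"
            unfolding M_def using \<theta> by (intro mult_right_mono powe_mono kernel_op_le) auto
          finally show ?thesis .
        qed
        then have "kernel_op n (f m n) t powe r \<le> (M m t powe (1 - \<theta>) * kernel_op n (h m n) t powe \<theta>) powe r" for n
          using r by (intro powe_mono) auto
        also have "(M m t powe (1 - \<theta>) * kernel_op n (h m n) t powe \<theta>) powe r = M m t powe (r - 1) * kernel_op n (h m n) t" for n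
        proof -
          have "(1 - \<theta>) * r = r - 1" "\<theta> * r = 1" using r by (auto simp: \<theta>_def field_simps)
          then show ?thesis using r \<theta> by (simp add: powe_mult powe_powe)
        qed
        finally have "(\<Sum>n. kernel_op n (f m n) t powe r) \<le> (\<Sum>n. M m t powe (r - 1) * kernel_op n (h m n) t)"
          by (intro suminf_le) auto
        then have "(\<Sum>n. kernel_op n (f m n) t powe r) powe (q / r) \<le> (M m t powe (r - 1) * U m t) powe (q / r)"
          using q r by (intro powe_mono) (auto simp: U_def)
        also have "\<dots> = (M m t powe q) powe (1 - \<theta>) * (U m t powe q) powe \<theta>"
        proof -
          have "(r - 1) * (q / r) = q * (1 - \<theta>)" "q / r = q * \<theta>" using r by (auto simp: \<theta>_def field_simps)
          moreover have "0 \<le> r - 1" "0 \<le> q / r" "0 \<le> q" "0 \<le> 1 - \<theta>" "0 \<le> \<theta>" using q r \<theta> by auto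
          ultimately have "(M m t powe (r - 1)) powe (q / r) = (M m t powe q) powe (1 - \<theta>)"
            "U m t powe (q / r) = (U m t powe q) powe \<theta>"
            by (metis powe_powe)+
          then show ?thesis using q r by (simp add: powe_mult)
        qed
        finally show ?thesis .
      qed
      have pt: "?\<Phi> (\<lambda>m n. kernel_op n (f m n) t)
          \<le> ((\<Sum>m. M m t powe q) powe (p / q)) powe (1 - \<theta>) * ((\<Sum>m. U m t powe q) powe (p / q)) powe \<theta>" for t
      proof -
        have "(\<Sum>m. (\<Sum>n. kernel_op n (f m n) t powe r) powe (q / r)) \<le> (\<Sum>m. (M m t powe q) powe (1 - \<theta>) * (U m t powe q) powe \<theta>)"
          by (intro suminf_le pt1) auto
        also have "\<dots> \<le> (\<Sum>m. M m t powe q) powe (1 - \<theta>) * (\<Sum>m. U m t powe q) powe \<theta>"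
          using \<theta> by (intro suminf_Hoelder) auto
        finally have "?\<Phi> (\<lambda>m n. kernel_op n (f m n) t)
            \<le> ((\<Sum>m. M m t powe q) powe (1 - \<theta>) * (\<Sum>m. U m t powe q) powe \<theta>) powe (p / q)"
          using p q by (intro powe_mono) auto
        also have "\<dots> = ((\<Sum>m. M m t powe q) powe (p / q)) powe (1 - \<theta>) * ((\<Sum>m. U m t powe q) powe (p / q)) powe \<theta>"
          using p q \<theta> by (simp add: powe_mult powe_powe mult.commute)
        finally show ?thesis .
      qed
      have "(\<integral>\<^sup>+t. ?\<Phi> (\<lambda>m n. kernel_op n (f m n) t) \<partial>lborel)
          \<le> (\<integral>\<^sup>+t. ((\<Sum>m. M m t powe q) powe (p / q)) powe (1 - \<theta>) * ((\<Sum>m. U m t powe q) powe (p / q)) powe \<theta> \<partial>lborel)"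
        by (intro nn_integral_mono pt)
      also have "\<dots> \<le> mixed_integral p q M powe (1 - \<theta>) * mixed_integral p q U powe \<theta>"
        unfolding mixed_integral_def using \<theta> by (intro nn_integral_Hoelder) auto
      also have "\<dots> \<le> (D * I) powe (1 - \<theta>) * (D * I) powe \<theta>"
      proof (intro mult_mono powe_mono)
        show "mixed_integral p q M \<le> D * I" "mixed_integral p q U \<le> D * I"
          using M_le U_le by (auto simp: D_def distrib_right intro: add_increasing add_increasing2)
      qed (use \<theta> in auto)
      also have "\<dots> = D * I" using powe_add[of "1 - \<theta>" \<theta> "D * I"] \<theta> by simp
      also have "\<dots> \<le> (D + 1) * I" by (simp add: mult_right_mono)
      finally show ?thesis unfolding I .
    qed
  qed
qed

end

section \<open>Exponential kernels\<close>

definition exp_kernel :: "real \<Rightarrow> real \<Rightarrow> real \<Rightarrow> ennreal" where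
  "exp_kernel l t s = (if s < t then ennreal (l * exp (- (l * (t - s)))) else 0)"

lemma measurable_exp_kernel [measurable]:
  "(\<lambda>(t, s). exp_kernel l t s) \<in> borel_measurable (borel \<Otimes>\<^sub>M borel)"
  unfolding exp_kernel_def by measurable

text \<open>
  A symmetric step function above the kernel \<open>l * exp (- l * u)\<close>, where \<open>l = 2 powi i\<close>. The coefficients
  \<open>8 / 4 ^ k\<close> come from \<open>exp (- y) \<le> 2 / y\<^sup>2\<close>; they beat the growth \<open>2 ^ k\<close> of the intervals, so that the
  weights of the means add up to a constant. By symmetry it serves for the adjoint operators as well.
\<close>

definition dyadic_majorant :: "int \<Rightarrow> real \<Rightarrow> ennreal" where
  "dyadic_majorant i u = (\<Sum>k. ennreal (8 / 4 ^ k * 2 powi i) * indicator {- (2 powi (int k - i))..2 powi (int k - i)} u)"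

lemma le_suminf_ennreal: "f k \<le> (\<Sum>n. f n)" for f :: "nat \<Rightarrow> ennreal"
  using sum_le_suminf[of f "{k}"] by simp

lemma measurable_dyadic_majorant [measurable]: "dyadic_majorant i \<in> borel_measurable borel"
  unfolding dyadic_majorant_def[abs_def] by measurable

lemma exp_kernel_le_majorant: "exp_kernel (2 powi i) t s \<le> dyadic_majorant i (t - s)"
proof (cases "s < t")
  case True
  define y where "y = 2 powi i * (t - s)"
  have y: "y > 0" using True by (simp add: y_def)
  have "\<exists>k::nat. y \<le> 2 ^ k" using real_arch_pow[of 2 y] by (auto intro: less_imp_le)
  define k where "k = (LEAST k::nat. y \<le> 2 ^ k)"
  have k1: "y \<le> 2 ^ k" unfolding k_def using \<open>\<exists>k::nat. y \<le> 2 ^ k\<close> by (rule LeastI_ex)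
  have k2: "k \<le> j" if "y \<le> 2 ^ j" for j unfolding k_def using that by (rule Least_le)
  have "exp (- y) \<le> 8 / 4 ^ k"
  proof (cases k)
    case 0
    have "exp (- y) \<le> 1" using y by simp
    also have "(1 :: real) \<le> 8 / 4 ^ k" using 0 by simp
    finally show ?thesis by simp
  next
    case (Suc j)
    then have "2 ^ j \<le> y" using k2[of j] by (metis Suc_n_not_le_n less_eq_real_def not_less)
    then have "(2 ^ j)\<^sup>2 \<le> y\<^sup>2" by (intro power_mono) auto
    moreover have "(2 ^ j)\<^sup>2 = (4 :: real) ^ j" by (simp add: power2_eq_square flip: power_mult_distrib)
    ultimately have "4 ^ j \<le> y\<^sup>2" by simp
    moreover have "y\<^sup>2 / 2 \<le> exp y" using exp_lower_Taylor_quadratic[of y] y by simp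
    ultimately have "4 ^ j / 2 \<le> exp y" by simp
    then have "exp (- y) \<le> 2 / 4 ^ j" by (simp add: exp_minus field_simps)
    then show ?thesis using Suc by simp
  qed
  then have "2 powi i * exp (- y) \<le> 2 powi i * (8 / 4 ^ k)" by (intro mult_left_mono) auto
  moreover have "t - s \<le> 2 powi (int k - i)"
    using k1 by (simp add: y_def power_int_diff field_simps)
  ultimately have "exp_kernel (2 powi i) t s \<le> ennreal (8 / 4 ^ k * 2 powi i) * indicator {- (2 powi (int k - i))..2 powi (int k - i)} (t - s)"
  proof -
    have "0 < (2 :: real) powi (int k - i)" by simp
    then have "- (2 powi (int k - i)) \<le> t - s" using True by linarith
    then have "t - s \<in> {- (2 powi (int k - i))..2 powi (int k - i)}"
      using \<open>t - s \<le> 2 powi (int k - i)\<close> by simp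
    then show ?thesis
      using True \<open>2 powi i * exp (- y) \<le> 2 powi i * (8 / 4 ^ k)\<close>
      by (simp add: exp_kernel_def y_def mult.commute[of _ "2 powi i"] ennreal_leI)
  qed
  also have "\<dots> \<le> dyadic_majorant i (t - s)"
    unfolding dyadic_majorant_def
    by (rule le_suminf_ennreal)
  finally show ?thesis .
qed (simp add: exp_kernel_def)

lemma dyadic_majorant_minus: "dyadic_majorant i (- u) = dyadic_majorant i u"
  unfolding dyadic_majorant_def by (intro suminf_cong) (auto simp: indicator_def)

lemma integral_majorant_le:
  assumes [measurable]: "f \<in> borel_measurable borel"
  shows "(\<integral>\<^sup>+s. f s * dyadic_majorant i (t - s) \<partial>lborel) \<le> 16 * maximal_fun f t"
proof -
  have "(\<integral>\<^sup>+s. f s * dyadic_majorant i (t - s) \<partial>lborel)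
    = (\<Sum>k. \<integral>\<^sup>+s. ennreal (8 / 4 ^ k * 2 powi i) * (indicator {- (2 powi (int k - i))..2 powi (int k - i)} (t - s) * f s) \<partial>lborel)"
    unfolding dyadic_majorant_def
    by (subst nn_integral_suminf[symmetric], measurable) (simp add: mult_ac flip: ennreal_suminf_cmult)
  also have "\<dots> = (\<Sum>k. ennreal (8 / 4 ^ k * 2 powi i) * (\<integral>\<^sup>+s. indicator {- (2 powi (int k - i))..2 powi (int k - i)} (t - s) * f s \<partial>lborel))"
    by (intro suminf_cong nn_integral_cmult) measurable
  also have "\<dots> \<le> (\<Sum>k. ennreal (8 / 4 ^ k * 2 powi i) * (ennreal (2 powi (int k - i)) * maximal_fun f t))"
    by (intro suminf_le mult_left_mono integral_le_maximal_fun) auto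
  also have "\<dots> = (\<Sum>k. ennreal (8 * (1 / 2) ^ k) * maximal_fun f t)"
  proof (intro suminf_cong)
    fix k
    have "8 / 4 ^ k * 2 powi i * 2 powi (int k - i) = (8 * (1 / 2) ^ k :: real)"
      by (simp add: power_int_diff power_divide field_simps flip: power_mult_distrib)
    then show "ennreal (8 / 4 ^ k * 2 powi i) * (ennreal (2 powi (int k - i)) * maximal_fun f t) = ennreal (8 * (1 / 2) ^ k) * maximal_fun f t"
      by (simp flip: mult.assoc ennreal_mult')
  qed
  also have "\<dots> = 16 * maximal_fun f t"
  proof -
    have "(\<lambda>k. 8 * (1 / 2) ^ k :: real) sums (8 * (1 / (1 - 1 / 2)))"
      by (intro sums_mult geometric_sums) simp
    then have "(\<Sum>k. ennreal (8 * (1 / 2) ^ k)) = ennreal 16"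
      by (intro suminf_ennreal_eq) auto
    then show ?thesis by simp
  qed
  finally show ?thesis .
qed

text \<open>
  The family of exponents \<open>e\<close> is arbitrary so that the kernels can also be indexed by pairs.
\<close>

lemma dominated_exp_kernels: "dominated_kernels (\<lambda>n. exp_kernel (2 ^ e n)) 16"
proof
  fix n :: nat and f :: "real \<Rightarrow> ennreal" and t :: real
  assume f: "f \<in> borel_measurable borel"
  have pow: "exp_kernel (2 ^ e n) = exp_kernel (2 powi int (e n))" by simp
  have "(\<integral>\<^sup>+s. f s * exp_kernel (2 ^ e n) t s \<partial>lborel) \<le> (\<integral>\<^sup>+s. f s * dyadic_majorant (int (e n)) (t - s) \<partial>lborel)"
    unfolding pow by (intro nn_integral_mono mult_left_mono exp_kernel_le_majorant) auto
  then show "(\<integral>\<^sup>+s. f s * exp_kernel (2 ^ e n) t s \<partial>lborel) \<le> 16 * maximal_fun f t"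
    using integral_majorant_le[OF f] by (rule order_trans)
  have "exp_kernel (2 ^ e n) s t \<le> dyadic_majorant (int (e n)) (t - s)" for s
    using exp_kernel_le_majorant[of "int (e n)" s t] dyadic_majorant_minus[of _ "s - t"] unfolding pow by simp
  then have "(\<integral>\<^sup>+s. f s * exp_kernel (2 ^ e n) s t \<partial>lborel) \<le> (\<integral>\<^sup>+s. f s * dyadic_majorant (int (e n)) (t - s) \<partial>lborel)"
    by (intro nn_integral_mono mult_left_mono) auto
  then show "(\<integral>\<^sup>+s. f s * exp_kernel (2 ^ e n) s t \<partial>lborel) \<le> 16 * maximal_fun f t"
    using integral_majorant_le[OF f] by (rule order_trans)
qed auto

text \<open>
  For \<open>f\<close> supported in the half-line this is the operator \<open>T\<^sub>n\<close> that maps one entry of the inhomogeneity to the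
  corresponding entry of \<open>A u\<^sub>f\<close>; its eigenvalue is \<open>2 ^ (n + 1)\<close> because \<open>n\<close> starts at \<open>0\<close>.
\<close>

definition decay_op :: "nat \<Rightarrow> (real \<Rightarrow> ennreal) \<Rightarrow> real \<Rightarrow> ennreal" where
  "decay_op n f t = (\<integral>\<^sup>+s. f s * exp_kernel (2 ^ (n + 1)) t s \<partial>lborel)"

theorem decay_op_bounded:
  assumes "1 \<le> r" and cond: "(p > 1 \<and> (q > 1 \<or> q = 1 \<and> r = 1)) \<or> (p = 1 \<and> q = 1 \<and> r = 1)"
  obtains C where "C < top" "\<And>f. (\<And>m n. f m n \<in> borel_measurable borel) \<Longrightarrow>
    (\<integral>\<^sup>+t. (\<Sum>m. (\<Sum>n. decay_op n (f m n) t powe r) powe (q / r)) powe (p / q) \<partial>lborel)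
      \<le> C * (\<integral>\<^sup>+t. (\<Sum>m. (\<Sum>n. f m n t powe r) powe (q / r)) powe (p / q) \<partial>lborel)"
proof -
  let ?\<Phi> = "\<lambda>x. (\<Sum>m. (\<Sum>n. x m n powe r) powe (q / r)) powe (p / q)"
  consider "p > 1" "q > 1" | "p > 1" "q = 1" "r = 1" | "p = 1" "q = 1" "r = 1" using cond by blast
  then show ?thesis
  proof cases
    case 1
    interpret dominated_kernels "\<lambda>n. exp_kernel (2 ^ (n + 1))" 16 by (rule dominated_exp_kernels)
    have eq: "kernel_op = decay_op" by (intro ext) (simp only: kernel_op_def decay_op_def)
    show ?thesis using kernel_op_bounded[OF 1 assms(1)] that unfolding eq by blast
  next
    case 2
    interpret dominated_kernels "\<lambda>k. exp_kernel (2 ^ (snd (prod_decode k) + 1))" 16 by (rule dominated_exp_kernels)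
    have eq: "kernel_op k = decay_op (snd (prod_decode k))" for k by (intro ext) (simp only: kernel_op_def decay_op_def)
    obtain C where C: "C < top" "\<And>h. (\<And>m n. h m n \<in> borel_measurable borel) \<Longrightarrow>
      mixed_integral p 2 (\<lambda>m t. \<Sum>n. kernel_op n (h m n) t) \<le> C * mixed_integral p 2 (\<lambda>m t. \<Sum>n. h m n t)"
      using kernel_op_sum_bounded[of p 2] 2 by auto
    show ?thesis
    proof (rule that[OF C(1)])
      fix f :: "nat \<Rightarrow> nat \<Rightarrow> real \<Rightarrow> ennreal" assume [measurable]: "\<And>m n. f m n \<in> borel_measurable borel"
      define h where "h m k t = (if m = 0 then f (fst (prod_decode k)) (snd (prod_decode k)) t else 0)" for m k :: nat and t
      have [measurable]: "h m k \<in> borel_measurable borel" for m k unfolding h_def[abs_def] by measurable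
      have sum1: "(\<Sum>k. h m k t) = (if m = 0 then \<Sum>m. \<Sum>n. f m n t else 0)" for m t
        using suminf_ennreal_2dimen[of "\<lambda>m. \<Sum>n. f m n t" "\<lambda>(m, n). f m n t"]
        by (simp add: h_def case_prod_beta)
      have sum2: "(\<Sum>k. kernel_op k (h m k) t) = (if m = 0 then \<Sum>m. \<Sum>n. decay_op n (f m n) t else 0)" for m t
      proof (cases "m = 0")
        case True
        have "h 0 k = f (fst (prod_decode k)) (snd (prod_decode k))" for k by (simp add: h_def fun_eq_iff)
        then show ?thesis
          unfolding eq using True suminf_ennreal_2dimen[of "\<lambda>m. \<Sum>n. decay_op n (f m n) t" "\<lambda>(m, n). decay_op n (f m n) t"]
          by (simp add: case_prod_beta)
      next
        case False
        then show ?thesis unfolding eq by (simp add: decay_op_def h_def)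
      qed
      show "(\<integral>\<^sup>+t. ?\<Phi> (\<lambda>m n. decay_op n (f m n) t) \<partial>lborel)
        \<le> C * (\<integral>\<^sup>+t. ?\<Phi> (\<lambda>m n. f m n t) \<partial>lborel)"
        using C(2)[of h] 2 unfolding sum1 sum2 by (simp add: mixed_integral_single)
    qed
  next
    case 3
    define e where "e n = n + 1" for n :: nat
    interpret dominated_kernels "\<lambda>n. exp_kernel (2 ^ e n)" 16 by (rule dominated_exp_kernels)
    have eq: "decay_op = kernel_op" unfolding fun_eq_iff kernel_op_def decay_op_def by (auto simp only: e_def)
    show ?thesis
    proof (rule that)
      show "(32 :: ennreal) < top" by simp
      fix f :: "nat \<Rightarrow> nat \<Rightarrow> real \<Rightarrow> ennreal" assume [measurable]: "\<And>m n. f m n \<in> borel_measurable borel"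
      have "(\<integral>\<^sup>+t. (\<Sum>m. \<Sum>n. kernel_op n (f m n) t) \<partial>lborel) = (\<Sum>m. \<Sum>n. \<integral>\<^sup>+t. kernel_op n (f m n) t \<partial>lborel)"
        by (simp add: nn_integral_suminf)
      also have "\<dots> \<le> (\<Sum>m. \<Sum>n. 32 * (\<integral>\<^sup>+t. f m n t \<partial>lborel))"
      proof (intro suminf_le)
        fix m n
        have "(\<integral>\<^sup>+t. kernel_op n (f m n) t \<partial>lborel) \<le> 16 * (\<integral>\<^sup>+t. 2 * f m n t \<partial>lborel)"
          using kernel_op_pairing[of "f m n" "\<lambda>_. 1" n] by (simp add: maximal_fun_const mult.commute)
        also have "\<dots> = 32 * (\<integral>\<^sup>+t. f m n t \<partial>lborel)"
          by (simp add: nn_integral_cmult flip: mult.assoc)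
        finally show "(\<integral>\<^sup>+t. kernel_op n (f m n) t \<partial>lborel) \<le> 32 * (\<integral>\<^sup>+t. f m n t \<partial>lborel)" .
      qed auto
      also have "\<dots> = 32 * (\<integral>\<^sup>+t. (\<Sum>m. \<Sum>n. f m n t) \<partial>lborel)"
        by (simp add: nn_integral_suminf)
      finally show "(\<integral>\<^sup>+t. ?\<Phi> (\<lambda>m n. decay_op n (f m n) t) \<partial>lborel)
        \<le> 32 * (\<integral>\<^sup>+t. ?\<Phi> (\<lambda>m n. f m n t) \<partial>lborel)"
        using 3 unfolding eq by simp
    qed
  qed
qed

section \<open>The space \<open>\<ell>\<^sup>q(\<ell>\<^sup>r)\<close> through extended norms\<close>

definition mixed_enorm :: "real \<Rightarrow> real \<Rightarrow> (nat \<Rightarrow> nat \<Rightarrow> ennreal) \<Rightarrow> ennreal" where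
  "mixed_enorm q r x = (\<Sum>m. (\<Sum>n. x m n powe r) powe (q / r)) powe (1 / q)"

lemma mixed_enorm_mono:
  assumes "1 \<le> q" "1 \<le> r" "\<And>m n. x m n \<le> y m n"
  shows "mixed_enorm q r x \<le> mixed_enorm q r y"
  unfolding mixed_enorm_def using assms by (intro powe_mono suminf_le) auto

lemma measurable_mixed_enorm:
  assumes [measurable]: "\<And>m n. (\<lambda>t. x t m n) \<in> borel_measurable M"
  shows "(\<lambda>t. mixed_enorm q r (x t)) \<in> borel_measurable M"
  unfolding mixed_enorm_def by measurable

lemma le_mixed_enorm:
  assumes "1 \<le> q" "1 \<le> r"
  shows "x m n \<le> mixed_enorm q r x"
proof -
  have "x m n \<le> (\<Sum>n. x m n powe r) powe (1 / r)"
    using assms by (intro powe_le_suminf_powe) auto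
  also have "\<dots> \<le> (\<Sum>m. ((\<Sum>n. x m n powe r) powe (1 / r)) powe q) powe (1 / q)"
    using assms by (intro powe_le_suminf_powe) auto
  finally show ?thesis using assms by (simp add: mixed_enorm_def powe_powe)
qed

lemma mixed_enorm_cmult:
  assumes "1 \<le> q" "1 \<le> r"
  shows "mixed_enorm q r (\<lambda>m n. c * x m n) = c * mixed_enorm q r x"
  unfolding mixed_enorm_def using assms by (simp add: powe_mult powe_powe)

text \<open>
  The real-valued norm is defined through series that are meaningful only if they converge. In extended reals
  membership in the space becomes finiteness of the norm, and no convergence has to be carried around.
\<close>

lemma lqr_space_iff:
  assumes "1 \<le> q" "1 \<le> r"
  shows "x \<in> lqr_space q r \<longleftrightarrow> mixed_enorm q r (\<lambda>m n. ennreal (norm (x m n))) < top"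
    and "x \<in> lqr_space q r \<Longrightarrow> mixed_enorm q r (\<lambda>m n. ennreal (norm (x m n))) = ennreal (lqr_norm q r x)"
proof -
  have inner: "(\<Sum>n. ennreal (norm (x m n)) powe r) = (\<Sum>n. ennreal (norm (x m n) powr r))" for m
    using assms by (simp add: ennreal_powe)
  have eq: "mixed_enorm q r (\<lambda>m n. ennreal (norm (x m n))) = ennreal (lqr_norm q r x)" if x: "x \<in> lqr_space q r"
  proof -
    have sx: "summable (\<lambda>n. norm (x m n) powr r)" for m using x by (auto simp: lqr_space_def)
    have ox: "summable (\<lambda>m. (\<Sum>n. norm (x m n) powr r) powr (q / r))" using x by (auto simp: lqr_space_def)
    have "(\<Sum>n. ennreal (norm (x m n)) powe r) powe (q / r) = ennreal ((\<Sum>n. norm (x m n) powr r) powr (q / r))" for m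
      using assms sx[of m] unfolding inner by (simp add: suminf_ennreal2 ennreal_powe suminf_nonneg)
    then show ?thesis
      using assms ox by (simp add: mixed_enorm_def suminf_ennreal2 ennreal_powe suminf_nonneg lqr_norm_def)
  qed
  then show "x \<in> lqr_space q r \<Longrightarrow> mixed_enorm q r (\<lambda>m n. ennreal (norm (x m n))) = ennreal (lqr_norm q r x)" .
  show "x \<in> lqr_space q r \<longleftrightarrow> mixed_enorm q r (\<lambda>m n. ennreal (norm (x m n))) < top"
  proof
    assume "mixed_enorm q r (\<lambda>m n. ennreal (norm (x m n))) < top"
    then have fin: "(\<Sum>m. (\<Sum>n. ennreal (norm (x m n)) powe r) powe (q / r)) < top"
      using assms by (simp add: mixed_enorm_def)
    have fin': "(\<Sum>n. ennreal (norm (x m n)) powe r) < top" for m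
      using le_less_trans[OF le_suminf_ennreal[of _ m] fin] assms by simp
    have sx: "summable (\<lambda>n. norm (x m n) powr r)" for m
      using fin'[of m] unfolding inner by (intro summable_suminf_not_top) auto
    have "(\<Sum>n. ennreal (norm (x m n)) powe r) powe (q / r) = ennreal ((\<Sum>n. norm (x m n) powr r) powr (q / r))" for m
      using assms sx[of m] unfolding inner by (simp add: suminf_ennreal2 ennreal_powe suminf_nonneg)
    then have "summable (\<lambda>m. (\<Sum>n. norm (x m n) powr r) powr (q / r))"
      using fin by (intro summable_suminf_not_top) auto
    then show "x \<in> lqr_space q r" using sx by (simp add: lqr_space_def)
  qed (simp add: eq)
qed

lemma lqr_norm_nonneg: "0 \<le> lqr_norm q r x"
  by (simp add: lqr_norm_def)

lemma tendsto_powe_0: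
  assumes "(f \<longlongrightarrow> 0) F" "0 < a"
  shows "((\<lambda>x. f x powe a) \<longlongrightarrow> 0) F"
proof (rule order_tendstoI)
  fix u :: ennreal assume "0 < u"
  then have "0 < u powe (1 / a)" using assms by (simp add: zero_less_iff_neq_zero)
  then have "eventually (\<lambda>x. f x < u powe (1 / a)) F" by (rule order_tendstoD(2)[OF assms(1)])
  then show "eventually (\<lambda>x. f x powe a < u) F"
  proof eventually_elim
    fix x assume lt: "f x < u powe (1 / a)"
    show "f x powe a < u"
    proof (rule ccontr)
      assume "\<not> f x powe a < u"
      then have "u powe (1 / a) \<le> (f x powe a) powe (1 / a)" using assms by (intro powe_mono) auto
      then show False using lt assms by simp
    qed
  qed
qed simp

lemma suminf_ennreal_dominated_0:
  fixes f :: "nat \<Rightarrow> nat \<Rightarrow> ennreal"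
  assumes "\<And>n. (\<lambda>i. f i n) \<longlonglongrightarrow> 0" "\<And>i n. f i n \<le> w n" "(\<Sum>n. w n) < top"
  shows "(\<lambda>i. \<Sum>n. f i n) \<longlonglongrightarrow> 0"
proof -
  have "(\<lambda>i. \<integral>\<^sup>+n. f i n \<partial>count_space UNIV) \<longlonglongrightarrow> (\<integral>\<^sup>+n. 0 \<partial>count_space (UNIV :: nat set))"
    by (rule nn_integral_dominated_convergence[where w = w and u = f and u' = "\<lambda>_. 0"])
       (use assms in \<open>auto simp: nn_integral_count_space_nat\<close>)
  then show ?thesis by (simp add: nn_integral_count_space_nat)
qed

text \<open>
  Dominated convergence, first in \<open>n\<close> for each row and then in \<open>m\<close>.
\<close>

lemma mixed_enorm_dominated_0:
  assumes "1 \<le> q" "1 \<le> r"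
    and lim: "\<And>m n. (\<lambda>i. x i m n) \<longlonglongrightarrow> 0" and le: "\<And>i m n. x i m n \<le> w m n" and fin: "mixed_enorm q r w < top"
  shows "(\<lambda>i. mixed_enorm q r (x i)) \<longlonglongrightarrow> 0"
proof -
  have fin1: "(\<Sum>m. (\<Sum>n. w m n powe r) powe (q / r)) < top"
    using fin assms by (simp add: mixed_enorm_def)
  have fin2: "(\<Sum>n. w m n powe r) < top" for m
    using le_less_trans[OF le_suminf_ennreal[of _ m] fin1] assms by simp
  show ?thesis
    unfolding mixed_enorm_def
  proof (rule tendsto_powe_0, rule suminf_ennreal_dominated_0[OF _ _ fin1])
    show "(\<lambda>i. (\<Sum>n. x i m n powe r) powe (q / r)) \<longlonglongrightarrow> 0" for m
    proof (rule tendsto_powe_0, rule suminf_ennreal_dominated_0[OF _ _ fin2])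
      show "(\<lambda>i. x i m n powe r) \<longlonglongrightarrow> 0" for n
        using assms by (intro tendsto_powe_0 lim) auto
      show "x i m n powe r \<le> w m n powe r" for i n
        using assms by (intro powe_mono le) auto
    qed (use assms in auto)
    show "(\<Sum>n. x i m n powe r) powe (q / r) \<le> (\<Sum>n. w m n powe r) powe (q / r)" for i m
      using assms by (intro powe_mono suminf_le le) auto
  qed (use assms in auto)
qed

section \<open>Minkowski's integral inequality\<close>

text \<open>
  With \<open>G\<^sub>n = \<integral> F\<^sub>n\<close>, write \<open>\<Sum>\<^sub>n G\<^sub>n\<^sup>r\<close> as \<open>\<integral> \<Sum>\<^sub>n G\<^sub>n\<^sup>r\<^sup>-\<^sup>1 F\<^sub>n\<close>, apply Hoelder's inequality under the integral and
  cancel. Partial sums are used because the cancellation needs a finite quantity.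
\<close>

lemma Minkowski_integral:
  fixes F :: "nat \<Rightarrow> 'a \<Rightarrow> ennreal"
  assumes [measurable]: "\<And>n. F n \<in> borel_measurable M" and r: "1 \<le> r"
  shows "(\<Sum>n. (\<integral>\<^sup>+t. F n t \<partial>M) powe r) powe (1 / r) \<le> (\<integral>\<^sup>+t. (\<Sum>n. F n t powe r) powe (1 / r) \<partial>M)" (is "_ \<le> ?R")
proof (cases "r = 1 \<or> ?R = top")
  case True
  then show ?thesis
  proof
    assume "r = 1"
    then show ?thesis by (simp add: nn_integral_suminf)
  qed simp
next
  case False
  then have r1: "1 < r" and R: "?R < top" using r by (auto simp: less_top)
  define G where "G n = (\<integral>\<^sup>+t. F n t \<partial>M)" for n
  have G_fin: "G n < top" for n
  proof -
    have "G n \<le> ?R" unfolding G_def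
      using r by (intro nn_integral_mono powe_le_suminf_powe) auto
    then show ?thesis using R by (rule le_less_trans)
  qed
  have partial: "(\<Sum>n<N. G n powe r) \<le> ?R powe r" for N
  proof -
    define g where "g n = (if n < N then G n else 0)" for n
    define A where "A = (\<Sum>n. g n powe r)"
    have A: "A = (\<Sum>n<N. G n powe r)"
      unfolding A_def g_def using r by (subst suminf_finite[of "{..<N}"]) auto
    have "g n powe r = g n powe (r - 1) * G n" for n
      using powe_add[of "r - 1" 1 "g n"] r1 by (auto simp: g_def)
    then have "A = (\<Sum>n. \<integral>\<^sup>+t. g n powe (r - 1) * F n t \<partial>M)"
      unfolding A_def G_def by (simp add: nn_integral_cmult)
    also have "\<dots> = (\<integral>\<^sup>+t. (\<Sum>n. F n t * g n powe (r - 1)) \<partial>M)"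
      by (simp add: nn_integral_suminf mult.commute)
    also have "\<dots> \<le> (\<integral>\<^sup>+t. (\<Sum>n. F n t powe r) powe (1 / r) * A powe (1 - 1 / r) \<partial>M)"
    proof (rule nn_integral_mono)
      fix t
      have "(g n powe (r - 1)) powe (r / (r - 1)) = g n powe r" for n
        using r1 by (simp add: powe_powe)
      then show "(\<Sum>n. F n t * g n powe (r - 1)) \<le> (\<Sum>n. F n t powe r) powe (1 / r) * A powe (1 - 1 / r)"
        using suminf_Hoelder_conjugate[OF r1, of "\<lambda>n. F n t" "\<lambda>n. g n powe (r - 1)"] by (simp add: A_def)
    qed
    also have "\<dots> = ?R * A powe (1 - 1 / r)"
      by (rule nn_integral_multc) measurable
    finally have "A \<le> ?R * A powe (1 - 1 / r)" .
    moreover have "A < top" unfolding A using G_fin by simp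
    ultimately have "A \<le> ?R powe r" using r1 by (rule powe_absorb)
    then show ?thesis by (simp add: A)
  qed
  have "(\<Sum>n. G n powe r) \<le> ?R powe r"
    unfolding suminf_eq_SUP[of "\<lambda>n. G n powe r"] by (intro SUP_least partial)
  then have "(\<Sum>n. G n powe r) powe (1 / r) \<le> (?R powe r) powe (1 / r)" using r by (intro powe_mono) auto
  then show ?thesis using r by (simp add: G_def)
qed

lemma mixed_enorm_integral:
  fixes F :: "nat \<Rightarrow> nat \<Rightarrow> 'a \<Rightarrow> ennreal"
  assumes [measurable]: "\<And>m n. F m n \<in> borel_measurable M" and qr: "1 \<le> q" "1 \<le> r"
  shows "mixed_enorm q r (\<lambda>m n. \<integral>\<^sup>+t. F m n t \<partial>M) \<le> (\<integral>\<^sup>+t. mixed_enorm q r (\<lambda>m n. F m n t) \<partial>M)"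
proof -
  have eq: "mixed_enorm q r x = (\<Sum>m. ((\<Sum>n. x m n powe r) powe (1 / r)) powe q) powe (1 / q)" for x
    using qr by (simp add: mixed_enorm_def powe_powe)
  have "mixed_enorm q r (\<lambda>m n. \<integral>\<^sup>+t. F m n t \<partial>M)
      \<le> (\<Sum>m. (\<integral>\<^sup>+t. (\<Sum>n. F m n t powe r) powe (1 / r) \<partial>M) powe q) powe (1 / q)"
    unfolding eq using qr by (intro powe_mono suminf_le Minkowski_integral) auto
  also have "\<dots> \<le> (\<integral>\<^sup>+t. mixed_enorm q r (\<lambda>m n. F m n t) \<partial>M)"
    unfolding eq using qr by (intro Minkowski_integral) measurable
  finally show ?thesis .
qed

section \<open>Bochner integration in \<open>\<ell>\<^sup>q(\<ell>\<^sup>r)\<close> is coordinatewise integration\<close>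

lemma finite_support_in_lqr:
  assumes "finite A" "\<And>m n. (m, n) \<notin> A \<Longrightarrow> x m n = 0"
  shows "x \<in> lqr_space q r"
proof -
  have zero: "x m n = 0" if "m \<notin> fst ` A \<or> n \<notin> snd ` A" for m n
    using that by (intro assms(2)) force
  have "summable (\<lambda>n. norm (x m n) powr r)" for m
    using assms(1) zero by (intro summable_finite[of "snd ` A"]) auto
  moreover have "summable (\<lambda>m. (\<Sum>n. norm (x m n) powr r) powr (q / r))"
    using assms(1) zero by (intro summable_finite[of "fst ` A"]) auto
  ultimately show ?thesis by (simp add: lqr_space_def)
qed

lemma lqr_sum:
  assumes "1 \<le> q" "1 \<le> r" "finite A" "\<And>a. a \<in> A \<Longrightarrow> x a \<in> lqr_space q r"
  shows "(\<Sum>a\<in>A. x a) \<in> lqr_space q r"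
  using assms(3,4)
proof (induction A)
  case empty
  then show ?case by (simp add: finite_support_in_lqr[of "{}"])
next
  case (insert a A)
  have "x a - (- 1) *\<^sub>R (\<Sum>a\<in>A. x a) \<in> lqr_space q r"
    using insert by (intro lqr_diff lqr_scaleR assms(1,2)) auto
  moreover have "(\<Sum>a\<in>insert a A. x a) = x a + (\<Sum>a\<in>A. x a)" using insert(1,2) by (rule sum.insert)
  moreover have "x a - (- 1) *\<^sub>R (\<Sum>a\<in>A. x a) = x a + (\<Sum>a\<in>A. x a)" by simp
  ultimately show ?case by (simp only:)
qed

text \<open>
  A simple function may take values in any type. The double sequences carry no \<open>\<sigma>\<close>-algebra, so simplicity is
  obtained by changing one coordinate after the other.
\<close>

lemma simple_function_finitely_many_coords:
  fixes F :: "nat \<Rightarrow> nat \<Rightarrow> 'a \<Rightarrow> complex"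
  assumes "finite A" "\<And>m n. simple_function M (F m n)"
  shows "simple_function M (\<lambda>t m n. if (m, n) \<in> A then F m n t else 0)"
  using assms(1)
proof (induction A)
  case (insert p A)
  have "simple_function M (\<lambda>t. (\<lambda>x c m n. if (m, n) = p then c else x m n)
      ((\<lambda>m n. if (m, n) \<in> A then F m n t else 0)) (F (fst p) (snd p) t))"
    by (rule simple_function_compose2[OF insert.IH assms(2)])
  moreover have "(\<lambda>t. (\<lambda>x c m n. if (m, n) = p then c else x m n)
      ((\<lambda>m n. if (m, n) \<in> A then F m n t else 0)) (F (fst p) (snd p) t))
      = (\<lambda>t m n. if (m, n) \<in> insert p A then F m n t else 0)"
    by (auto simp: fun_eq_iff)
  ultimately show ?case by simp
qed simp

text \<open>
  The factor \<open>2\<close>, independent of \<open>i\<close>, is what makes dominated convergence applicable.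
\<close>

lemma simple_approximation:
  fixes f :: "'a \<Rightarrow> dseq"
  assumes f: "\<And>m n. (\<lambda>t. f t m n) \<in> borel_measurable M"
  obtains s :: "nat \<Rightarrow> 'a \<Rightarrow> dseq" where "\<And>i. simple_function M (s i)" "\<And>i t. s i t \<in> lqr_space q r"
    "\<And>i t m n. t \<in> space M \<Longrightarrow> norm (s i t m n) \<le> 2 * norm (f t m n)"
    "\<And>t m n. t \<in> space M \<Longrightarrow> (\<lambda>i. s i t m n) \<longlonglongrightarrow> f t m n"
proof -
  have "\<exists>F. (\<forall>i. simple_function M (F i)) \<and> (\<forall>t\<in>space M. (\<lambda>i. F i t) \<longlonglongrightarrow> f t m n) \<and>
      (\<forall>i. \<forall>t\<in>space M. norm (F i t) \<le> 2 * norm (f t m n))" for m n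
    using borel_measurable_implies_sequence_metric[OF f[of m n], of 0] by (simp add: dist_norm)
  then obtain F where F: "\<And>m n i. simple_function M (F m n i)"
    "\<And>m n t. t \<in> space M \<Longrightarrow> (\<lambda>i. F m n i t) \<longlonglongrightarrow> f t m n"
    "\<And>m n i t. t \<in> space M \<Longrightarrow> norm (F m n i t) \<le> 2 * norm (f t m n)"
    by metis
  define s where "s i t m n = (if (m, n) \<in> {..<i} \<times> {..<i} then F m n i t else 0)" for i :: nat and t m n
  show ?thesis
  proof (rule that[of s])
    show "simple_function M (s i)" for i
      unfolding s_def[abs_def] using F(1) by (intro simple_function_finitely_many_coords) auto
    show "s i t \<in> lqr_space q r" for i t
      by (rule finite_support_in_lqr[of "{..<i} \<times> {..<i}"]) (auto simp: s_def)
    show "norm (s i t m n) \<le> 2 * norm (f t m n)" if "t \<in> space M" for i t m n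
      using F(3)[OF that] by (simp add: s_def)
    show "(\<lambda>i. s i t m n) \<longlonglongrightarrow> f t m n" if "t \<in> space M" for t m n
    proof (rule Lim_transform_eventually[OF F(2)[OF that]])
      show "eventually (\<lambda>i. F m n i t = s i t m n) sequentially"
        using eventually_gt_at_top[of "max m n"] by eventually_elim (auto simp: s_def)
    qed
  qed
qed

lemma enorm_lqr:
  assumes "1 \<le> q" "1 \<le> r" "x \<in> lqr_space q r"
  shows "ennreal (lqr_norm q r x) = mixed_enorm q r (\<lambda>m n. ennreal (norm (x m n)))"
  using lqr_space_iff(2)[OF assms] by simp

lemma ennreal_norm_diff_le:
  fixes x y :: "'a::real_normed_vector"
  assumes "norm y \<le> 2 * norm x"
  shows "ennreal (norm (x - y)) \<le> 3 * ennreal (norm x)"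
proof -
  have "norm (x - y) \<le> 3 * norm x"
    using norm_triangle_ineq4[of x y] assms by linarith
  then have "ennreal (norm (x - y)) \<le> ennreal (3 * norm x)" by (rule ennreal_leI)
  then show ?thesis by (simp add: ennreal_mult')
qed

lemma enorm_lqr_diff_tendsto_0:
  assumes qr: "1 \<le> q" "1 \<le> r" and x: "x \<in> lqr_space q r"
    and le: "\<And>i m n. norm (y i m n) \<le> 2 * norm (x m n)" and lim: "\<And>m n. (\<lambda>i. y i m n) \<longlonglongrightarrow> x m n"
  shows "(\<lambda>i. mixed_enorm q r (\<lambda>m n. ennreal (norm (x m n - y i m n)))) \<longlonglongrightarrow> 0"
proof (rule mixed_enorm_dominated_0[OF qr])
  show "(\<lambda>i. ennreal (norm (x m n - y i m n))) \<longlonglongrightarrow> 0" for m n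
  proof -
    have "(\<lambda>i. norm (x m n - y i m n)) \<longlonglongrightarrow> norm (x m n - x m n)"
      by (intro tendsto_intros lim)
    then show ?thesis by (simp add: ennreal_tendsto_0_iff)
  qed
  show "ennreal (norm (x m n - y i m n)) \<le> 3 * ennreal (norm (x m n))" for i m n
    by (rule ennreal_norm_diff_le[OF le])
  have "mixed_enorm q r (\<lambda>m n. ennreal (norm (x m n))) < top"
    using lqr_space_iff(1)[OF qr] x by blast
  then show "mixed_enorm q r (\<lambda>m n. 3 * ennreal (norm (x m n))) < top"
    unfolding mixed_enorm_cmult[OF qr] by (simp add: ennreal_mult_less_top)
qed

lemma strongly_measurable_lqrI:
  assumes qr: "1 \<le> q" "1 \<le> r" and X: "AE t in M. f t \<in> lqr_space q r"
    and f: "\<And>m n. (\<lambda>t. f t m n) \<in> borel_measurable M"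
  shows "strongly_measurable (lqr_space q r) (lqr_norm q r) M f"
proof -
  obtain s :: "nat \<Rightarrow> 'a \<Rightarrow> dseq" where s: "\<And>i. simple_function M (s i)" "\<And>i t. s i t \<in> lqr_space q r"
    "\<And>i t m n. t \<in> space M \<Longrightarrow> norm (s i t m n) \<le> 2 * norm (f t m n)"
    "\<And>t m n. t \<in> space M \<Longrightarrow> (\<lambda>i. s i t m n) \<longlonglongrightarrow> f t m n"
    using simple_approximation[of f M q r] f by blast
  have "AE t in M. (\<lambda>i. lqr_norm q r (f t - s i t)) \<longlonglongrightarrow> 0"
    using X AE_space
  proof eventually_elim
    case (elim t)
    have "ennreal (lqr_norm q r (f t - s i t)) = mixed_enorm q r (\<lambda>m n. ennreal (norm (f t m n - s i t m n)))" for i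
      using enorm_lqr[OF qr lqr_diff[OF qr elim(1) s(2)]] by simp
    then have "(\<lambda>i. ennreal (lqr_norm q r (f t - s i t))) \<longlonglongrightarrow> 0"
      using enorm_lqr_diff_tendsto_0[OF qr elim(1), of "\<lambda>i. s i t"] s(3,4)[OF elim(2)] by simp
    then show ?case by (simp add: ennreal_tendsto_0_iff lqr_norm_nonneg)
  qed
  then show ?thesis
    using X s(1,2) unfolding strongly_measurable_def by (intro conjI exI[of _ s]) auto
qed

text \<open>
  A coordinate of a strongly measurable function is the limit of the coordinates of simple functions only
  almost everywhere. It is measurable because the Lebesgue measure is complete.
\<close>

lemma measurable_coord_lebesgue_on:
  assumes qr: "1 \<le> q" "1 \<le> r" and I: "I \<in> sets lebesgue"
    and f: "strongly_measurable (lqr_space q r) (lqr_norm q r) (lebesgue_on I) f"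
  shows "(\<lambda>t::real. f t m n) \<in> borel_measurable (lebesgue_on I)"
proof -
  obtain s where X: "AE t in lebesgue_on I. f t \<in> lqr_space q r"
    and s: "\<And>i. simple_function (lebesgue_on I) (s i)" "\<And>i. s i ` space (lebesgue_on I) \<subseteq> lqr_space q r"
    and lim: "AE t in lebesgue_on I. (\<lambda>i. lqr_norm q r (f t - s i t)) \<longlonglongrightarrow> 0"
    using f unfolding strongly_measurable_def by blast
  have [measurable]: "(\<lambda>t. s i t m n) \<in> borel_measurable (lebesgue_on I)" for i
    using simple_function_compose1[OF s(1)[of i], of "\<lambda>x. x m n"] by (rule borel_measurable_simple_function)
  define g where "g t = lim (\<lambda>i. s i t m n)" for t
  have g: "g \<in> borel_measurable (lebesgue_on I)"
    unfolding g_def[abs_def] by (rule borel_measurable_lim_metric) measurable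
  have "AE t in lebesgue_on I. g t = f t m n"
    using X lim AE_space
  proof eventually_elim
    case (elim t)
    have "(\<lambda>i. f t m n - s i t m n) \<longlonglongrightarrow> 0"
    proof (rule Lim_null_comparison[OF _ elim(2)], rule always_eventually, rule allI)
      fix i
      have "f t - s i t \<in> lqr_space q r"
        using s(2)[of i] elim by (intro lqr_diff qr) auto
      then show "norm (f t m n - s i t m n) \<le> lqr_norm q r (f t - s i t)"
        using lqr_coord_le[OF qr, of "f t - s i t" m n] by simp
    qed
    then have "(\<lambda>i. f t m n - (f t m n - s i t m n)) \<longlonglongrightarrow> f t m n - 0" by (intro tendsto_intros)
    then have "(\<lambda>i. s i t m n) \<longlonglongrightarrow> f t m n" by simp
    then show ?case by (simp add: g_def limI)
  qed
  then have "AE t in lebesgue. t \<in> I \<longrightarrow> g t = f t m n"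
    using I by (simp add: AE_restrict_space_iff)
  then have "AE t in lebesgue. (if t \<in> I then g t else 0) = (if t \<in> I then f t m n else 0)"
    by eventually_elim auto
  then have "(\<lambda>t. if t \<in> I then f t m n else 0) \<in> borel_measurable lebesgue"
    by (rule borel_measurable_AE[rotated]) (use g I in \<open>simp add: borel_measurable_if\<close>)
  then show ?thesis using I by (simp add: borel_measurable_if)
qed

lemma simple_bochner_integral_coord:
  fixes s :: "'a \<Rightarrow> dseq"
  assumes s: "Bochner_Integration.simple_bochner_integrable M s"
  shows "integrable M (\<lambda>t. s t m n)"
    and "Bochner_Integration.simple_bochner_integral M s m n = (\<integral>t. s t m n \<partial>M)"
proof -
  have lin: "linear (\<lambda>x :: dseq. x m n)"
    by (rule linearI) (auto simp: scaleR_fun_def)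
  have "{t \<in> space M. s t m n \<noteq> 0} \<subseteq> {t \<in> space M. s t \<noteq> 0}" by (auto simp: fun_eq_iff)
  moreover have "{t \<in> space M. s t \<noteq> 0} \<in> sets M"
    using s simple_functionD(2)[of M s "- {0}"]
    by (auto simp: simple_bochner_integrable.simps vimage_def Int_def conj_commute)
  ultimately have "emeasure M {t \<in> space M. s t m n \<noteq> 0} \<le> emeasure M {t \<in> space M. s t \<noteq> 0}"
    by (rule emeasure_mono)
  also have "\<dots> < \<infinity>" using s by (auto simp: simple_bochner_integrable.simps less_top)
  finally have "Bochner_Integration.simple_bochner_integrable M (\<lambda>t. s t m n)"
    using s by (auto simp: simple_bochner_integrable.simps intro: simple_function_compose1[of M s "\<lambda>x. x m n"])
  then show "integrable M (\<lambda>t. s t m n)"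
    and "Bochner_Integration.simple_bochner_integral M s m n = (\<integral>t. s t m n \<partial>M)"
    using has_bochner_integral_simple_bochner_integrable[of M "\<lambda>t. s t m n"] simple_bochner_integral_linear[OF lin s]
    by (auto simp: has_bochner_integral_iff)
qed

lemma mixed_enorm_norm_integral:
  fixes f :: "'a \<Rightarrow> dseq"
  assumes "1 \<le> q" "1 \<le> r" and int: "\<And>m n. integrable M (\<lambda>t. f t m n)"
  shows "mixed_enorm q r (\<lambda>m n. ennreal (norm (\<integral>t. f t m n \<partial>M))) \<le> (\<integral>\<^sup>+t. mixed_enorm q r (\<lambda>m n. ennreal (norm (f t m n))) \<partial>M)"
proof -
  have "mixed_enorm q r (\<lambda>m n. ennreal (norm (\<integral>t. f t m n \<partial>M))) \<le> mixed_enorm q r (\<lambda>m n. \<integral>\<^sup>+t. ennreal (norm (f t m n)) \<partial>M)"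
    using assms by (intro mixed_enorm_mono integral_norm_bound_ennreal) auto
  also have "\<dots> \<le> (\<integral>\<^sup>+t. mixed_enorm q r (\<lambda>m n. ennreal (norm (f t m n))) \<partial>M)"
    using assms by (intro mixed_enorm_integral) (auto dest: borel_measurable_integrable)
  finally show ?thesis .
qed

text \<open>
  Existence: simple functions that converge to \<open>f\<close> coordinatewise and are dominated by \<open>2 |f|\<close> in each coordinate
  converge to \<open>f\<close> in \<open>L\<^sup>1\<close> by dominated convergence, and Minkowski's integral inequality carries this over to their integrals.
  Uniqueness: evaluation of a coordinate is continuous and commutes with the integral of simple functions,
  so that the integral is determined coordinate by coordinate.
\<close>

theorem has_bochner_integral_on_lqr:
  fixes f :: "'a \<Rightarrow> dseq"
  assumes qr: "1 \<le> q" "1 \<le> r" and M: "emeasure M (space M) < top"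
    and X: "AE t in M. f t \<in> lqr_space q r"
    and f: "\<And>m n. (\<lambda>t. f t m n) \<in> borel_measurable M"
    and fin: "(\<integral>\<^sup>+t. ennreal (lqr_norm q r (f t)) \<partial>M) < top"
  shows "has_bochner_integral_on (lqr_space q r) (lqr_norm q r) M f y \<longleftrightarrow> y = (\<lambda>m n. \<integral>t. f t m n \<partial>M)"
proof -
  note f [measurable]
  define E where "E t = mixed_enorm q r (\<lambda>m n. ennreal (norm (f t m n)))" for t
  have [measurable]: "E \<in> borel_measurable M"
    unfolding E_def[abs_def] by (intro measurable_mixed_enorm) measurable
  have EX: "AE t in M. ennreal (lqr_norm q r (f t)) = E t"
    using X by eventually_elim (simp add: E_def enorm_lqr[OF qr])
  then have E_fin: "(\<integral>\<^sup>+t. E t \<partial>M) < top"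
    using fin by (simp cong: nn_integral_cong_AE)
  have int: "integrable M (\<lambda>t. f t m n)" for m n
  proof (rule integrableI_bounded)
    have "(\<integral>\<^sup>+t. ennreal (norm (f t m n)) \<partial>M) \<le> (\<integral>\<^sup>+t. E t \<partial>M)"
      unfolding E_def using le_mixed_enorm[OF qr, of "\<lambda>m n. ennreal (norm (f _ m n))"] by (intro nn_integral_mono)
    then show "(\<integral>\<^sup>+t. ennreal (norm (f t m n)) \<partial>M) < \<infinity>" using E_fin by (simp add: le_less_trans)
  qed measurable
  define x where "x = (\<lambda>m n. \<integral>t. f t m n \<partial>M)"
  have "mixed_enorm q r (\<lambda>m n. ennreal (norm (x m n))) \<le> (\<integral>\<^sup>+t. E t \<partial>M)"
    unfolding x_def E_def by (rule mixed_enorm_norm_integral[OF qr int])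
  then have xX: "x \<in> lqr_space q r"
    using E_fin lqr_space_iff(1)[OF qr, of x] by (simp add: le_less_trans)
  have "has_bochner_integral_on (lqr_space q r) (lqr_norm q r) M f x"
  proof -
    obtain s :: "nat \<Rightarrow> 'a \<Rightarrow> dseq" where s: "\<And>i. simple_function M (s i)" "\<And>i t. s i t \<in> lqr_space q r"
      "\<And>i t m n. t \<in> space M \<Longrightarrow> norm (s i t m n) \<le> 2 * norm (f t m n)"
      "\<And>t m n. t \<in> space M \<Longrightarrow> (\<lambda>i. s i t m n) \<longlonglongrightarrow> f t m n"
      using simple_approximation[of f M q r] f by blast
    have s_int: "Bochner_Integration.simple_bochner_integrable M (s i)" for i
    proof -
      have "emeasure M {y \<in> space M. s i y \<noteq> 0} \<le> emeasure M (space M)" by (rule emeasure_space)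
      then show ?thesis using s(1) M by (auto simp: simple_bochner_integrable.simps less_top[symmetric] top_unique)
    qed
    have [measurable]: "(\<lambda>t. s i t m n) \<in> borel_measurable M" for i m n
      using simple_function_compose1[OF s(1)[of i], of "\<lambda>x. x m n"] by (rule borel_measurable_simple_function)
    define D where "D i t = mixed_enorm q r (\<lambda>m n. ennreal (norm (f t m n - s i t m n)))" for i t
    have [measurable]: "D i \<in> borel_measurable M" for i
      unfolding D_def[abs_def] by (intro measurable_mixed_enorm) measurable
    have DX: "AE t in M. ennreal (lqr_norm q r (f t - s i t)) = D i t" for i
      using X by eventually_elim (simp add: D_def enorm_lqr[OF qr lqr_diff[OF qr _ s(2)]])
    have "(\<lambda>i. \<integral>\<^sup>+t. D i t \<partial>M) \<longlonglongrightarrow> (\<integral>\<^sup>+t. 0 \<partial>M)"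
    proof (rule nn_integral_dominated_convergence[where u = D and u' = "\<lambda>_. 0" and w = "\<lambda>t. 3 * E t"])
      show "AE t in M. D i t \<le> 3 * E t" for i
      proof (rule AE_I2)
        fix t assume t: "t \<in> space M"
        have "ennreal (norm (f t m n - s i t m n)) \<le> 3 * ennreal (norm (f t m n))" for m n
          by (rule ennreal_norm_diff_le[OF s(3)[OF t]])
        then show "D i t \<le> 3 * E t"
          unfolding D_def E_def mixed_enorm_cmult[OF qr, symmetric] by (intro mixed_enorm_mono qr)
      qed
      show "(\<integral>\<^sup>+t. 3 * E t \<partial>M) < \<infinity>" using E_fin by (simp add: nn_integral_cmult ennreal_mult_less_top)
      show "AE t in M. (\<lambda>i. D i t) \<longlonglongrightarrow> 0"
        using X AE_space
      proof eventually_elim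
        case (elim t)
        then show ?case unfolding D_def by (intro enorm_lqr_diff_tendsto_0 qr s(3,4)) auto
      qed
    qed measurable
    then have D_lim: "(\<lambda>i. \<integral>\<^sup>+t. D i t \<partial>M) \<longlonglongrightarrow> 0" by simp
    have D_eq: "(\<integral>\<^sup>+t. ennreal (lqr_norm q r (f t - s i t)) \<partial>M) = (\<integral>\<^sup>+t. D i t \<partial>M)" for i
      by (rule nn_integral_cong_AE[OF DX])
    have D_fin: "eventually (\<lambda>i. (\<integral>\<^sup>+t. D i t \<partial>M) < top) sequentially"
      using order_tendstoD(2)[OF D_lim, of top] by simp
    let ?S = "\<lambda>i. Bochner_Integration.simple_bochner_integral M (s i)"
    have S_le: "mixed_enorm q r (\<lambda>m n. ennreal (norm ((?S i - x) m n))) \<le> (\<integral>\<^sup>+t. D i t \<partial>M)" for i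
    proof -
      have "(?S i - x) m n = (\<integral>t. s i t m n - f t m n \<partial>M)" for m n
        using simple_bochner_integral_coord[OF s_int] int by (simp add: x_def)
      then have "mixed_enorm q r (\<lambda>m n. ennreal (norm ((?S i - x) m n)))
          \<le> (\<integral>\<^sup>+t. mixed_enorm q r (\<lambda>m n. ennreal (norm (s i t m n - f t m n))) \<partial>M)"
        using mixed_enorm_norm_integral[OF qr, of M "\<lambda>t m n. s i t m n - f t m n"]
          simple_bochner_integral_coord(1)[OF s_int] int by simp
      then show ?thesis by (simp add: D_def norm_minus_commute)
    qed
    have S_ev: "eventually (\<lambda>i. ennreal (lqr_norm q r (?S i - x)) \<le> (\<integral>\<^sup>+t. D i t \<partial>M)) sequentially"
      using D_fin
    proof eventually_elim
      case (elim i)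
      then have "?S i - x \<in> lqr_space q r"
        using S_le[of i] lqr_space_iff(1)[OF qr, of "?S i - x"] by (auto intro: le_less_trans)
      then show ?case using S_le[of i] enorm_lqr[OF qr] by simp
    qed
    have "(\<lambda>i. ennreal (lqr_norm q r (?S i - x))) \<longlonglongrightarrow> 0"
      by (rule tendsto_sandwich[OF _ S_ev tendsto_const D_lim]) simp
    then have "(\<lambda>i. lqr_norm q r (?S i - x)) \<longlonglongrightarrow> 0" by (simp add: ennreal_tendsto_0_iff lqr_norm_nonneg)
    then show ?thesis
      unfolding has_bochner_integral_on_def
      using strongly_measurable_lqrI[OF qr X f] xX s_int s(2) D_lim
      by (intro conjI exI[of _ s]) (auto simp: D_eq)
  qed
  moreover have "y = x" if y: "has_bochner_integral_on (lqr_space q r) (lqr_norm q r) M f y" for y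
  proof (intro ext)
    fix m n
    obtain s :: "nat \<Rightarrow> 'a \<Rightarrow> dseq" where yX: "y \<in> lqr_space q r"
      and s: "\<And>i. Bochner_Integration.simple_bochner_integrable M (s i)" "\<And>i. s i ` space M \<subseteq> lqr_space q r"
      and lim1: "(\<lambda>i. \<integral>\<^sup>+t. ennreal (lqr_norm q r (f t - s i t)) \<partial>M) \<longlonglongrightarrow> 0"
      and lim2: "(\<lambda>i. lqr_norm q r (Bochner_Integration.simple_bochner_integral M (s i) - y)) \<longlonglongrightarrow> 0"
      using y unfolding has_bochner_integral_on_def by blast
    let ?S = "\<lambda>i. Bochner_Integration.simple_bochner_integral M (s i)"
    have "?S i \<in> lqr_space q r" for i
      unfolding simple_bochner_integral_def
      using s(1)[of i] s(2)[of i]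
      by (intro lqr_sum lqr_scaleR qr) (auto simp: simple_bochner_integrable.simps dest: simple_functionD)
    then have "norm ((?S i - y) m n) \<le> lqr_norm q r (?S i - y)" for i
      by (intro lqr_coord_le qr lqr_diff yX)
    then have "(\<lambda>i. (?S i - y) m n) \<longlonglongrightarrow> 0"
      by (intro Lim_null_comparison[OF _ lim2]) simp
    then have "(\<lambda>i. (?S i - y) m n + y m n) \<longlonglongrightarrow> 0 + y m n" by (intro tendsto_intros)
    then have 1: "(\<lambda>i. ?S i m n) \<longlonglongrightarrow> y m n" by simp
    have le: "ennreal (norm (?S i m n - x m n)) \<le> (\<integral>\<^sup>+t. ennreal (lqr_norm q r (f t - s i t)) \<partial>M)" for i
    proof -
      have "?S i m n - x m n = (\<integral>t. s i t m n - f t m n \<partial>M)"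
        using simple_bochner_integral_coord[OF s(1)] int by (simp add: x_def)
      also have "ennreal (norm \<dots>) \<le> (\<integral>\<^sup>+t. ennreal (norm (s i t m n - f t m n)) \<partial>M)"
        using simple_bochner_integral_coord(1)[OF s(1)] int by (intro integral_norm_bound_ennreal) auto
      also have "\<dots> \<le> (\<integral>\<^sup>+t. ennreal (lqr_norm q r (f t - s i t)) \<partial>M)"
      proof (rule nn_integral_mono_AE)
        show "AE t in M. ennreal (norm (s i t m n - f t m n)) \<le> ennreal (lqr_norm q r (f t - s i t))"
          using X AE_space
        proof eventually_elim
          case (elim t)
          then have "f t - s i t \<in> lqr_space q r" using s(2)[of i] by (intro lqr_diff qr) auto
          then show ?case
            using lqr_coord_le[OF qr, of "f t - s i t" m n] by (simp add: norm_minus_commute ennreal_leI)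
        qed
      qed
      finally show ?thesis .
    qed
    have "(\<lambda>i. ennreal (norm (?S i m n - x m n))) \<longlonglongrightarrow> 0"
      by (rule tendsto_sandwich[OF _ always_eventually tendsto_const lim1]) (use le in auto)
    then have "(\<lambda>i. norm (?S i m n - x m n)) \<longlonglongrightarrow> 0" by (simp add: ennreal_tendsto_0_iff)
    then have 2: "(\<lambda>i. ?S i m n) \<longlonglongrightarrow> x m n" by (simp add: tendsto_norm_zero_iff LIM_zero_cancel)
    show "y m n = x m n" using 1 2 by (rule LIMSEQ_unique)
  qed
  ultimately show ?thesis unfolding x_def by blast
qed

corollary bochner_integral_on_lqr:
  fixes f :: "'a \<Rightarrow> dseq"
  assumes "1 \<le> q" "1 \<le> r" "emeasure M (space M) < top"
    "AE t in M. f t \<in> lqr_space q r" "\<And>m n. (\<lambda>t. f t m n) \<in> borel_measurable M"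
    "(\<integral>\<^sup>+t. ennreal (lqr_norm q r (f t)) \<partial>M) < top"
  shows "bochner_integral_on (lqr_space q r) (lqr_norm q r) M f = (\<lambda>m n. \<integral>t. f t m n \<partial>M)"
    and "(\<lambda>m n. \<integral>t. f t m n \<partial>M) \<in> lqr_space q r"
  using has_bochner_integral_on_lqr[OF assms]
  by (auto simp: bochner_integral_on_def has_bochner_integral_on_def)

section \<open>The mild solution of the diagonal problem\<close>

lemma Lp_integral_enorm:
  assumes "1 \<le> q" "1 \<le> r" "0 < p" and X: "AE t in M. f t \<in> lqr_space q r"
  shows "(\<integral>\<^sup>+t. ennreal (lqr_norm q r (f t) powr p) \<partial>M)
    = (\<integral>\<^sup>+t. (\<Sum>m. (\<Sum>n. ennreal (norm (f t m n)) powe r) powe (q / r)) powe (p / q) \<partial>M)"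
proof (rule nn_integral_cong_AE)
  show "AE t in M. ennreal (lqr_norm q r (f t) powr p)
      = (\<Sum>m. (\<Sum>n. ennreal (norm (f t m n)) powe r) powe (q / r)) powe (p / q)"
    using X
  proof eventually_elim
    case (elim t)
    have "ennreal (lqr_norm q r (f t) powr p) = ennreal (lqr_norm q r (f t)) powe p"
      using assms(3) by (simp add: ennreal_powe lqr_norm_nonneg)
    also have "\<dots> = (\<Sum>m. (\<Sum>n. ennreal (norm (f t m n)) powe r) powe (q / r)) powe (p / q)"
      using assms by (simp add: enorm_lqr[OF assms(1,2) elim] mixed_enorm_def powe_powe)
    finally show ?case .
  qed
qed

lemma nn_integral_lebesgue_on:
  assumes "I \<in> sets lebesgue"
  shows "(\<integral>\<^sup>+t. f t \<partial>lebesgue_on I) = (\<integral>\<^sup>+t. f t * indicator I t \<partial>lborel)"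
  using assms by (simp add: nn_integral_restrict_space nn_integral_completion)

lemma AE_lebesgue_on_subset:
  assumes "I \<in> sets lebesgue" "J \<in> sets lebesgue" "J \<subseteq> I" "AE t in lebesgue_on I. P t"
  shows "AE t in lebesgue_on J. P t"
  using assms by (auto simp: AE_restrict_space_iff elim: eventually_mono)

text \<open>
  On a set of finite measure \<open>x \<le> 1 + x\<^sup>p\<close> replaces Hoelder's inequality.
\<close>

lemma lqr_norm_locally_integrable:
  fixes f :: "real \<Rightarrow> dseq"
  assumes qr: "1 \<le> q" "1 \<le> r" and p: "1 \<le> p" and I: "I \<in> sets lebesgue"
    and f: "Lp_fun (lqr_space q r) (lqr_norm q r) p (lebesgue_on I) f"
    and J: "J \<in> sets lebesgue" "J \<subseteq> I" "emeasure lebesgue J < top"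
  shows "(\<integral>\<^sup>+t. ennreal (lqr_norm q r (f t)) \<partial>lebesgue_on J) < top"
proof -
  have sm: "strongly_measurable (lqr_space q r) (lqr_norm q r) (lebesgue_on I) f"
    and fin: "(\<integral>\<^sup>+t. ennreal (lqr_norm q r (f t) powr p) \<partial>lebesgue_on I) < top"
    using f by (auto simp: Lp_fun_def)
  have X: "AE t in lebesgue_on I. f t \<in> lqr_space q r" using sm by (simp add: strongly_measurable_def)
  define E where "E t = mixed_enorm q r (\<lambda>m n. ennreal (norm (f t m n)))" for t
  have [measurable]: "(\<lambda>t. f t m n) \<in> borel_measurable (lebesgue_on I)" for m n
    by (rule measurable_coord_lebesgue_on[OF qr I sm])
  have EI: "E \<in> borel_measurable (lebesgue_on I)"
    unfolding E_def[abs_def] by (intro measurable_mixed_enorm) measurable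
  have [measurable]: "E \<in> borel_measurable (lebesgue_on J)"
    by (rule measurable_restrict_mono[OF EI J(2)])
  have EX: "AE t in lebesgue_on I. ennreal (lqr_norm q r (f t)) = E t"
    using X by eventually_elim (simp add: E_def enorm_lqr[OF qr])
  have le: "E t \<le> 1 + E t powe p" for t
  proof (cases "E t \<le> 1")
    case True
    then show ?thesis by (simp add: add_increasing2)
  next
    case False
    then have "1 powe (p - 1) \<le> E t powe (p - 1)" using p by (intro powe_mono) auto
    then have "1 * E t \<le> E t powe (p - 1) * E t" by (intro mult_right_mono) auto
    also have "\<dots> = E t powe p" using powe_add[of "p - 1" 1 "E t"] p by simp
    finally show ?thesis by (simp add: add_increasing)
  qed
  have "(\<integral>\<^sup>+t. ennreal (lqr_norm q r (f t)) \<partial>lebesgue_on J) = (\<integral>\<^sup>+t. E t \<partial>lebesgue_on J)"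
    by (intro nn_integral_cong_AE AE_lebesgue_on_subset[OF I J(1,2) EX])
  also have "\<dots> \<le> (\<integral>\<^sup>+t. 1 + E t powe p \<partial>lebesgue_on J)"
    by (intro nn_integral_mono le)
  also have "\<dots> = emeasure (lebesgue_on J) J + (\<integral>\<^sup>+t. E t powe p \<partial>lebesgue_on J)"
    by (subst nn_integral_add) auto
  also have "emeasure (lebesgue_on J) J = emeasure lebesgue J"
    using J by (intro emeasure_restrict_space) auto
  also have "(\<integral>\<^sup>+t. E t powe p \<partial>lebesgue_on J) \<le> (\<integral>\<^sup>+t. E t powe p \<partial>lebesgue_on I)"
    unfolding nn_integral_lebesgue_on[OF I] nn_integral_lebesgue_on[OF J(1)]
    using J(2) by (intro nn_integral_mono mult_left_mono) (auto simp: indicator_def)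
  also have "(\<integral>\<^sup>+t. E t powe p \<partial>lebesgue_on I) = (\<integral>\<^sup>+t. ennreal (lqr_norm q r (f t) powr p) \<partial>lebesgue_on I)"
  proof (rule nn_integral_cong_AE)
    show "AE t in lebesgue_on I. E t powe p = ennreal (lqr_norm q r (f t) powr p)"
      using EX
    proof eventually_elim
      case (elim t)
      then show ?case using p ennreal_powe[OF lqr_norm_nonneg[of q r "f t"], of p] by simp
    qed
  qed
  finally have "(\<integral>\<^sup>+t. ennreal (lqr_norm q r (f t)) \<partial>lebesgue_on J)
      \<le> emeasure lebesgue J + (\<integral>\<^sup>+t. ennreal (lqr_norm q r (f t) powr p) \<partial>lebesgue_on I)"
    by (simp add: add_left_mono)
  also have "\<dots> < top" using J(3) fin by simp
  finally show ?thesis .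
qed

text \<open>
  This covers both kinds of time intervals. The mild solution at a time in \<open>I\<close> depends on the values of \<open>f\<close> on \<open>I\<close>
  only.
\<close>

definition initial_interval :: "real set \<Rightarrow> bool" where
  "initial_interval I \<longleftrightarrow> I \<in> sets borel \<and> (\<forall>t\<in>I. 0 < t \<and> {0<..<t} \<subseteq> I)"

lemma mild_solution_lqr:
  fixes f :: "real \<Rightarrow> dseq"
  assumes qr: "1 \<le> q" "1 \<le> r" and p: "1 \<le> p" and I: "initial_interval I"
    and f: "Lp_fun (lqr_space q r) (lqr_norm q r) p (lebesgue_on I) f" and t: "t \<in> I"
  shows "mild_solution (lqr_space q r) (lqr_norm q r) diag_semigroup f t
      = (\<lambda>m n. \<integral>s. of_real (exp (- (2 ^ (n + 1)) * (t - s))) * f s m n \<partial>lebesgue_on {0<..<t})" (is "_ = ?u")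
    and "mild_solution (lqr_space q r) (lqr_norm q r) diag_semigroup f t \<in> lqr_space q r"
proof -
  have IL: "I \<in> sets lebesgue" and J: "{0<..<t} \<in> sets lebesgue" "{0<..<t} \<subseteq> I" and t0: "0 < t"
    using I t by (auto simp: initial_interval_def)
  have sm: "strongly_measurable (lqr_space q r) (lqr_norm q r) (lebesgue_on I) f"
    using f by (auto simp: Lp_fun_def)
  then have "AE s in lebesgue_on I. f s \<in> lqr_space q r" by (simp add: strongly_measurable_def)
  then have X: "AE s in lebesgue_on {0<..<t}. f s \<in> lqr_space q r"
    by (rule AE_lebesgue_on_subset[OF IL J])
  let ?g = "\<lambda>s. diag_semigroup (t - s) (f s)"
  have fin: "emeasure (lebesgue_on {0<..<t}) (space (lebesgue_on {0<..<t})) < top"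
    using J(1) t0 by (simp add: emeasure_restrict_space)
  have gX: "AE s in lebesgue_on {0<..<t}. ?g s \<in> lqr_space q r"
    using X AE_space by eventually_elim (auto intro!: diag_semigroup_contraction qr)
  have gm: "(\<lambda>s. ?g s m n) \<in> borel_measurable (lebesgue_on {0<..<t})" for m n
  proof -
    have "(\<lambda>s. complex_of_real (exp (- (2 ^ (n + 1)) * (t - s)))) \<in> borel_measurable borel" by measurable
    then have [measurable]: "(\<lambda>s. complex_of_real (exp (- (2 ^ (n + 1)) * (t - s)))) \<in> borel_measurable (lebesgue_on {0<..<t})"
      by (intro measurable_restrict_space1 measurable_completion) simp
    have [measurable]: "(\<lambda>s. f s m n) \<in> borel_measurable (lebesgue_on {0<..<t})"
      by (rule measurable_restrict_mono[OF measurable_coord_lebesgue_on[OF qr IL sm] J(2)])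
    show ?thesis unfolding diag_semigroup_def by measurable
  qed
  have "(\<integral>\<^sup>+s. ennreal (lqr_norm q r (?g s)) \<partial>lebesgue_on {0<..<t}) \<le> (\<integral>\<^sup>+s. ennreal (lqr_norm q r (f s)) \<partial>lebesgue_on {0<..<t})"
  proof (rule nn_integral_mono_AE)
    show "AE s in lebesgue_on {0<..<t}. ennreal (lqr_norm q r (?g s)) \<le> ennreal (lqr_norm q r (f s))"
      using X AE_space by eventually_elim (auto intro!: ennreal_leI diag_semigroup_contraction qr)
  qed
  also have "\<dots> < top"
    by (rule lqr_norm_locally_integrable[OF qr p IL f J]) (use t0 in auto)
  finally have gfin: "(\<integral>\<^sup>+s. ennreal (lqr_norm q r (?g s)) \<partial>lebesgue_on {0<..<t}) < top" .
  note b = bochner_integral_on_lqr[OF qr fin gX gm gfin]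
  show "mild_solution (lqr_space q r) (lqr_norm q r) diag_semigroup f t = ?u"
    unfolding mild_solution_def b(1) by (simp add: diag_semigroup_def)
  show "mild_solution (lqr_space q r) (lqr_norm q r) diag_semigroup f t \<in> lqr_space q r"
    unfolding mild_solution_def b(1) by (rule b(2))
qed

section \<open>Boundedness of the map from \<open>f\<close> to \<open>A u\<^sub>f\<close>\<close>

lemma borel_representative:
  fixes c :: "real \<Rightarrow> complex"
  assumes "c \<in> borel_measurable lebesgue"
  obtains g where "g \<in> borel_measurable borel" "AE t in lborel. c t = g t"
proof -
  have [measurable]: "c \<in> borel_measurable lebesgue" by fact
  obtain a where a: "a \<in> borel_measurable borel" "AE t in lborel. Re (c t) = a t"
    using completion_ex_borel_measurable_real[of "\<lambda>t. Re (c t)" lborel] by auto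
  obtain b where b: "b \<in> borel_measurable borel" "AE t in lborel. Im (c t) = b t"
    using completion_ex_borel_measurable_real[of "\<lambda>t. Im (c t)" lborel] by auto
  note a(1) [measurable] b(1) [measurable]
  show ?thesis
  proof (rule that)
    have "(\<lambda>t. Complex (a t) (b t)) = (\<lambda>t. complex_of_real (a t) + \<i> * complex_of_real (b t))"
      by (simp add: Complex_eq)
    then show "(\<lambda>t. Complex (a t) (b t)) \<in> borel_measurable borel" by simp
    show "AE t in lborel. c t = Complex (a t) (b t)"
      using a(2) b(2) by eventually_elim (simp add: complex_eq_iff)
  qed
qed

text \<open>
  The estimates for positive functions concern Borel functions on the whole line, whereas \<open>f\<close> is Lebesgue
  measurable on \<open>I\<close>. A Borel representative \<open>g\<close> of the extension of \<open>f\<close> by \<open>0\<close> links the two and leaves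
  all the integrals unchanged.
\<close>

theorem maximal_regularity_if:
  assumes qr: "1 \<le> q" "1 \<le> r" and p: "1 \<le> p" and I: "initial_interval I"
    and cond: "(p > 1 \<and> (q > 1 \<or> q = 1 \<and> r = 1)) \<or> (p = 1 \<and> q = 1 \<and> r = 1)"
  shows "maximal_Lp_regularity (lqr_space q r) (lqr_norm q r) (diag_dom q r) diag_op diag_semigroup p I"
proof -
  obtain C where C: "C < top" "\<And>f. (\<And>m n. f m n \<in> borel_measurable borel) \<Longrightarrow>
    (\<integral>\<^sup>+t. (\<Sum>m. (\<Sum>n. decay_op n (f m n) t powe r) powe (q / r)) powe (p / q) \<partial>lborel)
      \<le> C * (\<integral>\<^sup>+t. (\<Sum>m. (\<Sum>n. f m n t powe r) powe (q / r)) powe (p / q) \<partial>lborel)"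
    using decay_op_bounded[OF qr(2) cond] by blast
  have IL: "I \<in> sets lebesgue" and IB [measurable]: "I \<in> sets borel"
    using I by (auto simp: initial_interval_def)
  let ?X = "lqr_space q r" and ?N = "lqr_norm q r"
  show ?thesis
    unfolding maximal_Lp_regularity_def
  proof (intro exI[of _ "enn2real C powr (1 / p)"] allI impI conjI)
    fix f assume f: "Lp_fun ?X ?N p (lebesgue_on I) f"
    let ?u = "mild_solution ?X ?N diag_semigroup f"
    have sm: "strongly_measurable ?X ?N (lebesgue_on I) f"
      and fin: "(\<integral>\<^sup>+t. ennreal (?N (f t) powr p) \<partial>lebesgue_on I) < top"
      using f by (auto simp: Lp_fun_def)
    have X: "AE t in lebesgue_on I. f t \<in> ?X" using sm by (simp add: strongly_measurable_def)
    define rep where "rep m n g \<longleftrightarrow> g \<in> borel_measurable borel \<and> (AE t in lborel. (if t \<in> I then f t m n else 0) = g t)"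
      for m n and g :: "real \<Rightarrow> complex"
    have "\<exists>g. rep m n g" for m n
    proof -
      have "(\<lambda>t. if t \<in> I then f t m n else 0) \<in> borel_measurable lebesgue"
        using measurable_coord_lebesgue_on[OF qr IL sm] IL by (simp add: borel_measurable_if)
      then show ?thesis unfolding rep_def by (rule borel_representative) blast
    qed
    then obtain g where "rep m n (g m n)" for m n by metis
    then have g [measurable]: "\<And>m n. g m n \<in> borel_measurable borel"
      and fg: "\<And>m n. AE t in lborel. (if t \<in> I then f t m n else 0) = g m n t"
      unfolding rep_def by blast+
    define F where "F m n t = ennreal (norm (g m n t))" for m n t
    have [measurable]: "F m n \<in> borel_measurable borel" for m n unfolding F_def[abs_def] by measurable
    define P where "P x = (\<Sum>m. (\<Sum>n. x m n powe r) powe (q / r)) powe (p / q)" for x :: "nat \<Rightarrow> nat \<Rightarrow> ennreal"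
    have P_mono: "P x \<le> P y" if "\<And>m n. x m n \<le> y m n" for x y
      unfolding P_def using that qr p by (intro powe_mono suminf_le) auto
    have fF: "(\<integral>\<^sup>+t. ennreal (?N (f t) powr p) \<partial>lebesgue_on I) = (\<integral>\<^sup>+t. P (\<lambda>m n. F m n t) \<partial>lborel)"
    proof -
      have "(\<integral>\<^sup>+t. ennreal (?N (f t) powr p) \<partial>lebesgue_on I) = (\<integral>\<^sup>+t. P (\<lambda>m n. ennreal (norm (f t m n))) * indicator I t \<partial>lborel)"
        using Lp_integral_enorm[OF qr _ X, of p] p by (simp add: P_def nn_integral_lebesgue_on[OF IL])
      also have "\<dots> = (\<integral>\<^sup>+t. P (\<lambda>m n. F m n t) \<partial>lborel)"
      proof (rule nn_integral_cong_AE)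
        have "AE t in lborel. \<forall>m n. (if t \<in> I then f t m n else 0) = g m n t"
          using fg by (simp add: AE_all_countable)
        then show "AE t in lborel. P (\<lambda>m n. ennreal (norm (f t m n))) * indicator I t = P (\<lambda>m n. F m n t)"
        proof eventually_elim
          case (elim t)
          show ?case
          proof (cases "t \<in> I")
            case True
            then show ?thesis using elim by (simp add: F_def)
          next
            case False
            then have "g m n t = 0" for m n using elim[rule_format, of m n] by simp
            then show ?thesis using False qr p by (simp add: F_def P_def)
          qed
        qed
      qed
      finally show ?thesis .
    qed
    let ?w = "\<lambda>n t s. complex_of_real (exp (- (2 ^ (n + 1)) * (t - s)))"
    \<comment> \<open>\<open>v\<close> is \<open>A u\<^sub>f\<close> written as integrals over the line, in a form that is visibly measurable in \<open>t\<close>\<close>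
    define v where "v m n t = 2 ^ (n + 1) * (\<integral>s. indicator {0<..<t} s *\<^sub>R (?w n t s * g m n s) \<partial>lborel)" for m n t
    have [measurable]: "v m n \<in> borel_measurable borel" for m n
    proof -
      have "(\<lambda>(t, s). indicator {0<..<t} s *\<^sub>R (?w n t s * g m n s))
        = (\<lambda>(t, s). (if 0 < s \<and> s < t then ?w n t s * g m n s else 0))"
        by (auto simp: fun_eq_iff indicator_def)
      also have "\<dots> \<in> borel_measurable (borel \<Otimes>\<^sub>M lborel)" by measurable
      finally have "(\<lambda>t. \<integral>s. indicator {0<..<t} s *\<^sub>R (?w n t s * g m n s) \<partial>lborel) \<in> borel_measurable borel"
        by (rule lborel.borel_measurable_lebesgue_integral)
      then show ?thesis unfolding v_def[abs_def] by measurable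
    qed
    have Au: "diag_op (?u t) m n = v m n t" if t: "t \<in> I" for t m n
    proof -
      have t0: "{0<..<t} \<subseteq> I" using I t by (auto simp: initial_interval_def)
      have "(\<integral>s. ?w n t s * f s m n \<partial>lebesgue_on {0<..<t})
          = (\<integral>s. indicator {0<..<t} s *\<^sub>R (?w n t s * f s m n) \<partial>lebesgue)"
        by (rule integral_restrict_space) simp
      also have "\<dots> = (\<integral>s. indicator {0<..<t} s *\<^sub>R (?w n t s * g m n s) \<partial>lebesgue)"
      proof -
        have eq: "(\<lambda>s. indicator {0<..<t} s *\<^sub>R (?w n t s * f s m n))
          = (\<lambda>s. indicator {0<..<t} s *\<^sub>R (?w n t s * (if s \<in> I then f s m n else 0)))"
          using t0 by (auto simp: fun_eq_iff indicator_def)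
        have c: "(\<lambda>t. if t \<in> I then f t m n else 0) \<in> borel_measurable lebesgue"
          using measurable_coord_lebesgue_on[OF qr IL sm] IL by (simp add: borel_measurable_if)
        have e: "(\<lambda>s. indicat_real {0<..<t} s) \<in> borel_measurable lebesgue"
          "(\<lambda>s. ?w n t s) \<in> borel_measurable lebesgue"
          "g m n \<in> borel_measurable lebesgue"
          by (intro measurable_completion; measurable)+
        show ?thesis
          unfolding eq
        proof (rule integral_cong_AE)
          have "AE s in lebesgue. (if s \<in> I then f s m n else 0) = g m n s"
            using fg[of m n] by (rule AE_completion)
          then show "AE s in lebesgue. indicator {0<..<t} s *\<^sub>R (?w n t s * (if s \<in> I then f s m n else 0))
            = indicator {0<..<t} s *\<^sub>R (?w n t s * g m n s)"
            by eventually_elim (simp only:)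
        qed (intro borel_measurable_scaleR borel_measurable_times c e)+
      qed
      also have "\<dots> = (\<integral>s. indicator {0<..<t} s *\<^sub>R (?w n t s * g m n s) \<partial>lborel)"
        by (rule integral_completion) measurable
      finally show ?thesis
        unfolding mild_solution_lqr(1)[OF qr p I f t] diag_op_def v_def by (simp only:)
    qed
    have v_le: "ennreal (norm (v m n t)) \<le> decay_op n (F m n) t" for m n t
    proof -
      let ?h = "\<lambda>s. indicator {0<..<t} s *\<^sub>R (?w n t s * g m n s)"
      have "ennreal (norm (\<integral>s. ?h s \<partial>lborel)) \<le> (\<integral>\<^sup>+s. ennreal (norm (?h s)) \<partial>lborel)"
      proof (cases "integrable lborel ?h")
        case True
        then show ?thesis by (rule integral_norm_bound_ennreal)
      qed (simp add: not_integrable_integral_eq)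
      then have "ennreal (2 ^ (n + 1)) * ennreal (norm (\<integral>s. ?h s \<partial>lborel)) \<le> ennreal (2 ^ (n + 1)) * (\<integral>\<^sup>+s. ennreal (norm (?h s)) \<partial>lborel)"
        by (rule mult_left_mono) simp
      also have "\<dots> = (\<integral>\<^sup>+s. ennreal (2 ^ (n + 1)) * ennreal (norm (?h s)) \<partial>lborel)"
        by (rule nn_integral_cmult[symmetric]) measurable
      also have "\<dots> \<le> decay_op n (F m n) t"
        unfolding decay_op_def
      proof (rule nn_integral_mono)
        fix s
        show "ennreal (2 ^ (n + 1)) * ennreal (norm (?h s)) \<le> F m n s * exp_kernel (2 ^ (n + 1)) t s"
          by (auto simp: indicator_def exp_kernel_def F_def norm_mult mult_ac simp flip: ennreal_mult' ennreal_mult'')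
      qed
      finally show ?thesis by (simp add: v_def norm_mult norm_power flip: ennreal_mult')
    qed
    have bound: "(\<integral>\<^sup>+t. P (\<lambda>m n. ennreal (norm (v m n t))) \<partial>lborel) \<le> C * (\<integral>\<^sup>+t. ennreal (?N (f t) powr p) \<partial>lebesgue_on I)"
    proof -
      have "(\<integral>\<^sup>+t. P (\<lambda>m n. ennreal (norm (v m n t))) \<partial>lborel) \<le> (\<integral>\<^sup>+t. P (\<lambda>m n. decay_op n (F m n) t) \<partial>lborel)"
        by (intro nn_integral_mono P_mono v_le)
      also have "\<dots> \<le> C * (\<integral>\<^sup>+t. P (\<lambda>m n. F m n t) \<partial>lborel)"
        unfolding P_def by (rule C(2)) measurable
      finally show ?thesis by (simp add: fF)
    qed
    have bound_fin: "(\<integral>\<^sup>+t. P (\<lambda>m n. ennreal (norm (v m n t))) \<partial>lborel) < top"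
      using bound C(1) fin by (simp add: ennreal_mult_less_top le_less_trans)
    have [measurable]: "(\<lambda>t. P (\<lambda>m n. ennreal (norm (v m n t)))) \<in> borel_measurable borel"
      unfolding P_def by measurable
    have "AE t in lborel. P (\<lambda>m n. ennreal (norm (v m n t))) \<noteq> \<infinity>"
      using bound_fin by (intro nn_integral_PInf_AE) auto
    then have "AE t in lborel. (\<lambda>m n. v m n t) \<in> ?X"
    proof eventually_elim
      case (elim t)
      then have "mixed_enorm q r (\<lambda>m n. ennreal (norm (v m n t))) < top"
        using qr p by (simp add: P_def mixed_enorm_def less_top)
      then show ?case using lqr_space_iff(1)[OF qr, of "\<lambda>m n. v m n t"] by simp
    qed
    then have "AE t in lebesgue. (\<lambda>m n. v m n t) \<in> ?X" by (rule AE_completion)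
    then have "AE t in lebesgue_on I. (\<lambda>m n. v m n t) \<in> ?X"
      using IL by (auto simp: AE_restrict_space_iff elim: eventually_mono)
    then have AuX: "AE t in lebesgue_on I. diag_op (?u t) \<in> ?X"
      using AE_space
    proof eventually_elim
      case (elim t)
      then have "diag_op (?u t) = (\<lambda>m n. v m n t)" using Au[of t] by (auto simp: fun_eq_iff)
      then show ?case using elim by simp
    qed
    show "AE t in lebesgue_on I. ?u t \<in> diag_dom q r"
      using AuX AE_space
    proof eventually_elim
      case (elim t)
      then have "?u t \<in> ?X" by (intro mild_solution_lqr(2)[OF qr p I f]) simp
      then show ?case using elim by (simp add: diag_dom_def)
    qed
    have sm_Au: "strongly_measurable ?X ?N (lebesgue_on I) (\<lambda>t. diag_op (?u t))"
    proof (rule strongly_measurable_lqrI[OF qr AuX])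
      fix m n
      have "v m n \<in> borel_measurable (lebesgue_on I)"
        by (intro measurable_restrict_space1 measurable_completion) measurable
      then show "(\<lambda>t. diag_op (?u t) m n) \<in> borel_measurable (lebesgue_on I)"
        by (rule measurable_cong[THEN iffD1, rotated]) (simp add: Au)
    qed
    have J_Au: "(\<integral>\<^sup>+t. ennreal (?N (diag_op (?u t)) powr p) \<partial>lebesgue_on I) \<le> C * (\<integral>\<^sup>+t. ennreal (?N (f t) powr p) \<partial>lebesgue_on I)"
    proof -
      have "(\<integral>\<^sup>+t. ennreal (?N (diag_op (?u t)) powr p) \<partial>lebesgue_on I)
          = (\<integral>\<^sup>+t. P (\<lambda>m n. ennreal (norm (diag_op (?u t) m n))) * indicator I t \<partial>lborel)"
        using Lp_integral_enorm[OF qr _ AuX, of p] p by (simp add: P_def nn_integral_lebesgue_on[OF IL])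
      also have "\<dots> \<le> (\<integral>\<^sup>+t. P (\<lambda>m n. ennreal (norm (v m n t))) \<partial>lborel)"
        by (intro nn_integral_mono) (auto simp: indicator_def Au)
      finally show ?thesis using bound by (rule order_trans)
    qed
    also have CJ: "\<dots> < top" using C(1) fin by (simp add: ennreal_mult_less_top)
    finally show "Lp_fun ?X ?N p (lebesgue_on I) (\<lambda>t. diag_op (?u t))"
      using sm_Au by (simp add: Lp_fun_def)
    have "enn2real (\<integral>\<^sup>+t. ennreal (?N (diag_op (?u t)) powr p) \<partial>lebesgue_on I)
        \<le> enn2real C * enn2real (\<integral>\<^sup>+t. ennreal (?N (f t) powr p) \<partial>lebesgue_on I)"
      using enn2real_mono[OF J_Au CJ] by (simp add: enn2real_mult)
    then have "enn2real (\<integral>\<^sup>+t. ennreal (?N (diag_op (?u t)) powr p) \<partial>lebesgue_on I) powr (1 / p)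
        \<le> (enn2real C * enn2real (\<integral>\<^sup>+t. ennreal (?N (f t) powr p) \<partial>lebesgue_on I)) powr (1 / p)"
      using p by (intro powr_mono2) auto
    then show "Lp_norm ?N p (lebesgue_on I) (\<lambda>t. diag_op (?u t)) \<le> enn2real C powr (1 / p) * Lp_norm ?N p (lebesgue_on I) f"
      by (simp add: Lp_norm_def powr_mult)
  qed
qed

section \<open>Counterexamples for \<open>p = 1\<close> and for \<open>q = 1\<close>\<close>

lemma powr_unbounded:
  fixes a D :: real
  assumes "a > 0"
  obtains N :: nat where "N \<ge> 1" "D < real N powr a"
proof -
  obtain N :: nat where N: "(\<bar>D\<bar> + 1) powr (1 / a) \<le> real N" using real_arch_simple by blast
  have "1 powr (1 / a) \<le> (\<bar>D\<bar> + 1) powr (1 / a)" using assms by (intro powr_mono2) auto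
  then have "N \<ge> 1" using N by simp
  moreover have "((\<bar>D\<bar> + 1) powr (1 / a)) powr a \<le> real N powr a" using N assms by (intro powr_mono2) auto
  then have "D < real N powr a" using assms by (simp add: powr_powr)
  ultimately show ?thesis by (rule that)
qed

lemma lqr_norm_zero: "lqr_norm q r 0 = 0"
  by (simp add: lqr_norm_def zero_fun_def)

lemma Lp_test_function:
  fixes f :: "real \<Rightarrow> dseq"
  assumes qr: "1 \<le> q" "1 \<le> r" and p: "1 \<le> p" and I: "I \<in> sets lebesgue"
    and J: "J \<in> sets borel" "J \<subseteq> I" "emeasure lborel J < top" and c: "0 \<le> c"
    and f: "\<And>m n. (\<lambda>t. f t m n) \<in> borel_measurable borel" "\<And>t. f t \<in> lqr_space q r"
      "\<And>t. lqr_norm q r (f t) = (if t \<in> J then c else 0)"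
  shows "Lp_fun (lqr_space q r) (lqr_norm q r) p (lebesgue_on I) f"
    and "Lp_norm (lqr_norm q r) p (lebesgue_on I) f = c * measure lborel J powr (1 / p)"
proof -
  have "(\<integral>\<^sup>+t. ennreal (lqr_norm q r (f t) powr p) \<partial>lebesgue_on I) = (\<integral>\<^sup>+t. ennreal (c powr p) * indicator J t \<partial>lborel)"
    unfolding nn_integral_lebesgue_on[OF I] f(3)
    using p J(2) by (intro nn_integral_cong) (auto simp: indicator_def)
  also have "\<dots> = ennreal (c powr p) * emeasure lborel J"
    using J(1) by (subst nn_integral_cmult_indicator) auto
  finally have int: "(\<integral>\<^sup>+t. ennreal (lqr_norm q r (f t) powr p) \<partial>lebesgue_on I) = ennreal (c powr p) * emeasure lborel J" .
  have "strongly_measurable (lqr_space q r) (lqr_norm q r) (lebesgue_on I) f"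
  proof (rule strongly_measurable_lqrI[OF qr])
    show "(\<lambda>t. f t m n) \<in> borel_measurable (lebesgue_on I)" for m n
      by (intro measurable_restrict_space1 measurable_completion) (use f(1) in simp)
  qed (use f(2) in auto)
  then show "Lp_fun (lqr_space q r) (lqr_norm q r) p (lebesgue_on I) f"
    using J(3) by (simp add: Lp_fun_def int ennreal_mult_less_top)
  have "enn2real (ennreal (c powr p) * emeasure lborel J) = c powr p * measure lborel J"
    by (simp add: enn2real_mult measure_def)
  then show "Lp_norm (lqr_norm q r) p (lebesgue_on I) f = c * measure lborel J powr (1 / p)"
    using p c by (simp add: Lp_norm_def int powr_mult powr_powr)
qed

text \<open>
  If the entry \<open>(m, n)\<close> of \<open>f\<close> is \<open>1\<close> on \<open>B'\<close>, then the time that has passed since \<open>B'\<close>, being at most \<open>2 / l\<close> with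
  \<open>l = 2 ^ (n + 1)\<close>, has damped it by no more than the factor \<open>exp (- 2)\<close>.
\<close>

lemma mild_coordinate_lower_bound:
  fixes f :: "real \<Rightarrow> dseq"
  assumes B: "B \<in> sets borel" "\<And>s. s \<in> {0<..<t} \<Longrightarrow> f s m n = (if s \<in> B then 1 else 0)"
    and B': "B' \<in> sets borel" "B' \<subseteq> B" "B' \<subseteq> {0<..<t}"
    and t: "0 < t" "\<And>s. s \<in> B' \<Longrightarrow> 2 ^ n * (t - s) \<le> 1"
  shows "2 ^ (n + 1) * exp (- 2) * measure lborel B'
      \<le> norm (2 ^ (n + 1) * (\<integral>s. complex_of_real (exp (- (2 ^ (n + 1)) * (t - s))) * f s m n \<partial>lebesgue_on {0<..<t}))"
proof -
  let ?M = "lebesgue_on {0<..<t}"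
  define h where "h s = exp (- (2 ^ (n + 1)) * (t - s)) * (if s \<in> B then 1 else 0)" for s :: real
  have fin: "emeasure ?M (space ?M) < top"
    using t(1) by (simp add: emeasure_restrict_space)
  interpret finite_measure ?M by (rule finite_measureI) (use fin in auto)
  have meas: "g \<in> borel_measurable ?M" if "g \<in> borel_measurable borel" for g :: "real \<Rightarrow> real"
    by (intro measurable_restrict_space1 measurable_completion) (use that in simp)
  have hm: "h \<in> borel_measurable ?M"
    by (rule meas) (use B(1) in \<open>unfold h_def, measurable\<close>)
  have hi: "integrable ?M h"
  proof (rule integrable_const_bound[where B = 1])
    show "AE s in ?M. norm (h s) \<le> 1"
      by (rule AE_I2) (auto simp: h_def)
  qed (rule hm)
  have "(\<integral>s. exp (- 2) * indicator B' s \<partial>?M) \<le> (\<integral>s. h s \<partial>?M)"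
  proof (rule integral_mono[OF _ hi])
    show "integrable ?M (\<lambda>s. exp (- 2) * indicat_real B' s)"
    proof (rule integrable_const_bound[where B = 1])
      show "AE s in ?M. norm (exp (- 2) * indicat_real B' s) \<le> 1"
        by (rule AE_I2) (auto simp: indicator_def)
      show "(\<lambda>s. exp (- 2) * indicat_real B' s) \<in> borel_measurable ?M"
        by (rule meas) (use B'(1) in measurable)
    qed
    fix s
    have "exp (- 2) \<le> exp (- (2 ^ (n + 1)) * (t - s))" if "s \<in> B'"
      using t(2)[OF that] by simp
    then show "exp (- 2) * indicat_real B' s \<le> h s"
      using B'(2) by (auto simp: h_def indicator_def)
  qed
  moreover have "(\<integral>s. exp (- 2) * indicator B' s \<partial>?M) = exp (- 2) * measure lborel B'"
  proof -
    have "(\<integral>s. indicator B' s \<partial>?M) = measure ?M B'"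
      using B'(1,3) by (simp add: Int_absorb2)
    also have "\<dots> = measure lborel B'"
      using B'(1,3) by (simp add: measure_restrict_space)
    finally show ?thesis by simp
  qed
  ultimately have le: "exp (- 2) * measure lborel B' \<le> (\<integral>s. h s \<partial>?M)" by simp
  have "(\<integral>s. complex_of_real (exp (- (2 ^ (n + 1)) * (t - s))) * f s m n \<partial>?M) = (\<integral>s. complex_of_real (h s) \<partial>?M)"
    by (intro Bochner_Integration.integral_cong) (auto simp: h_def B(2))
  also have "\<dots> = complex_of_real (\<integral>s. h s \<partial>?M)" by simp
  finally have eq: "(\<integral>s. complex_of_real (exp (- (2 ^ (n + 1)) * (t - s))) * f s m n \<partial>?M) = complex_of_real (\<integral>s. h s \<partial>?M)" .
  have "2 ^ (n + 1) * (exp (- 2) * measure lborel B') \<le> 2 ^ (n + 1) * \<bar>\<integral>s. h s \<partial>?M\<bar>"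
    using le by (intro mult_left_mono) auto
  then show ?thesis unfolding eq by (simp add: norm_mult norm_power mult.assoc)
qed

lemma dyadic_interval_subset:
  fixes I :: "real set"
  assumes "I = {0<..} \<or> (\<exists>T>0. I = {0<..<T})"
  obtains k :: nat where "{0<..2 * (1 / 2) ^ k} \<subseteq> I"
proof (cases "I = {0<..}")
  case True
  then have "{0<..2 * (1 / 2) ^ 0} \<subseteq> I" by auto
  then show ?thesis by (rule that)
next
  case False
  then obtain T where T: "T > 0" "I = {0<..<T}" using assms by auto
  obtain k where "(1 / 2 :: real) ^ k < T / 2" using real_arch_pow_inv[of "T / 2" "1 / 2"] T by auto
  then have "{0<..2 * (1 / 2) ^ k} \<subseteq> I" using T by auto
  then show ?thesis by (rule that)
qed

lemma lqr_norm_diagonal: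
  assumes "1 \<le> q" "1 \<le> r" "finite W"
  shows "lqr_norm q r (\<lambda>m n. if m = n \<and> n \<in> W then 1 else 0) = real (card W) powr (1 / q)"
proof -
  have inner: "(\<Sum>n. norm (if m = n \<and> n \<in> W then 1 else (0 :: complex)) powr r) = (if m \<in> W then 1 else 0)" for m
    by (subst suminf_finite[of "{m}"]) auto
  have "(\<Sum>m. (if m \<in> W then 1 else 0 :: real) powr (q / r)) = real (card W)"
    using assms by (subst suminf_finite[of W]) auto
  then show ?thesis unfolding lqr_norm_def inner by simp
qed

text \<open>
  The short pulse \<open>1\<^bsub>(0, \<epsilon>)\<^esub> \<Sum>\<^sub>n e\<^sub>n\<^sub>n\<close> comes close to an initial value. The entries \<open>(n, n)\<close> are of order \<open>\<epsilon> * 2\<^sup>n\<close> on the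
  disjoint time intervals \<open>[2\<^sup>-\<^sup>n\<^sup>-\<^sup>1, 2\<^sup>-\<^sup>n)\<close>, so in \<open>L\<^sup>1\<close> their contributions add up, while in \<open>\<ell>\<^sup>q(\<ell>\<^sup>r)\<close> the \<open>N\<close>
  entries of \<open>f\<close>, lying in distinct rows, only add up to \<open>N\<^sup>1\<^sup>/\<^sup>q\<close>.
\<close>

theorem not_maximal_L1_regularity:
  fixes I :: "real set"
  assumes qr: "1 < q" "1 \<le> r" and I: "I = {0<..} \<or> (\<exists>T>0. I = {0<..<T})"
  shows "\<not> maximal_Lp_regularity (lqr_space q r) (lqr_norm q r) (diag_dom q r) diag_op diag_semigroup 1 I"
proof
  let ?X = "lqr_space q r" and ?N = "lqr_norm q r"
  assume "maximal_Lp_regularity ?X ?N (diag_dom q r) diag_op diag_semigroup 1 I"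
  then obtain C where C: "\<And>f. Lp_fun ?X ?N 1 (lebesgue_on I) f \<Longrightarrow>
      Lp_fun ?X ?N 1 (lebesgue_on I) (\<lambda>t. diag_op (mild_solution ?X ?N diag_semigroup f t)) \<and>
      Lp_norm ?N 1 (lebesgue_on I) (\<lambda>t. diag_op (mild_solution ?X ?N diag_semigroup f t)) \<le> C * Lp_norm ?N 1 (lebesgue_on I) f"
    unfolding maximal_Lp_regularity_def by blast
  have q1: "1 \<le> q" using qr by simp
  have adm: "initial_interval I" using I by (auto simp: initial_interval_def)
  then have IL: "I \<in> sets lebesgue" by (auto simp: initial_interval_def)
  obtain k :: nat where k: "{0<..2 * (1 / 2) ^ k} \<subseteq> I" using dyadic_interval_subset[OF I] .
  have "real N powr (1 - 1 / q) \<le> exp 2 * C" if N: "N \<ge> 1" for N :: nat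
  proof -
    define W where "W = {k..<k + N}"
    \<comment> \<open>The pulse ends where the first of the time intervals used below begins.\<close>
    define \<epsilon> :: real where "\<epsilon> = (1 / 2) ^ (k + N)"
    have \<epsilon>: "0 < \<epsilon>" by (simp add: \<epsilon>_def)
    have \<epsilon>_le: "\<epsilon> \<le> (1 / 2) ^ (n + 1)" if "n \<in> W" for n
      unfolding \<epsilon>_def using that by (intro power_decreasing) (auto simp: W_def)
    have \<epsilon>I: "{0<..<\<epsilon>} \<subseteq> I"
    proof -
      have "\<epsilon> \<le> (1 / 2) ^ k" unfolding \<epsilon>_def by (intro power_decreasing) auto
      also have "(1 / 2 :: real) ^ k \<le> 2 * (1 / 2) ^ k" by simp
      finally show ?thesis using k by (auto simp: subset_iff)
    qed
    define f :: "real \<Rightarrow> dseq" where "f t = (if t \<in> {0<..<\<epsilon>} then (\<lambda>m n. if m = n \<and> n \<in> W then 1 else 0) else 0)" for t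
    have f_coord: "f t m n = (if m = n \<and> n \<in> W \<and> t \<in> {0<..<\<epsilon>} then 1 else 0)" for t m n
      by (simp add: f_def)
    have f1: "(\<lambda>t. f t m n) \<in> borel_measurable borel" for m n
      unfolding f_coord by measurable
    have f2: "f t \<in> ?X" for t
      by (rule finite_support_in_lqr[of "W \<times> W"]) (auto simp: f_coord W_def)
    have f3: "?N (f t) = (if t \<in> {0<..<\<epsilon>} then real N powr (1 / q) else 0)" for t
      using lqr_norm_diagonal[OF q1 qr(2), of W] by (simp add: f_def lqr_norm_zero W_def)
    have fL: "Lp_fun ?X ?N 1 (lebesgue_on I) f"
      and fN: "Lp_norm ?N 1 (lebesgue_on I) f = real N powr (1 / q) * measure lborel {0<..<\<epsilon>} powr (1 / 1)"
      by (rule Lp_test_function[OF q1 qr(2) _ IL _ \<epsilon>I _ _ f1 f2 f3]; use \<epsilon> in simp)+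
    define y where "y t = diag_op (mild_solution ?X ?N diag_semigroup f t)" for t
    have yL: "Lp_fun ?X ?N 1 (lebesgue_on I) y"
      and yN: "Lp_norm ?N 1 (lebesgue_on I) y \<le> C * Lp_norm ?N 1 (lebesgue_on I) f"
      using C[OF fL] by (simp_all add: y_def[abs_def])
    have yX: "AE t in lebesgue. t \<in> I \<longrightarrow> y t \<in> ?X"
      using yL IL by (simp add: Lp_fun_def strongly_measurable_def AE_restrict_space_iff)
    let ?J = "\<lambda>n. {(1 / 2) ^ (n + 1)..<(1 / 2 :: real) ^ n}"
    have y_le: "2 ^ (n + 1) * exp (- 2) * \<epsilon> \<le> ?N (y t)" if n: "n \<in> W" and t: "t \<in> ?J n" and X: "t \<in> I \<longrightarrow> y t \<in> ?X" for n t
    proof -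
      have t0: "0 < t" using t by (auto intro: less_le_trans[rotated])
      have "(1 / 2 :: real) ^ n \<le> (1 / 2) ^ k" using n by (intro power_decreasing) (auto simp: W_def)
      then have "t \<le> 2 * (1 / 2) ^ k"
        using t zero_le_power[of "1 / 2 :: real" k] unfolding atLeastLessThan_iff by linarith
      then have tI: "t \<in> I" using k t0 by auto
      have "\<epsilon> \<le> t" using \<epsilon>_le[OF n] t unfolding atLeastLessThan_iff by linarith
      have "2 ^ (n + 1) * exp (- 2) * measure lborel {0<..<\<epsilon>}
        \<le> norm (2 ^ (n + 1) * (\<integral>s. complex_of_real (exp (- (2 ^ (n + 1)) * (t - s))) * f s n n \<partial>lebesgue_on {0<..<t}))"
      proof (rule mild_coordinate_lower_bound)
        show "f s n n = (if s \<in> {0<..<\<epsilon>} then 1 else 0)" for s using n by (simp add: f_coord)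
        fix s assume "s \<in> {0<..<\<epsilon>}"
        then have "2 ^ n * (t - s) \<le> 2 ^ n * (1 / 2) ^ n" using t by (intro mult_left_mono) auto
        then show "2 ^ n * (t - s) \<le> 1" by (simp add: power_divide)
      qed (use \<open>\<epsilon> \<le> t\<close> t0 in auto)
      also have "\<dots> = norm (y t n n)"
        unfolding y_def mild_solution_lqr(1)[OF q1 qr(2) order_refl adm fL tI] diag_op_def by (rule refl)
      also have "\<dots> \<le> ?N (y t)" using X tI by (intro lqr_coord_le q1 qr(2)) auto
      finally show ?thesis using \<epsilon> by simp
    qed
    have J_unique: "n = n'" if "t \<in> ?J n" "t \<in> ?J n'" for t n n'
    proof (rule ccontr)
      assume "n \<noteq> n'"
      then consider "n + 1 \<le> n'" | "n' + 1 \<le> n" by linarith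
      then show False
      proof cases
        case 1
        then have "(1 / 2 :: real) ^ n' \<le> (1 / 2) ^ (n + 1)" by (intro power_decreasing) auto
        then show False using that unfolding atLeastLessThan_iff by linarith
      next
        case 2
        then have "(1 / 2 :: real) ^ n \<le> (1 / 2) ^ (n' + 1)" by (intro power_decreasing) auto
        then show False using that unfolding atLeastLessThan_iff by linarith
      qed
    qed
    have J_I: "?J n \<subseteq> I" if n: "n \<in> W" for n
    proof
      fix t assume t: "t \<in> ?J n"
      have "(1 / 2 :: real) ^ n \<le> (1 / 2) ^ k" using n by (intro power_decreasing) (auto simp: W_def)
      then have "t \<le> 2 * (1 / 2) ^ k"
        using t zero_le_power[of "1 / 2 :: real" k] unfolding atLeastLessThan_iff by linarith
      moreover have "0 < t" using t by (auto intro: less_le_trans[rotated])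
      ultimately show "t \<in> I" using k by auto
    qed
    let ?g = "\<lambda>n t. ennreal (2 ^ (n + 1) * exp (- 2) * \<epsilon>) * indicator (?J n) t"
    have "ennreal (real N * (exp (- 2) * \<epsilon>)) = (\<Sum>n\<in>W. ennreal (exp (- 2) * \<epsilon>))"
      by (simp add: W_def ennreal_mult' ennreal_of_nat_eq_real_of_nat)
    also have "\<dots> = (\<Sum>n\<in>W. ennreal (2 ^ (n + 1) * exp (- 2) * \<epsilon>) * emeasure lborel (?J n))"
    proof (rule sum.cong[OF refl])
      fix n
      have "(1 / 2 :: real) ^ n - (1 / 2) ^ (n + 1) = (1 / 2) ^ (n + 1)" by simp
      then have "emeasure lborel (?J n) = ennreal ((1 / 2) ^ (n + 1))" by simp
      moreover have "2 ^ (n + 1) * exp (- 2) * \<epsilon> * (1 / 2) ^ (n + 1) = exp (- 2) * \<epsilon>"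
        by (simp add: power_divide)
      ultimately show "ennreal (exp (- 2) * \<epsilon>) = ennreal (2 ^ (n + 1) * exp (- 2) * \<epsilon>) * emeasure lborel (?J n)"
        using \<epsilon> by (simp flip: ennreal_mult'')
    qed
    also have "\<dots> = (\<Sum>n\<in>W. \<integral>\<^sup>+t. ?g n t \<partial>lborel)"
      by (intro sum.cong refl, subst nn_integral_cmult_indicator) auto
    also have "\<dots> = (\<integral>\<^sup>+t. (\<Sum>n\<in>W. ?g n t) \<partial>lborel)"
      by (rule nn_integral_sum[symmetric]) measurable
    also have "\<dots> = (\<integral>\<^sup>+t. (\<Sum>n\<in>W. ?g n t) \<partial>lebesgue)"
      by (simp only: nn_integral_completion)
    also have "\<dots> \<le> (\<integral>\<^sup>+t. ennreal (?N (y t)) * indicator I t \<partial>lebesgue)"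
    proof (rule nn_integral_mono_AE)
      show "AE t in lebesgue. (\<Sum>n\<in>W. ?g n t) \<le> ennreal (?N (y t)) * indicator I t"
        using yX
      proof eventually_elim
        case (elim t)
        show ?case
        proof (cases "\<exists>n\<in>W. t \<in> ?J n")
          case True
          then obtain n where n: "n \<in> W" "t \<in> ?J n" by blast
          define G where "G i = ennreal (2 ^ (i + 1) * exp (- 2) * \<epsilon>) * indicator (?J i) t" for i
          have G0: "G i = 0" if "i \<in> W - {n}" for i
          proof -
            have "t \<notin> ?J i" using that J_unique[OF n(2), of i] by blast
            from indicator_simps(2)[OF this] show ?thesis unfolding G_def by (metis mult_zero_right)
          qed
          have "(\<Sum>i\<in>W. G i) = G n + (\<Sum>i\<in>W - {n}. G i)"
            by (rule sum.remove[OF _ n(1)]) (simp add: W_def)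
          also have "(\<Sum>i\<in>W - {n}. G i) = 0" by (rule sum.neutral) (use G0 in blast)
          also have "G n + 0 = ennreal (2 ^ (n + 1) * exp (- 2) * \<epsilon>)"
            unfolding G_def using indicator_simps(1)[OF n(2)] by (metis add_0_right mult_1_right)
          finally have "(\<Sum>n\<in>W. ?g n t) = ennreal (2 ^ (n + 1) * exp (- 2) * \<epsilon>)"
            unfolding G_def .
          also have "\<dots> \<le> ennreal (?N (y t))" by (intro ennreal_leI y_le[OF n elim])
          also have "\<dots> = ennreal (?N (y t)) * indicator I t" using J_I[OF n(1)] n(2) by auto
          finally show ?thesis .
        next
          case False
          then have "(\<Sum>n\<in>W. ?g n t) = 0"
            by (intro sum.neutral) (auto simp: indicator_def)
          then show ?thesis by simp
        qed
      qed
    qed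
    also have "\<dots> = (\<integral>\<^sup>+t. ennreal (?N (y t) powr 1) \<partial>lebesgue_on I)"
      using IL by (simp add: nn_integral_restrict_space lqr_norm_nonneg)
    finally have "ennreal (real N * (exp (- 2) * \<epsilon>)) \<le> (\<integral>\<^sup>+t. ennreal (?N (y t) powr 1) \<partial>lebesgue_on I)" .
    then have "enn2real (ennreal (real N * (exp (- 2) * \<epsilon>))) \<le> enn2real (\<integral>\<^sup>+t. ennreal (?N (y t) powr 1) \<partial>lebesgue_on I)"
      using yL by (intro enn2real_mono) (auto simp: Lp_fun_def)
    then have "real N * (exp (- 2) * \<epsilon>) \<le> Lp_norm ?N 1 (lebesgue_on I) y"
      using \<epsilon> by (simp add: Lp_norm_def)
    also have "\<dots> \<le> C * (real N powr (1 / q) * \<epsilon>)"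
      using yN \<epsilon> by (simp add: fN)
    finally have "real N * exp (- 2) \<le> C * real N powr (1 / q)"
      using \<epsilon> by (simp add: mult.assoc[symmetric])
    then have "real N \<le> exp 2 * C * real N powr (1 / q)"
      by (simp add: exp_minus field_simps)
    then show ?thesis using N by (simp add: powr_diff field_simps)
  qed
  moreover have "1 - 1 / q > 0" using qr by simp
  ultimately show False using powr_unbounded[of "1 - 1 / q" "exp 2 * C"] by (metis not_less)
qed

lemma lqr_norm_single_row:
  assumes "1 \<le> r" "finite W"
  shows "lqr_norm 1 r (\<lambda>m n. if m = a \<and> n \<in> W then 1 else 0) = real (card W) powr (1 / r)"
proof -
  have inner: "(\<Sum>n. norm (if m = a \<and> n \<in> W then 1 else (0 :: complex)) powr r) = (if m = a then real (card W) else 0)" for m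
    using assms by (subst suminf_finite[of W]) auto
  have "(\<Sum>m. (if m = a then real (card W) else 0) powr (1 / r)) = real (card W) powr (1 / r)"
    using assms by (subst suminf_finite[of "{a}"]) auto
  then show ?thesis unfolding lqr_norm_def inner by simp
qed

text \<open>
  Each row \<open>m\<close> lies in at most one \<open>S n\<close>. The \<open>\<ell>\<^sup>r\<close> norm of a row is at least any single entry of it, and for
  \<open>q = 1\<close> the norms of the rows are added.
\<close>

lemma lqr_norm_disjoint_rows:
  assumes r: "1 \<le> r" and y: "y \<in> lqr_space 1 r" and W: "finite W"
    and S: "\<And>n. n \<in> W \<Longrightarrow> finite (S n)" "\<And>m n n'. n \<in> W \<Longrightarrow> n' \<in> W \<Longrightarrow> m \<in> S n \<Longrightarrow> m \<in> S n' \<Longrightarrow> n = n'"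
  shows "(\<Sum>n\<in>W. \<Sum>m\<in>S n. norm (y m n)) \<le> lqr_norm 1 r y"
proof -
  have sy: "summable (\<lambda>n. norm (y m n) powr r)" for m
    using y by (auto simp: lqr_space_def)
  have oy: "summable (\<lambda>m. (\<Sum>n. norm (y m n) powr r) powr (1 / r))"
    using y by (auto simp: lqr_space_def)
  define A where "A = (\<Union>n\<in>W. S n)"
  have A: "finite A" using W S(1) by (simp add: A_def)
  have coord: "norm (y m n) \<le> (\<Sum>n. norm (y m n) powr r) powr (1 / r)" for m n
  proof -
    have "norm (y m n) powr r \<le> (\<Sum>n. norm (y m n) powr r)"
      using sum_le_suminf[OF sy[of m], of "{n}"] by auto
    then have "(norm (y m n) powr r) powr (1 / r) \<le> (\<Sum>n. norm (y m n) powr r) powr (1 / r)"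
      using r by (intro powr_mono2) auto
    then show ?thesis using r by (simp add: powr_powr)
  qed
  have row: "(\<Sum>n\<in>{n \<in> W. m \<in> S n}. norm (y m n)) \<le> (\<Sum>n. norm (y m n) powr r) powr (1 / r)" for m
  proof (cases "\<exists>n\<in>W. m \<in> S n")
    case True
    then obtain n where n: "n \<in> W" "m \<in> S n" by blast
    then have "{n \<in> W. m \<in> S n} = {n}" using S(2) by blast
    then show ?thesis using coord by simp
  next
    case False
    then have "{n \<in> W. m \<in> S n} = {}" by blast
    then show ?thesis by (simp only: sum.empty powr_ge_zero)
  qed
  have "(\<Sum>n\<in>W. \<Sum>m\<in>S n. norm (y m n)) = (\<Sum>n\<in>W. \<Sum>m\<in>{m \<in> A. m \<in> S n}. norm (y m n))"
    by (intro sum.cong refl) (auto simp: A_def)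
  also have "\<dots> = (\<Sum>m\<in>A. \<Sum>n\<in>{n \<in> W. m \<in> S n}. norm (y m n))"
    by (rule sum.swap_restrict[OF W A])
  also have "\<dots> \<le> (\<Sum>m\<in>A. (\<Sum>n. norm (y m n) powr r) powr (1 / r))"
    by (intro sum_mono row)
  also have "\<dots> \<le> (\<Sum>m. (\<Sum>n. norm (y m n) powr r) powr (1 / r))"
    by (intro sum_le_suminf oy A) auto
  also have "\<dots> = lqr_norm 1 r y"
  proof -
    have "0 \<le> (\<Sum>m. (\<Sum>n. norm (y m n) powr r) powr (1 / r))"
      by (intro suminf_nonneg oy) auto
    then show ?thesis by (simp add: lqr_norm_def)
  qed
  finally show ?thesis .
qed

text \<open>
  An interval \<open>[a, b]\<close> loses at most one cell of a grid at each of its ends.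
\<close>

lemma count_grid_cells:
  fixes a b \<delta> :: real
  assumes \<delta>: "0 < \<delta>" and a: "0 \<le> a"
  defines "S \<equiv> {m :: nat. a \<le> real m * \<delta> \<and> real (Suc m) * \<delta> \<le> b}"
  shows "finite S" "b - a - 2 * \<delta> \<le> real (card S) * \<delta>"
proof -
  have "m \<le> nat \<lceil>b / \<delta>\<rceil>" if "m \<in> S" for m
  proof -
    have "real m * \<delta> \<le> b" using that \<delta> by (simp add: S_def algebra_simps)
    then have "real m \<le> b / \<delta>" using \<delta> by (simp add: field_simps)
    then show ?thesis by linarith
  qed
  then have "S \<subseteq> {..nat \<lceil>b / \<delta>\<rceil>}" by blast
  then show fin: "finite S" by (rule finite_subset) simp
  define l where "l = nat \<lceil>a / \<delta>\<rceil>"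
  define u where "u = nat \<lfloor>b / \<delta>\<rfloor>"
  have "{l..<u} \<subseteq> S"
  proof
    fix m assume m: "m \<in> {l..<u}"
    have "a / \<delta> \<le> real l" unfolding l_def by linarith
    then have "a / \<delta> \<le> real m" using m by simp
    moreover have "0 < u" using m by auto
    then have "real u \<le> b / \<delta>" unfolding u_def by linarith
    then have "real (Suc m) \<le> b / \<delta>" using m by (meson Suc_leI atLeastLessThan_iff of_nat_le_iff order_trans)
    ultimately show "m \<in> S" using \<delta> by (simp add: S_def field_simps)
  qed
  with fin have "card {l..<u} \<le> card S" by (rule card_mono)
  then have "real u - real l \<le> real (card S)" by simp
  moreover have "b / \<delta> - 1 \<le> real u" unfolding u_def by linarith
  moreover have "real l \<le> a / \<delta> + 1"
  proof -
    have "0 \<le> a / \<delta>" using a \<delta> by simp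
    then show ?thesis unfolding l_def by linarith
  qed
  ultimately have "b / \<delta> - a / \<delta> - 2 \<le> real (card S)" by linarith
  then have "(b / \<delta> - a / \<delta> - 2) * \<delta> \<le> real (card S) * \<delta>" using \<delta> by (intro mult_right_mono) auto
  then show "b - a - 2 * \<delta> \<le> real (card S) * \<delta>" using \<delta> by (simp add: left_diff_distrib)
qed

lemma Lp_norm_lower_bound:
  fixes y :: "real \<Rightarrow> dseq"
  assumes p: "1 \<le> p" and I: "I \<in> sets lebesgue" and y: "Lp_fun X (lqr_norm q r) p (lebesgue_on I) y"
    and J: "J \<in> sets borel" "J \<subseteq> I" and c: "0 \<le> c" and le: "AE t in lebesgue. t \<in> J \<longrightarrow> c \<le> lqr_norm q r (y t)"
  shows "c * measure lborel J powr (1 / p) \<le> Lp_norm (lqr_norm q r) p (lebesgue_on I) y"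
proof -
  have "ennreal (c powr p) * emeasure lborel J = (\<integral>\<^sup>+t. ennreal (c powr p) * indicator J t \<partial>lebesgue)"
    using J(1) by (subst nn_integral_cmult_indicator) auto
  also have "\<dots> \<le> (\<integral>\<^sup>+t. ennreal (lqr_norm q r (y t) powr p) * indicator I t \<partial>lebesgue)"
  proof (rule nn_integral_mono_AE)
    show "AE t in lebesgue. ennreal (c powr p) * indicator J t \<le> ennreal (lqr_norm q r (y t) powr p) * indicator I t"
      using le
    proof eventually_elim
      case (elim t)
      show ?case
      proof (cases "t \<in> J")
        case True
        then have "c powr p \<le> lqr_norm q r (y t) powr p" using elim c p by (intro powr_mono2) auto
        then show ?thesis using True J(2) by (simp add: ennreal_leI subset_iff)
      qed simp
    qed
  qed
  also have "\<dots> = (\<integral>\<^sup>+t. ennreal (lqr_norm q r (y t) powr p) \<partial>lebesgue_on I)"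
    using I by (simp add: nn_integral_restrict_space)
  finally have "enn2real (ennreal (c powr p) * emeasure lborel J) \<le> enn2real (\<integral>\<^sup>+t. ennreal (lqr_norm q r (y t) powr p) \<partial>lebesgue_on I)"
    using y by (intro enn2real_mono) (auto simp: Lp_fun_def)
  then have "c powr p * measure lborel J \<le> enn2real (\<integral>\<^sup>+t. ennreal (lqr_norm q r (y t) powr p) \<partial>lebesgue_on I)"
    by (simp add: enn2real_mult measure_def)
  then have "(c powr p * measure lborel J) powr (1 / p) \<le> Lp_norm (lqr_norm q r) p (lebesgue_on I) y"
    unfolding Lp_norm_def using p by (intro powr_mono2) auto
  then show ?thesis using p c by (simp add: powr_mult powr_powr)
qed

text \<open>
  This is the failure of the maximal inequality in \<open>L\<^sup>p(\<ell>\<^sup>1)\<close>: the indicators of the cells of a fine grid add up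
  to \<open>1\<close>, but their maximal functions to the logarithm of the number of cells. The \<open>N\<close> indices of the
  window \<open>W\<close> make the maximal function visible, since the cells at distance between \<open>2\<^sup>-\<^sup>n\<^sup>-\<^sup>1\<close> and \<open>2\<^sup>-\<^sup>n\<close> use the
  entry \<open>n\<close>. The price is a factor \<open>N\<^sup>1\<^sup>/\<^sup>r\<close> in the norm of \<open>f\<close>, which is less than the gain \<open>N\<close> if \<open>r > 1\<close>.
\<close>

theorem not_maximal_regularity_l1:
  fixes I :: "real set"
  assumes p: "1 \<le> p" and r: "1 < r" and I: "I = {0<..} \<or> (\<exists>T>0. I = {0<..<T})"
  shows "\<not> maximal_Lp_regularity (lqr_space 1 r) (lqr_norm 1 r) (diag_dom 1 r) diag_op diag_semigroup p I"
proof
  let ?X = "lqr_space 1 r" and ?N = "lqr_norm 1 r"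
  assume "maximal_Lp_regularity ?X ?N (diag_dom 1 r) diag_op diag_semigroup p I"
  then obtain C where C: "\<And>f. Lp_fun ?X ?N p (lebesgue_on I) f \<Longrightarrow>
      Lp_fun ?X ?N p (lebesgue_on I) (\<lambda>t. diag_op (mild_solution ?X ?N diag_semigroup f t)) \<and>
      Lp_norm ?N p (lebesgue_on I) (\<lambda>t. diag_op (mild_solution ?X ?N diag_semigroup f t)) \<le> C * Lp_norm ?N p (lebesgue_on I) f"
    unfolding maximal_Lp_regularity_def by blast
  have q1: "(1 :: real) \<le> 1" and r1: "1 \<le> r" using r by simp_all
  have adm: "initial_interval I" using I by (auto simp: initial_interval_def)
  then have IL: "I \<in> sets lebesgue" by (auto simp: initial_interval_def)
  obtain k :: nat where k: "{0<..2 * (1 / 2) ^ k} \<subseteq> I" using dyadic_interval_subset[OF I] .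
  define \<tau> :: real where "\<tau> = (1 / 2) ^ k"
  have \<tau>: "0 < \<tau>" by (simp add: \<tau>_def)
  have \<tau>I: "{0<..<2 * \<tau>} \<subseteq> I" using k by (auto simp: \<tau>_def subset_iff)
  \<comment> \<open>the constant left over when \<open>f\<close> is estimated on \<open>(0, 2 \<tau>)\<close> and \<open>A u\<^sub>f\<close> on \<open>(\<tau>, 2 \<tau>)\<close>\<close>
  define D where "D = 2 * exp 2 * (C * (2 * \<tau>) powr (1 / p) / \<tau> powr (1 / p))"
  have "real N powr (1 - 1 / r) \<le> D" if N: "N \<ge> 1" for N :: nat
  proof -
    define W where "W = {k..<k + N}"
    \<comment> \<open>The two cells lost at the ends of an interval of length \<open>2\<^sup>-\<^sup>n\<^sup>-\<^sup>1\<close> then make up at most half of it.\<close>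
    define \<delta> :: real where "\<delta> = (1 / 2) ^ (k + N + 2)"
    have \<delta>: "0 < \<delta>" by (simp add: \<delta>_def)
    have \<delta>_le: "4 * \<delta> \<le> (1 / 2) ^ (n + 1)" if "n \<in> W" for n
    proof -
      have "4 * \<delta> = (1 / 2) ^ (k + N)" by (simp add: \<delta>_def)
      also have "\<dots> \<le> (1 / 2 :: real) ^ (n + 1)"
        using that by (intro power_decreasing) (auto simp: W_def)
      finally show ?thesis .
    qed
    define f :: "real \<Rightarrow> dseq" where
      "f t = (if t \<in> {0<..<2 * \<tau>} then (\<lambda>m n. if m = nat \<lfloor>t / \<delta>\<rfloor> \<and> n \<in> W then 1 else 0) else 0)" for t
    have f_coord: "f t m n = (if n \<in> W \<and> t \<in> {0<..<2 * \<tau>} \<and> real m = real_of_int \<lfloor>t / \<delta>\<rfloor> then 1 else 0)" for t m n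
    proof -
      have "m = nat \<lfloor>t / \<delta>\<rfloor> \<longleftrightarrow> real m = real_of_int \<lfloor>t / \<delta>\<rfloor>" if "0 < t"
      proof -
        have "0 \<le> \<lfloor>t / \<delta>\<rfloor>" using that \<delta> by simp
        then show ?thesis by linarith
      qed
      then show ?thesis by (auto simp: f_def)
    qed
    have f1: "(\<lambda>t. f t m n) \<in> borel_measurable borel" for m n
      unfolding f_coord by measurable
    have f2: "f t \<in> ?X" for t
      by (rule finite_support_in_lqr[of "{nat \<lfloor>t / \<delta>\<rfloor>} \<times> W"]) (auto simp: f_def W_def)
    have f3: "?N (f t) = (if t \<in> {0<..<2 * \<tau>} then real N powr (1 / r) else 0)" for t
      using lqr_norm_single_row[OF r1, of W] by (simp add: f_def lqr_norm_zero W_def)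
    have fL: "Lp_fun ?X ?N p (lebesgue_on I) f"
      and fN: "Lp_norm ?N p (lebesgue_on I) f = real N powr (1 / r) * measure lborel {0<..<2 * \<tau>} powr (1 / p)"
      by (rule Lp_test_function[OF q1 r1 p IL _ \<tau>I _ _ f1 f2 f3]; use \<tau> in simp)+
    define y where "y t = diag_op (mild_solution ?X ?N diag_semigroup f t)" for t
    have yL: "Lp_fun ?X ?N p (lebesgue_on I) y"
      and yN: "Lp_norm ?N p (lebesgue_on I) y \<le> C * Lp_norm ?N p (lebesgue_on I) f"
      using C[OF fL] by (simp_all add: y_def[abs_def])
    have yX: "AE t in lebesgue. t \<in> I \<longrightarrow> y t \<in> ?X"
      using yL IL by (simp add: Lp_fun_def strongly_measurable_def AE_restrict_space_iff)
    define c where "c = real N * (exp (- 2) / 2)"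
    have y_le: "c \<le> ?N (y t)" if t: "t \<in> {\<tau><..<2 * \<tau>}" and X: "y t \<in> ?X" for t
    proof -
      have tI: "t \<in> I" using \<tau>I t \<tau> by auto
      have t0: "0 < t" using t \<tau> by auto
      define S where "S n = {m :: nat. t - (1 / 2) ^ n \<le> real m * \<delta> \<and> real (Suc m) * \<delta> \<le> t - (1 / 2) ^ (n + 1)}" for n :: nat
      have pow_le: "(1 / 2 :: real) ^ n \<le> \<tau>" if "n \<in> W" for n
        unfolding \<tau>_def using that by (intro power_decreasing) (auto simp: W_def)
      have card_S: "finite (S n)" "(1 / 2) ^ (n + 1) - 2 * \<delta> \<le> real (card (S n)) * \<delta>" if n: "n \<in> W" for n
      proof -
        have "0 \<le> t - (1 / 2) ^ n" using pow_le[OF n] t by simp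
        note count = count_grid_cells[OF \<delta> this, where b = "t - (1 / 2) ^ (n + 1)"]
        show "finite (S n)" unfolding S_def by (rule count(1))
        show "(1 / 2) ^ (n + 1) - 2 * \<delta> \<le> real (card (S n)) * \<delta>"
          using count(2) unfolding S_def by simp
      qed
      have S_disj: False if "m \<in> S n" "m \<in> S n'" "n + 1 \<le> n'" for m n n'
      proof -
        have "(1 / 2 :: real) ^ n' \<le> (1 / 2) ^ (n + 1)" using that(3) by (intro power_decreasing) auto
        moreover have "t - (1 / 2) ^ n' \<le> real m * \<delta>" "real (Suc m) * \<delta> \<le> t - (1 / 2) ^ (n + 1)"
          using that by (auto simp: S_def)
        moreover have "real (Suc m) * \<delta> = real m * \<delta> + \<delta>" by (simp add: algebra_simps)
        ultimately show False using \<delta> by linarith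
      qed
      have S_unique: "n = n'" if "m \<in> S n" "m \<in> S n'" for m n n'
        using S_disj[OF that] S_disj[OF that(2,1)] by (cases n n' rule: linorder_cases) auto
      have coord: "2 ^ (n + 1) * exp (- 2) * \<delta> \<le> norm (y t m n)" if n: "n \<in> W" and m: "m \<in> S n" for m n
      proof -
        let ?B = "{s. s \<in> {0<..<2 * \<tau>} \<and> real m = real_of_int \<lfloor>s / \<delta>\<rfloor>}"
        let ?B' = "{real m * \<delta><..<real (Suc m) * \<delta>}"
        have m1: "t - (1 / 2) ^ n \<le> real m * \<delta>" and m2: "real (Suc m) * \<delta> \<le> t - (1 / 2) ^ (n + 1)"
          using m by (auto simp: S_def)
        have B't: "?B' \<subseteq> {0<..<t}"
        proof
          fix s assume s: "s \<in> ?B'"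
          have "0 \<le> real m * \<delta>" using \<delta> by simp
          moreover have "0 < (1 / 2 :: real) ^ (n + 1)" by simp
          ultimately show "s \<in> {0<..<t}"
            using s m2 unfolding greaterThanLessThan_iff by linarith
        qed
        have "2 ^ (n + 1) * exp (- 2) * measure lborel ?B'
          \<le> norm (2 ^ (n + 1) * (\<integral>s. complex_of_real (exp (- (2 ^ (n + 1)) * (t - s))) * f s m n \<partial>lebesgue_on {0<..<t}))"
        proof (rule mild_coordinate_lower_bound)
          show "?B \<in> sets borel" by measurable
          show "f s m n = (if s \<in> ?B then 1 else 0)" for s using n by (simp add: f_coord)
          show "?B' \<subseteq> ?B"
          proof
            fix s assume s: "s \<in> ?B'"
            then have "real m < s / \<delta>" "s / \<delta> < real m + 1" using \<delta> by (auto simp: field_simps)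
            then have "\<lfloor>s / \<delta>\<rfloor> = int m" by linarith
            moreover have "s \<in> {0<..<2 * \<tau>}"
            proof -
              have "s \<in> {0<..<t}" using B't s by blast
              then show ?thesis using t by simp
            qed
            ultimately show "s \<in> ?B" by simp
          qed
          fix s assume s: "s \<in> ?B'"
          then have "t - s \<le> (1 / 2) ^ n" using m1 unfolding greaterThanLessThan_iff by linarith
          then have "2 ^ n * (t - s) \<le> 2 ^ n * (1 / 2) ^ n" by (intro mult_left_mono) auto
          then show "2 ^ n * (t - s) \<le> 1" by (simp add: power_divide)
        qed (use t0 B't in auto)
        also have "\<dots> = norm (y t m n)"
          unfolding y_def mild_solution_lqr(1)[OF q1 r1 p adm fL tI] diag_op_def by (rule refl)
        also have "measure lborel ?B' = \<delta>"
          using \<delta> by (simp add: algebra_simps)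
        finally show ?thesis .
      qed
      have "c = (\<Sum>n\<in>W. exp (- 2) / 2)" by (simp add: c_def W_def)
      also have "\<dots> \<le> (\<Sum>n\<in>W. \<Sum>m\<in>S n. norm (y t m n))"
      proof (rule sum_mono)
        fix n assume n: "n \<in> W"
        have "(1 / 2) ^ (n + 1) / 2 \<le> real (card (S n)) * \<delta>"
          using card_S(2)[OF n] \<delta>_le[OF n] by linarith
        then have le: "2 ^ (n + 1) * exp (- 2) * ((1 / 2) ^ (n + 1) / 2) \<le> 2 ^ (n + 1) * exp (- 2) * (real (card (S n)) * \<delta>)"
          by (intro mult_left_mono) auto
        have "exp (- 2 :: real) / 2 = 2 ^ (n + 1) * exp (- 2) * ((1 / 2) ^ (n + 1) / 2)"
          by (simp add: power_divide)
        also note le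
        also have "2 ^ (n + 1) * exp (- 2) * (real (card (S n)) * \<delta>) = (\<Sum>m\<in>S n. 2 ^ (n + 1) * exp (- 2) * \<delta>)"
          by (simp only: sum_constant of_nat_id mult_ac)
        also have "\<dots> \<le> (\<Sum>m\<in>S n. norm (y t m n))" by (intro sum_mono coord n)
        finally show "exp (- 2) / 2 \<le> (\<Sum>m\<in>S n. norm (y t m n))" .
      qed
      also have "\<dots> \<le> ?N (y t)"
        by (rule lqr_norm_disjoint_rows[OF r1 X]) (use card_S(1) S_unique in \<open>auto simp: W_def\<close>)
      finally show ?thesis .
    qed
    have "c * measure lborel {\<tau><..<2 * \<tau>} powr (1 / p) \<le> Lp_norm ?N p (lebesgue_on I) y"
    proof (rule Lp_norm_lower_bound[OF p IL yL])
      show "{\<tau><..<2 * \<tau>} \<subseteq> I" using \<tau>I \<tau> by auto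
      then show "AE t in lebesgue. t \<in> {\<tau><..<2 * \<tau>} \<longrightarrow> c \<le> ?N (y t)"
        using yX by (auto intro: y_le elim!: eventually_mono)
    qed (auto simp: c_def)
    also have "\<dots> \<le> C * (real N powr (1 / r) * (2 * \<tau>) powr (1 / p))"
      using yN \<tau> by (simp add: fN)
    finally have "c * \<tau> powr (1 / p) \<le> C * (real N powr (1 / r) * (2 * \<tau>) powr (1 / p))"
      using \<tau> by simp
    then have "real N * (exp (- 2) / 2) \<le> C * (2 * \<tau>) powr (1 / p) / \<tau> powr (1 / p) * real N powr (1 / r)"
      using \<tau> by (simp add: c_def field_simps)
    then have "real N \<le> D * real N powr (1 / r)"
      by (simp add: D_def exp_minus field_simps)
    then show ?thesis using N by (simp add: powr_diff field_simps)
  qed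
  moreover have "1 - 1 / r > 0" using r by simp
  ultimately show False using powr_unbounded[of "1 - 1 / r" D] by (metis not_less)
qed

theorem corollary3p5:
  fixes p q r :: real and I :: "real set"
  assumes "p \<ge> 1" "q \<ge> 1" "r \<ge> 1"
    and "I = {0<..} \<or> (\<exists>T>0. I = {0<..<T})"
  shows "maximal_Lp_regularity (lqr_space q r) (lqr_norm q r) (diag_dom q r) diag_op
           diag_semigroup p I
         \<longleftrightarrow> (p > 1 \<and> (q > 1 \<or> r = 1)) \<or> (p = 1 \<and> q = 1 \<and> r = 1)"
proof
  assume *: "maximal_Lp_regularity (lqr_space q r) (lqr_norm q r) (diag_dom q r) diag_op diag_semigroup p I"
  have "\<not> (p = 1 \<and> q > 1)"
    using not_maximal_L1_regularity[OF _ assms(3,4)] * by blast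
  moreover have "\<not> (q = 1 \<and> r > 1)"
    using not_maximal_regularity_l1[OF assms(1) _ assms(4)] * by blast
  ultimately show "(p > 1 \<and> (q > 1 \<or> r = 1)) \<or> (p = 1 \<and> q = 1 \<and> r = 1)"
    using assms(1-3) by linarith
next
  assume "(p > 1 \<and> (q > 1 \<or> r = 1)) \<or> (p = 1 \<and> q = 1 \<and> r = 1)"
  moreover have "initial_interval I" using assms(4) by (auto simp: initial_interval_def)
  ultimately show "maximal_Lp_regularity (lqr_space q r) (lqr_norm q r) (diag_dom q r) diag_op diag_semigroup p I"
    using assms(1-3) by (intro maximal_regularity_if) auto
qed

end
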